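(* Let $\mathbb{F}_q$ be a finite field with $q$ elements and characteristic $p$, let $d\ge 2$ be a composite integer, let $l$ be the smallest prime divisor of $d$, let $D_d$ be the set of decomposable polynomials in $\mathbb{F}_q[x]$ of degree $d$, and set $$\alpha_d=\begin{cases}2q^{l+d/l}(1-q^{-1}) & \text{if } d\neq l^2,\\ q^{2l}(1-q^{-1}) & \text{if } d=l^2.\end{cases}$$ Then: (1) $q^{2\sqrt d}/2\le \alpha_d<2q^{d/2+2}$. (2) $\alpha_d/2\le \#D_d\le \alpha_d(1+q^{-d/(3l^2)})<2\alpha_d<4q^{d/2+2}$. (3) If $d\neq p^2$ and $q>5$, then $\#D_d\ge (3-2q^{-1})\alpha_d/4\ge q^{2\sqrt d}/2$. (4) Unless $p=l$ and $p$ divides $d$ exactly twice (i.e. $p^2\mid d$ and $p^3\nmid d$), we have $\#D_d\ge \alpha_d(1-2q^{-1})$. (5) If $p\nmid d$, then $|\#D_d-\alpha_d|\le \alpha_d\, q^{-d/(3l^2)}$.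
   Context: For polynomials $g,h\in F[x]$ over a field $F$, $g\circ h=g(h)$ denotes composition. A polynomial $f\in F[x]$ is decomposable if $f=g\circ h$ for some $g,h\in F[x]$ with $\deg g\ge 2$ and $\deg h\ge 2$. *)

theory Defs
  imports "HOL-Computational_Algebra.Computational_Algebra"
begin

definition decomposable :: "'a::field poly \<Rightarrow> bool" where
  "decomposable f \<longleftrightarrow> (\<exists>g h. f = pcompose g h \<and> degree g \<ge> 2 \<and> degree h \<ge> 2)"

definition decomp_set :: "nat \<Rightarrow> 'a::field poly set" where
  "decomp_set d = {f. degree f = d \<and> decomposable f}"

definition alpha_d :: "nat \<Rightarrow> nat \<Rightarrow> nat \<Rightarrow> real" where
  "alpha_d q d l =
     (if d \<noteq> l^2 then 2 * real q powr (real l + real d / real l) * (1 - 1 / real q)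
      else real q powr (2 * real l) * (1 - 1 / real q))"

end

theory Submission
  imports Defs "HOL-Library.FuncSet" "HOL-Library.Cardinality"
begin

text \<open>
  Splitting off leading coefficients and constants, it suffices to count the compositions $g(h)$ with
  $g$, $h$ monic of degrees $e$, $d/e$ and without constant term. The pairs number $q^{e + d/e - 2}$, and
  a union bound over $e$ gives the upper bound. The lower bounds only use the two extreme cases
  $\{e, d/e\} = \{l, m\}$ with $d = l m$, and need two things: composition is almost injective, and the
  two sets of values hardly meet.

  A collision $g(h) = G(H)$ with $h \neq H$ is controlled by the leading terms of the difference; for
  $p \nmid e$ there are none. In the wild case it forces either an arithmetic relation
  between $e$ and $d/e$ or a relation between the second coefficients, to which the leading
  coefficient of $g'(h) h' = G'(H) H'$ adds another one. Two small cases ($p = 2$, and $l = 2$ with $p = 3$)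
  are settled instead by the translation invariance of $f$.

  The intersection is bounded for $p \nmid l$ by an approximate $l$-th root of $f$: it is determined by $h$ and the
  first $m/l$ coefficients of $g$ for any decomposition $f = g(h)$ with $\deg h = l$. For $p = l$ the degrees of the
  derivative $f'$ in the two sets differ.
\<close>

subsection \<open>Monic polynomials without constant term and collisions\<close>

text \<open>Multiplied by (q - 1) q, the pair count q^(l + m - 2) becomes \<alpha>_d for d = l^2 and
  \<alpha>_d / 2 otherwise. The lower bounds thus ask which share of one, respectively two, full
  families of pairs survives identification. Where the left degree is divisible by p, the second
  coefficient of g is mostly taken nonzero. This costs a share 1/q of the pairs; without it the
  terms of index e - 1 may drop out of the cancellation and control nothing. The obstacle is p = l
  dividing d exactly twice. Right factors of degree p with different second coefficients u, v may
  then collide, and the bound for the number of ordered collisions has the order of the number of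
  pairs: about q^2 choices of (u, v) against two prescribed coefficients. A lost value uses up at
  least two ordered collisions, so about half of the family remains. That half is the 1/2 for d =
  p^2; added to the nearly intact family with left factors of degree p, it gives the 3/2 behind the
  constant (3 - 2/q)/4.\<close>

definition monic_original :: "nat \<Rightarrow> 'a::field poly set" where
  "monic_original k = {f. degree f = k \<and> coeff f k = 1 \<and> coeff f 0 = 0}"

lemma monic_originalD:
  assumes "f \<in> monic_original k"
  shows "degree f = k" "coeff f k = 1" "coeff f 0 = 0"
  using assms by (auto simp: monic_original_def)

lemma card_monic_original_prescribed:
  assumes "n \<ge> 1" and "J \<subseteq> {1..<n}"
  shows "card {f \<in> monic_original n :: 'a::{field,finite} poly set. \<forall>j\<in>J. coeff f j = c j}
         = CARD('a) ^ (n - 1 - card J)"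
    and "finite {f \<in> monic_original n :: 'a::{field,finite} poly set. \<forall>j\<in>J. coeff f j = c j}"
proof -
  let ?S = "{f \<in> monic_original n :: 'a poly set. \<forall>j\<in>J. coeff f j = c j}"
  let ?I = "{1..<n} - J"
  let ?E = "PiE ?I (\<lambda>_. UNIV :: 'a set)"
  define v where "v \<phi> i = (if i = n then 1 else if i = 0 then 0 else if i \<in> J then c i else \<phi> i :: 'a)"
    for \<phi> i
  define mk where "mk \<phi> = Poly (map (v \<phi>) [0..<Suc n])" for \<phi>
  have coeff_mk: "coeff (mk \<phi>) i = (if i \<le> n then v \<phi> i else 0)" for \<phi> i
    unfolding mk_def coeff_Poly_eq by (auto simp: nth_default_def simp del: upt_Suc)
  have nJ: "n \<notin> J" "0 \<notin> J" using assms by auto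
  have mk_in: "mk \<phi> \<in> ?S" for \<phi>
  proof -
    have "degree (mk \<phi>) = n"
    proof (rule antisym)
      show "degree (mk \<phi>) \<le> n" by (rule degree_le) (simp add: coeff_mk)
      show "n \<le> degree (mk \<phi>)" by (rule le_degree) (simp add: coeff_mk v_def)
    qed
    thus ?thesis using assms nJ
      by (auto simp: monic_original_def coeff_mk v_def)
  qed
  have bij: "bij_betw (\<lambda>f. restrict (coeff f) ?I) ?S ?E"
  proof (rule bij_betw_byWitness[where f' = mk])
    show "\<forall>f\<in>?S. mk (restrict (coeff f) ?I) = f"
    proof
      fix f assume f: "f \<in> ?S"
      show "mk (restrict (coeff f) ?I) = f"
        using f by (intro poly_eqI) (auto simp: coeff_mk v_def monic_original_def coeff_eq_0)
    qed
    show "\<forall>\<phi>\<in>?E. restrict (coeff (mk \<phi>)) ?I = \<phi>"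
    proof
      fix \<phi> assume \<phi>: "\<phi> \<in> ?E"
      show "restrict (coeff (mk \<phi>)) ?I = \<phi>"
      proof
        fix i show "restrict (coeff (mk \<phi>)) ?I i = \<phi> i"
          using \<phi> nJ by (auto simp: coeff_mk v_def restrict_def PiE_def extensional_def)
      qed
    qed
    show "(\<lambda>f. restrict (coeff f) ?I) ` ?S \<subseteq> ?E"
      by (intro image_subsetI) (simp only: restrict_PiE_iff, simp)
  qed (use mk_in in blast)
  have fin: "finite ?I" by simp
  have "finite ?E" by (rule finite_PiE) auto
  with bij show "finite ?S" using bij_betw_finite by blast
  have "card ?S = card ?E" using bij by (rule bij_betw_same_card)
  also have "\<dots> = CARD('a) ^ card ?I" using fin by (simp add: card_PiE)
  also have "card ?I = n - 1 - card J"
    using assms by (simp add: card_Diff_subset finite_subset)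
  finally show "card ?S = CARD('a) ^ (n - 1 - card J)" .
qed

lemma card_monic_original:
  assumes "n \<ge> 1"
  shows "card (monic_original n :: 'a::{field,finite} poly set) = CARD('a) ^ (n - 1)"
  using card_monic_original_prescribed(1)[OF assms, of "{}"] by simp

lemma finite_monic_original:
  "finite (monic_original n :: 'a::{field,finite} poly set)"
proof (cases "n = 0")
  case False
  thus ?thesis using card_monic_original_prescribed(2)[of n "{}"] by simp
next
  case True
  hence "monic_original n = ({} :: 'a poly set)" by (auto simp: monic_original_def)
  thus ?thesis by simp
qed

lemma card_monic_original_coeff:
  assumes "1 \<le> j" "j < n"
  shows "card {f \<in> monic_original n :: 'a::{field,finite} poly set. coeff f j = c} = CARD('a) ^ (n - 2)"
  using card_monic_original_prescribed(1)[of n "{j}" "\<lambda>_. c"] assms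
  by (simp add: numeral_2_eq_2)

lemma card_monic_original_coeff_nonzero:
  assumes "1 \<le> j" "j < n"
  shows "card {f \<in> monic_original n :: 'a::{field,finite} poly set. coeff f j \<noteq> 0}
         = (CARD('a) - 1) * CARD('a) ^ (n - 2)"
proof -
  have "{f \<in> monic_original n :: 'a poly set. coeff f j \<noteq> 0}
      = monic_original n - {f \<in> monic_original n. coeff f j = 0}" by auto
  hence "card {f \<in> monic_original n :: 'a poly set. coeff f j \<noteq> 0}
      = CARD('a) ^ (n - 1) - CARD('a) ^ (n - 2)"
    using assms by (simp add: card_Diff_subset finite_monic_original card_monic_original
                      card_monic_original_coeff)
  moreover have "n - 1 = Suc (n - 2)" using assms by linarith
  hence "CARD('a) ^ (n - 1) = CARD('a) * CARD('a) ^ (n - 2)" by (simp only: power_Suc)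
  ultimately show ?thesis by (simp add: diff_mult_distrib)
qed

text \<open>Only degree bounds are assumed, so that the formula also covers vanishing coefficients.
  The comparisons below evaluate both sides of an identity at one common index, where either side
  may vanish.\<close>

lemma coeff_mult_le:
  assumes "degree f \<le> m" "degree g \<le> n"
  shows "coeff (f * g) (m + n) = coeff f m * coeff g n"
proof -
  have "coeff (f * g) (m + n) = (\<Sum>i\<le>m + n. coeff f i * coeff g (m + n - i))"
    by (rule coeff_mult)
  also have "\<dots> = (\<Sum>i\<in>{m}. coeff f i * coeff g (m + n - i))"
  proof (rule sum.mono_neutral_right)
    show "\<forall>i\<in>{..m + n} - {m}. coeff f i * coeff g (m + n - i) = 0"
    proof
      fix i assume "i \<in> {..m + n} - {m}"
      hence "i > m \<or> m + n - i > n" by auto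
      thus "coeff f i * coeff g (m + n - i) = 0" using assms by (auto simp: coeff_eq_0)
    qed
  qed auto
  finally show ?thesis by simp
qed

lemma coeff_power_le:
  fixes f :: "'a::comm_semiring_1 poly"
  assumes "degree f \<le> n"
  shows "coeff (f ^ m) (m * n) = coeff f n ^ m"
proof (induction m)
  case (Suc m)
  have "degree (f ^ m) \<le> m * n"
    using degree_power_le[of f m] assms by (metis mult.commute mult_le_mono1 order_trans)
  from coeff_mult_le[OF assms this] Suc show ?case by simp
qed auto

text \<open>Dividing h^n - H^n by h - H leaves a sum of n monic products of degree (n - 1) k, hence
  the factor n. It is zero if the characteristic divides n, so only a degree bound can be
  claimed.\<close>

lemma power_diff_top:
  fixes h H :: "'a::field poly"
  assumes h: "degree h = k" "coeff h k = 1" and H: "degree H = k" "coeff H k = 1"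
    and n: "n \<ge> 1" and s: "degree (h - H) \<le> s"
  shows "degree (h ^ n - H ^ n) \<le> (n - 1) * k + s"
    and "coeff (h ^ n - H ^ n) ((n - 1) * k + s) = of_nat n * coeff (h - H) s"
proof -
  define S where "S = (\<Sum>i<n. H ^ (n - Suc i) * h ^ i)"
  have eq: "h ^ n - H ^ n = S * (h - H)" unfolding S_def by (simp add: power_diff_sumr2 mult.commute)
  have *: "degree (H ^ (n - Suc i) * h ^ i) \<le> (n - 1) * k
        \<and> coeff (H ^ (n - Suc i) * h ^ i) ((n - 1) * k) = 1" if "i < n" for i
  proof -
    have dH: "degree (H ^ (n - Suc i)) \<le> (n - Suc i) * k" and dh: "degree (h ^ i) \<le> i * k"
      using h(1) H(1) by (metis degree_power_le mult.commute)+
    have e: "(n - Suc i) * k + i * k = (n - 1) * k"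
      using that by (simp flip: add_mult_distrib)
    have cH: "coeff (H ^ (n - Suc i)) ((n - Suc i) * k) = 1" 
      using coeff_power_le[of H k "n - Suc i"] H by simp
    have ch: "coeff (h ^ i) (i * k) = 1" 
      using coeff_power_le[of h k "i"] h by simp
    have "degree (H ^ (n - Suc i) * h ^ i) \<le> (n - Suc i) * k + i * k"
      using degree_mult_le dH dh by (meson add_mono order_trans)
    thus ?thesis using coeff_mult_le[OF dH dh] cH ch unfolding e by simp
  qed
  have dS: "degree S \<le> (n - 1) * k" unfolding S_def
    by (intro degree_sum_le) (use * in auto)
  have cS: "coeff S ((n - 1) * k) = of_nat n"
    unfolding S_def coeff_sum using * by simp
  show "degree (h ^ n - H ^ n) \<le> (n - 1) * k + s"
    unfolding eq using degree_mult_le dS s by (meson add_mono order_trans)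
  show "coeff (h ^ n - H ^ n) ((n - 1) * k + s) = of_nat n * coeff (h - H) s"
    unfolding eq using coeff_mult_le[OF dS s] cS by simp
qed

lemma pcompose_monom: "pcompose (monom c n) h = smult c (h ^ n)"
  for h :: "'a::comm_ring_1 poly"
  by (induction n) (simp_all add: monom_0 monom_Suc pcompose_pCons mult.commute)

lemma pcompose_top_terms:
  fixes g h :: "'a::field poly"
  assumes g: "degree g = e" "coeff g e = 1" and e: "e \<ge> 2"
  obtains r where "degree r \<le> (e - 2) * degree h"
    "pcompose g h = h ^ e + smult (coeff g (e - 1)) (h ^ (e - 1)) + r"
proof -
  define g2 where "g2 = g - monom 1 e - monom (coeff g (e - 1)) (e - 1)"
  have "degree g2 \<le> e - 2"
  proof (rule degree_le, intro allI impI)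
    fix i assume "i > e - 2"
    hence "i = e - 1 \<or> i = e \<or> i > e" by linarith
    thus "coeff g2 i = 0"
      using e g unfolding g2_def by (auto simp: coeff_eq_0)
  qed
  hence "degree (pcompose g2 h) \<le> (e - 2) * degree h"
    by (simp add: degree_pcompose)
  moreover have "pcompose g h = h ^ e + smult (coeff g (e - 1)) (h ^ (e - 1)) + pcompose g2 h"
    unfolding g2_def by (simp add: pcompose_diff pcompose_monom)
  ultimately show ?thesis using that by blast
qed

lemma degree_diff_monic_original:
  assumes "h \<in> monic_original k" "H \<in> monic_original k" "h \<noteq> H"
  shows "1 \<le> degree (h - H)" "degree (h - H) < k"
proof -
  have nz: "h - H \<noteq> 0" using assms by simp
  show "1 \<le> degree (h - H)"
  proof (rule ccontr)
    assume "\<not> 1 \<le> degree (h - H)"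
    hence "degree (h - H) = 0" by simp
    moreover have "coeff (h - H) 0 = 0" using assms by (simp add: monic_originalD)
    ultimately have "lead_coeff (h - H) = 0" by metis
    with nz show False using leading_coeff_0_iff by blast
  qed
  have "degree (h - H) \<le> k" using assms by (intro degree_diff_le) (auto simp: monic_original_def)
  moreover have "degree (h - H) \<noteq> k"
  proof
    assume "degree (h - H) = k"
    moreover have "coeff (h - H) k = 0" using assms by (simp add: monic_originalD)
    ultimately have "lead_coeff (h - H) = 0" by metis
    with nz show False using leading_coeff_0_iff by blast
  qed
  ultimately show "degree (h - H) < k" by simp
qed

lemma prime_CHAR_finite: "prime CHAR('a::{field,finite})"
  by (simp add: finite_imp_CHAR_pos prime_CHAR_semidom)

lemma power_CHAR_power_diff:
  fixes x y :: "'a::{field,finite} poly"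
  shows "(x - y) ^ (CHAR('a) ^ t) = x ^ (CHAR('a) ^ t) - y ^ (CHAR('a) ^ t)"
proof -
  have "((x - y) + y) ^ (CHAR('a) ^ t) = (x - y) ^ (CHAR('a) ^ t) + y ^ (CHAR('a) ^ t)"
    by (rule freshmans_dream'[where n = t]) (simp_all add: prime_CHAR_finite)
  thus ?thesis by (simp add: algebra_simps)
qed

text \<open>If $g(h) = G(H)$ with $h \neq H$, the two leading contributions to $g(h) - G(H)$ come from
  $h^e - H^e = (h^r - H^r)^{p^t}$ and from the terms of index $e - 1$; they have to cancel.\<close>

lemma collision:
  fixes g h G H :: "'a::{field,finite} poly"
  assumes g: "g \<in> monic_original e" and G: "G \<in> monic_original e"
    and h: "h \<in> monic_original k" and H: "H \<in> monic_original k"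
    and eq: "pcompose g h = pcompose G H" and neq: "h \<noteq> H"
    and e: "e = CHAR('a) ^ t * r" "\<not> CHAR('a) dvd r" "e \<ge> 2"
  shows "t \<noteq> 0"
    and "coeff g (e - 1) \<noteq> coeff G (e - 1) \<Longrightarrow>
           CHAR('a) ^ t * (k - degree (h - H)) = k \<and>
           (of_nat r * lead_coeff (h - H)) ^ (CHAR('a) ^ t) + (coeff g (e - 1) - coeff G (e - 1)) = 0"
    and "coeff g (e - 1) = coeff G (e - 1) \<Longrightarrow> coeff g (e - 1) \<noteq> 0 \<Longrightarrow>
           CHAR('a) ^ t * (k - degree (h - H)) = k + (k - degree (h - H))"
proof -
  define P where "P = CHAR('a) ^ t"
  define s where "s = degree (h - H)"
  define i where "i = k - s"
  define a where "a = coeff g (e - 1)"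
  define A where "A = coeff G (e - 1)"
  define \<eta> where "\<eta> = lead_coeff (h - H)"
  have s: "1 \<le> s" "s < k" unfolding s_def using degree_diff_monic_original[OF h H neq] by auto
  have i: "i \<ge> 1" "i < k" "s = k - i" unfolding i_def using s by auto
  have \<eta>: "\<eta> \<noteq> 0" unfolding \<eta>_def using neq by (metis leading_coeff_0_iff right_minus_eq)
  have ePr: "e = P * r" using e unfolding P_def by simp
  have rpos: "r \<ge> 1" and Ppos: "P \<ge> 1" using ePr e(3) by (cases r; cases P; auto)+
  obtain r1 where r1: "degree r1 \<le> (e - 2) * k"
    "pcompose g h = h ^ e + smult a (h ^ (e - 1)) + r1"
    using pcompose_top_terms[OF monic_originalD(1,2)[OF g] e(3), of h] monic_originalD(1)[OF h] unfolding a_def by metis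
  obtain r2 where r2: "degree r2 \<le> (e - 2) * k"
    "pcompose G H = H ^ e + smult A (H ^ (e - 1)) + r2"
    using pcompose_top_terms[OF monic_originalD(1,2)[OF G] e(3), of H] monic_originalD(1)[OF H] unfolding A_def by metis
  define T1 where "T1 = h ^ e - H ^ e"
  define T2 where "T2 = smult a (h ^ (e - 1)) - smult A (H ^ (e - 1))"
  define T3 where "T3 = r1 - r2"
  have zero: "T1 + T2 + T3 = 0"
    using eq r1(2) r2(2) unfolding T1_def T2_def T3_def by (simp add: algebra_simps)
  hence czero: "coeff T1 n + coeff T2 n + coeff T3 n = 0" for n
    by (metis coeff_0 coeff_add)
  have T3: "degree T3 \<le> (e - 2) * k" unfolding T3_def by (intro degree_diff_le r1 r2)
  \<comment> \<open>The degree of \<open>T1\<close>. Measured downwards from e k, \<open>T1\<close>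
    starts at depth P i, \<open>T2\<close> at depth k if a \<noteq> A and at k + i if a = A \<noteq>
    0, and \<open>T3\<close> not before 2 k. Since i < k, \<open>T1\<close> and \<open>T2\<close>
    have to start together; this gives the two equations.\<close>
  define D where "D = P * ((r - 1) * k + s)"
  have Di: "D + P * i = e * k"
  proof -
    have "D + P * i = P * ((r - 1) * k + k)" unfolding D_def using i by (simp flip: add_mult_distrib2)
    also have "(r - 1) * k + k = r * k" using rpos by (cases r) auto
    finally show ?thesis using ePr by simp
  qed
  have T1': "T1 = (h ^ r - H ^ r) ^ P"
    unfolding T1_def P_def power_CHAR_power_diff ePr by (simp add: P_def power_mult mult.commute)
  note pd = power_diff_top[OF monic_originalD(1,2)[OF h] monic_originalD(1,2)[OF H] rpos, of s, OF eq_refl[OF s_def[symmetric]]]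
  have T1_deg: "degree T1 \<le> D"
    unfolding T1' D_def using degree_power_le pd(1) by (metis mult.commute mult_le_mono1 order_trans)
  have T1_c: "coeff T1 D = (of_nat r * \<eta>) ^ P"
    unfolding T1' D_def using coeff_power_le[OF pd(1), of P] pd(2) by (simp add: \<eta>_def s_def)
  have "of_nat r \<noteq> (0::'a)" using e(2) by (simp add: of_nat_eq_0_iff_char_dvd)
  hence T1_nz: "coeff T1 D \<noteq> 0" using T1_c \<eta> by simp
  have ek: "e * k = (e - 1) * k + k" "(e - 1) * k = (e - 2) * k + k"
    using e(3) by (auto simp: numeral_2_eq_2 Suc_le_eq gr0_conv_Suc less_iff_Suc_add)
  have T2_deg: "degree T2 \<le> (e - 1) * k"
    unfolding T2_def using monic_originalD(1)[OF h] monic_originalD(1)[OF H]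
    by (intro degree_diff_le order_trans[OF degree_smult_le])
       (metis degree_power_le mult.commute)+
  have T2_c: "coeff T2 ((e - 1) * k) = a - A"
    unfolding T2_def using coeff_power_le[of h k "e - 1"] coeff_power_le[of H k "e - 1"]
      monic_originalD[OF h] monic_originalD[OF H] by simp
  have neq_case: "P * i = k \<and> (of_nat r * \<eta>) ^ P + (a - A) = 0" if "a \<noteq> A"
  proof -
    have "\<not> P * i < k"
    proof
      assume "P * i < k"
      hence "D > (e - 1) * k" using Di ek by linarith
      hence "coeff T2 D = 0" "coeff T3 D = 0" using T2_deg T3 ek by (auto intro!: coeff_eq_0)
      with czero[of D] T1_nz show False by simp
    qed
    moreover have "\<not> P * i > k"
    proof
      assume "P * i > k"
      hence "D < (e - 1) * k" using Di ek by linarith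
      hence "coeff T1 ((e - 1) * k) = 0" using T1_deg by (auto intro!: coeff_eq_0)
      moreover have "coeff T3 ((e - 1) * k) = 0" using T3 ek i by (auto intro!: coeff_eq_0)
      ultimately show False using czero[of "(e - 1) * k"] T2_c that by simp
    qed
    ultimately have Pik: "P * i = k" by linarith
    hence "D = (e - 1) * k" using Di ek by linarith
    moreover have "coeff T3 ((e - 1) * k) = 0" using T3 ek i by (auto intro!: coeff_eq_0)
    ultimately have "(of_nat r * \<eta>) ^ P + (a - A) = 0"
      using czero[of D] T1_c T2_c by simp
    with Pik show ?thesis by simp
  qed
  have T2_eq: "degree T2 \<le> (e - 2) * k + s"
     "coeff T2 ((e - 2) * k + s) = a * (of_nat (e - 1) * \<eta>)" if "a = A"
  proof -
    have e1: "1 \<le> e - 1" using e(3) by simp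
    have T2: "T2 = smult a (h ^ (e - 1) - H ^ (e - 1))"
      unfolding T2_def that by (simp add: smult_diff_right)
    have e2: "e - 1 - 1 = e - 2" by simp
    note pd2 = power_diff_top[OF monic_originalD(1,2)[OF h] monic_originalD(1,2)[OF H] e1, of s, OF eq_refl[OF s_def[symmetric]], unfolded e2]
    show "degree T2 \<le> (e - 2) * k + s"
      unfolding T2 using order_trans[OF degree_smult_le pd2(1)] by simp
    show "coeff T2 ((e - 2) * k + s) = a * (of_nat (e - 1) * \<eta>)"
      unfolding T2 using pd2(2) by (simp add: \<eta>_def s_def)
  qed
  \<comment> \<open>For P = 1 the term \<open>T1\<close> starts at depth i < k, above everything
    that could cancel it.\<close>
  show "t \<noteq> 0"
  proof
    assume "t = 0"
    hence P1: "P = 1" unfolding P_def by simp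
    have "a = A" using neq_case P1 i by auto
    have "D > (e - 2) * k + s" using Di ek P1 i by simp
    hence "coeff T2 D = 0" "coeff T3 D = 0" using T2_eq(1)[OF \<open>a = A\<close>] T3
      by (auto intro!: coeff_eq_0)
    with czero[of D] T1_nz show False by simp
  qed
  hence "CHAR('a) dvd e" unfolding e(1) by auto
  hence "\<not> CHAR('a) dvd (e - 1)" using e(3)
    by (metis prime_CHAR_finite One_nat_def Suc_diff_Suc diff_zero dvd_add_right_iff Suc_eq_plus1
        less_le_trans nat_dvd_1_iff_1 not_prime_1 pos2)
  hence e1nz: "of_nat (e - 1) \<noteq> (0::'a)" using of_nat_eq_0_iff_char_dvd by blast
  have eq_case: "P * i = k + i" if "a = A" "a \<noteq> 0"
  proof -
    have "\<not> P * i < k + i"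
    proof
      assume "P * i < k + i"
      hence "D > (e - 2) * k + s" using Di ek i by linarith
      hence "coeff T2 D = 0" "coeff T3 D = 0" using T2_eq(1)[OF \<open>a = A\<close>] T3
        by (auto intro!: coeff_eq_0)
      with czero[of D] T1_nz show False by simp
    qed
    moreover have "\<not> P * i > k + i"
    proof
      assume "P * i > k + i"
      hence "D < (e - 2) * k + s" using Di ek i by linarith
      hence "coeff T1 ((e - 2) * k + s) = 0" using T1_deg by (auto intro!: coeff_eq_0)
      moreover have "coeff T3 ((e - 2) * k + s) = 0" using T3 s by (auto intro!: coeff_eq_0)
      ultimately show False using czero[of "(e - 2) * k + s"] T2_eq(2)[OF \<open>a = A\<close>] that e1nz \<eta>
        by simp
    qed
    ultimately show ?thesis by linarith
  qed
  show "coeff g (e - 1) \<noteq> coeff G (e - 1) \<Longrightarrow>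
           CHAR('a) ^ t * (k - degree (h - H)) = k \<and>
           (of_nat r * lead_coeff (h - H)) ^ (CHAR('a) ^ t) + (coeff g (e - 1) - coeff G (e - 1)) = 0"
    using neq_case unfolding a_def A_def P_def i_def s_def \<eta>_def by blast
  show "coeff g (e - 1) = coeff G (e - 1) \<Longrightarrow> coeff g (e - 1) \<noteq> 0 \<Longrightarrow>
           CHAR('a) ^ t * (k - degree (h - H)) = k + (k - degree (h - H))"
    using eq_case unfolding a_def A_def P_def i_def s_def by blast
qed

subsection \<open>Counting compositions\<close>

lemma degree_add_const [simp]: "degree (f + [:b:]) = degree (f :: 'a::field poly)"
proof (cases "degree f = 0")
  case True
  then obtain a where "f = [:a:]" by (rule degree_eq_zeroE)
  thus ?thesis by simp
next
  case False
  thus ?thesis by (intro degree_add_eq_left) simp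
qed

lemma degree_diff_const [simp]: "degree (f - [:b:]) = degree (f :: 'a::field poly)"
proof -
  have "f - [:b:] = f + [:- b:]" by simp
  thus ?thesis by (simp only: degree_add_const)
qed

lemma pcompose_monic_original:
  assumes g: "g \<in> monic_original e" and h: "h \<in> monic_original k" and k: "k \<ge> 1"
  shows "pcompose g h \<in> monic_original (e * k)"
proof -
  have "degree (pcompose g h) = e * k"
    using g h by (simp add: degree_pcompose monic_originalD)
  moreover have "lead_coeff (pcompose g h) = 1"
    using lead_coeff_comp[of h g] g h k by (simp add: monic_originalD)
  moreover have "coeff (pcompose g h) 0 = 0"
    using g h by (simp add: monic_originalD poly_0_coeff_0)
  ultimately show ?thesis by (simp add: monic_original_def)
qed

lemma pcompose_left_cancel:
  fixes g G h :: "'a::field poly"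
  assumes "pcompose g h = pcompose G h" "degree h > 0"
  shows "g = G"
  using pcompose_eq_0[of "g - G" h] assms by (simp add: pcompose_diff)

lemma inj_on_pcompose_tame:
  assumes e: "\<not> CHAR('a) dvd e" "e \<ge> 2" and k: "k \<ge> 1"
  shows "inj_on (\<lambda>(g, h). pcompose g h :: 'a::{field,finite} poly) (monic_original e \<times> monic_original k)"
proof (rule inj_onI, clarify)
  fix g h G H :: "'a poly"
  assume A: "g \<in> monic_original e" "h \<in> monic_original k" "G \<in> monic_original e"
    "H \<in> monic_original k" "pcompose g h = pcompose G H"
  have "h = H"
    using collision(1)[of g e G h k H 0 e] A e by auto
  with A k show "g = G \<and> h = H" using pcompose_left_cancel[of g h G] by (auto simp: monic_originalD)
qed

text \<open>The last two hypotheses deny the relations P i = k and P i = k + i that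
  \<open>collision\<close> leaves open for the gap i = k - degree (h - H). The second relation is
  available because the second coefficient of g is nonzero.\<close>

lemma inj_on_pcompose_wild:
  assumes e: "e = CHAR('a) ^ t * r" "\<not> CHAR('a) dvd r" "e \<ge> 2" and k: "k \<ge> 1"
    and "\<not> CHAR('a) ^ t dvd k" and "\<And>i. 1 \<le> i \<Longrightarrow> i < k \<Longrightarrow> CHAR('a) ^ t * i \<noteq> k + i"
  shows "inj_on (\<lambda>(g, h). pcompose g h :: 'a::{field,finite} poly)
           ({g \<in> monic_original e. coeff g (e - 1) \<noteq> 0} \<times> monic_original k)"
proof (rule inj_onI, clarify)
  fix g h G H :: "'a poly"
  assume A: "g \<in> monic_original e" "h \<in> monic_original k" "G \<in> monic_original e"
    "H \<in> monic_original k" "pcompose g h = pcompose G H" "coeff g (e - 1) \<noteq> 0"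
  have "h = H"
  proof (rule ccontr)
    assume neq: "h \<noteq> H"
    note c = collision[OF A(1,3,2,4,5) neq e]
    have "coeff g (e - 1) = coeff G (e - 1)"
      using c(2) assms(5) by (metis dvd_triv_left)
    moreover have "1 \<le> k - degree (h - H)" "k - degree (h - H) < k"
      using degree_diff_monic_original[OF A(2,4) neq] by linarith+
    ultimately show False using c(3) A(6) assms(6) by blast
  qed
  with A k show "g = G \<and> h = H" using pcompose_left_cancel[of g h G] by (auto simp: monic_originalD)
qed

section \<open>Composition sets for a fixed pair of degrees and their sizes\<close>

definition compositions :: "nat \<Rightarrow> nat \<Rightarrow> 'a::field poly set" where
  "compositions e k = (\<lambda>(g, h). pcompose g h) ` (monic_original e \<times> monic_original k)"

lemma compositionsE:
  assumes "f \<in> compositions e k"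
  obtains g h where "g \<in> monic_original e" "h \<in> monic_original k" "f = pcompose g h"
  using assms unfolding compositions_def by auto

lemma finite_compositions: "finite (compositions e k :: 'a::{field,finite} poly set)"
  unfolding compositions_def by (intro finite_imageI finite_cartesian_product finite_monic_original)

lemma card_monic_original_Times:
  assumes "e \<ge> 1" "k \<ge> 1"
  shows "card (monic_original e \<times> monic_original k :: ('a::{field,finite} poly \<times> 'a poly) set)
         = CARD('a) ^ (e + k - 2)"
proof -
  have "(e - 1) + (k - 1) = e + k - 2" using assms by linarith
  thus ?thesis
    unfolding card_cartesian_product card_monic_original[OF assms(1)] card_monic_original[OF assms(2)]
    by (simp only: flip: power_add)
qed

lemma card_compositions_le:
  assumes "e \<ge> 1" "k \<ge> 1"
  shows "card (compositions e k :: 'a::{field,finite} poly set) \<le> CARD('a) ^ (e + k - 2)"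
  unfolding compositions_def
  by (rule order_trans[OF card_image_le])
     (simp_all only: card_monic_original_Times[OF assms] finite_cartesian_product finite_monic_original order_refl)

lemma card_compositions_tame:
  assumes "\<not> CHAR('a) dvd e" "e \<ge> 2" "k \<ge> 1"
  shows "card (compositions e k :: 'a::{field,finite} poly set) = CARD('a) ^ (e + k - 2)"
  unfolding compositions_def card_image[OF inj_on_pcompose_tame[OF assms]]
  using assms by (simp add: card_monic_original_Times)

lemma card_compositions_wild:
  assumes e: "e = CHAR('a) ^ t * r" "\<not> CHAR('a) dvd r" "e \<ge> 2" and k: "k \<ge> 1"
    and "\<not> CHAR('a) ^ t dvd k" and "\<And>i. 1 \<le> i \<Longrightarrow> i < k \<Longrightarrow> CHAR('a) ^ t * i \<noteq> k + i"
  shows "(CARD('a) - 1) * CARD('a) ^ (e + k - 3) \<le> card (compositions e k :: 'a::{field,finite} poly set)"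
proof -
  let ?P = "{g \<in> monic_original e :: 'a poly set. coeff g (e - 1) \<noteq> 0} \<times> (monic_original k :: 'a poly set)"
  have "card ?P = (CARD('a) - 1) * CARD('a) ^ (e - 2) * CARD('a) ^ (k - 1)"
    using assms by (simp add: card_cartesian_product card_monic_original card_monic_original_coeff_nonzero)
  also have "\<dots> = (CARD('a) - 1) * CARD('a) ^ (e + k - 3)"
    using e(3) k by (simp add: mult.assoc flip: power_add)
  finally have "(CARD('a) - 1) * CARD('a) ^ (e + k - 3) = card ((\<lambda>(g, h). pcompose g h) ` ?P)"
    by (simp only: card_image[OF inj_on_pcompose_wild[OF assms]])
  also have "\<dots> \<le> card (compositions e k :: 'a poly set)"
    by (rule card_mono[OF finite_compositions]) (auto simp: compositions_def)
  finally show ?thesis .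
qed

section \<open>Reduction to decomposable polynomials that are monic without constant term\<close>

definition monic_decomposables :: "nat \<Rightarrow> 'a::field poly set" where
  "monic_decomposables d = {f \<in> monic_original d. decomposable f}"

lemma monic_decomposables_eq:
  assumes "d \<ge> 1"
  shows "monic_decomposables d = (\<Union>e\<in>{e. e dvd d \<and> 1 < e \<and> e < d}. compositions e (d div e))"
proof (intro set_eqI iffI)
  fix f assume "f \<in> monic_decomposables d"
  then obtain g h where f: "f \<in> monic_original d" "f = pcompose g h" "degree g \<ge> 2" "degree h \<ge> 2"
    by (auto simp: monic_decomposables_def decomposable_def)
  define c where "c = lead_coeff h"
  define b where "b = coeff h 0"
  have c: "c \<noteq> 0" using f(4) unfolding c_def by (metis degree_0 leading_coeff_0_iff not_numeral_le_zero)
  \<comment> \<open>h is the affine map b + c x after a monic \<open>H\<close> without constant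
    term; the affine map moves into the left factor.\<close>
  define H where "H = smult (inverse c) (h - [:b:])"
  define G where "G = pcompose g [:b, c:]"
  have dH: "degree H = degree h"
    unfolding H_def using c f(4) by simp
  have "coeff [:b:] (degree h) = 0" using f(4) by (intro coeff_eq_0) simp
  hence "coeff H (degree h) = inverse c * c" by (simp add: H_def c_def)
  hence "coeff H (degree h) = 1" using c by simp
  moreover have "coeff H 0 = 0" by (simp add: H_def b_def)
  ultimately have H: "H \<in> monic_original (degree h)" using dH by (simp add: monic_original_def)
  have "pcompose [:b, c:] H = h" unfolding H_def using c by (simp add: pcompose_pCons)
  hence fG: "f = pcompose G H" unfolding G_def f(2) by (simp flip: pcompose_assoc)
  have dG: "degree G = degree g" unfolding G_def using c by (simp add: degree_pcompose)
  have dd: "d = degree g * degree h"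
    using f(1,2) by (simp add: monic_original_def degree_pcompose)
  have "lead_coeff f = lead_coeff G"
    using lead_coeff_comp[of H G] H f(4) unfolding fG by (simp add: monic_originalD)
  hence "coeff G (degree g) = 1" using f(1) dG by (simp add: monic_original_def)
  moreover have "coeff G 0 = 0"
    using monic_originalD(3)[OF f(1)] H unfolding fG by (simp add: monic_originalD poly_0_coeff_0)
  ultimately have "G \<in> monic_original (degree g)" using dG by (simp add: monic_original_def)
  with H fG have "f \<in> compositions (degree g) (d div degree g)"
    using f(3) unfolding compositions_def dd by auto
  moreover have "degree g dvd d" "1 < degree g" "degree g < d" using f(3,4) unfolding dd by auto
  ultimately show "f \<in> (\<Union>e\<in>{e. e dvd d \<and> 1 < e \<and> e < d}. compositions e (d div e))" by blast
next
  fix f :: "'a poly" assume "f \<in> (\<Union>e\<in>{e. e dvd d \<and> 1 < e \<and> e < d}. compositions e (d div e))"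
  then obtain e where e: "e dvd d" "1 < e" "e < d" and "f \<in> compositions e (d div e)" by blast
  then obtain g h where
    gh: "g \<in> monic_original e" "h \<in> monic_original (d div e)" "f = pcompose g h"
    using compositionsE by blast
  from e have de: "e * (d div e) = d" by simp
  with e have "d div e \<noteq> 0" "d div e \<noteq> 1" by auto
  hence k: "d div e \<ge> 2" by linarith
  hence "f \<in> monic_original d" using pcompose_monic_original[OF gh(1,2)] gh(3) de by simp
  moreover have "decomposable f"
    unfolding decomposable_def gh(3) using gh(1,2) k e
    by (intro exI[of _ g] exI[of _ h]) (auto simp: monic_originalD)
  ultimately show "f \<in> monic_decomposables d" by (simp add: monic_decomposables_def)
qed

lemma decomposable_affine:
  fixes f :: "'a::field poly"
  assumes "decomposable f" "c \<noteq> 0"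
  shows "decomposable (smult c f + [:b:])"
proof -
  obtain g h where f: "f = pcompose g h" "degree g \<ge> 2" "degree h \<ge> 2"
    using assms by (auto simp: decomposable_def)
  have "smult c f + [:b:] = pcompose (smult c g + [:b:]) h"
    by (simp add: f pcompose_add pcompose_smult)
  moreover have "degree (smult c g + [:b:]) = degree g"
    using f(2) assms(2) by (simp add: degree_add_eq_left)
  ultimately show ?thesis using f unfolding decomposable_def by metis
qed

text \<open>Affine maps c x + b with c \<noteq> 0, composed from the left, preserve decomposability
  and act freely; each orbit contains exactly one monic polynomial without constant term.\<close>

lemma card_decomp_set:
  assumes "d \<ge> 1"
  shows "card (decomp_set d :: 'a::{field,finite} poly set)
         = (CARD('a) - 1) * CARD('a) * card (monic_decomposables d :: 'a poly set)"
proof -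
  let ?A = "(UNIV - {0::'a}) \<times> (UNIV :: 'a set) \<times> (monic_decomposables d :: 'a poly set)"
  let ?f = "\<lambda>(c, b, f). smult c f + [:b:] :: 'a poly"
  let ?g = "\<lambda>f. (coeff f d, coeff f 0, smult (inverse (coeff f d)) (f - [:coeff f 0:]))"
  have "bij_betw ?f ?A (decomp_set d)"
  proof (rule bij_betw_byWitness[where f' = ?g])
    show "\<forall>a\<in>?A. ?g (?f a) = a"
      using assms by (auto simp: monic_decomposables_def monic_original_def coeff_pCons split: nat.splits)
    show "\<forall>a\<in>decomp_set d. ?f (?g a) = a"
    proof
      fix f :: "'a poly" assume "f \<in> decomp_set d"
      hence "coeff f d \<noteq> 0" using assms
        by (metis (mono_tags, lifting) decomp_set_def degree_0 leading_coeff_0_iff mem_Collect_eq not_one_le_zero)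
      thus "?f (?g f) = f" by simp
    qed
    show "?f ` ?A \<subseteq> decomp_set d"
    proof (rule image_subsetI)
      fix t assume "t \<in> ?A"
      then obtain c b f where t: "t = (c, b, f)" and A: "f \<in> monic_decomposables d" "c \<noteq> 0"
        by blast
      hence "degree f = d" "decomposable f" by (auto simp: monic_decomposables_def monic_original_def)
      thus "?f t \<in> decomp_set d"
        using decomposable_affine[of f c b] A by (simp add: t decomp_set_def)
    qed
    show "?g ` decomp_set d \<subseteq> ?A"
    proof (rule image_subsetI)
      fix f :: "'a poly" assume f: "f \<in> decomp_set d"
      hence d: "degree f = d" "decomposable f" by (auto simp: decomp_set_def)
      have nz: "coeff f d \<noteq> 0" using assms d
        by (metis degree_0 leading_coeff_0_iff not_one_le_zero)
      let ?F = "smult (inverse (coeff f d)) (f - [:coeff f 0:])"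
      have "?F = smult (inverse (coeff f d)) f + [:- inverse (coeff f d) * coeff f 0:]"
        by (simp add: smult_diff_right)
      hence "decomposable ?F" using decomposable_affine[OF d(2)] nz by (metis inverse_nonzero_iff_nonzero)
      moreover have "degree ?F = d" using nz d assms by simp
      moreover have "coeff [:coeff f 0:] d = 0" using assms by (cases d) auto
      hence "coeff ?F d = 1" "coeff ?F 0 = 0" using nz by simp_all
      ultimately have "?F \<in> monic_decomposables d"
        by (simp add: monic_decomposables_def monic_original_def)
      thus "?g f \<in> ?A" using nz by blast
    qed
  qed
  hence "card (decomp_set d :: 'a poly set) = card ?A" by (simp add: bij_betw_same_card)
  thus ?thesis by (simp add: card_cartesian_product card_Diff_subset)
qed

text \<open>A fibre with n elements loses n - 1 values and carries n (n - 1) \<ge> 2 (n - 1) ordered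
  collisions. In the induction, a new element that hits an old value adds two ordered
  collisions.\<close>

lemma card_image_plus_collisions:
  assumes "finite P"
  shows "2 * card P \<le> 2 * card (\<phi> ` P) + card {(x, y). x \<in> P \<and> y \<in> P \<and> x \<noteq> y \<and> \<phi> x = \<phi> y}"
  using assms
proof (induction P rule: finite_induct)
  case (insert x P)
  let ?C = "\<lambda>P. {(x, y). x \<in> P \<and> y \<in> P \<and> x \<noteq> y \<and> \<phi> x = \<phi> y}"
  have fin: "finite (?C (insert x P))"
    by (rule finite_subset[of _ "insert x P \<times> insert x P"]) (use insert in auto)
  show ?case
  proof (cases "\<phi> x \<in> \<phi> ` P")
    case False
    have "card (?C P) \<le> card (?C (insert x P))" by (rule card_mono[OF fin]) auto
    with False insert show ?thesis by simp
  next
    case True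
    then obtain y where y: "y \<in> P" "\<phi> x = \<phi> y" by auto
    have xy: "x \<noteq> y" using y insert by auto
    have finP: "finite (?C P)" by (rule finite_subset[OF _ fin]) auto
    have "card (?C P \<union> {(x, y), (y, x)}) = card (?C P) + 2"
      using xy insert finP by (subst card_Un_disjoint) auto
    moreover have "card (?C P \<union> {(x, y), (y, x)}) \<le> card (?C (insert x P))"
      by (rule card_mono[OF fin]) (use y xy in auto)
    moreover have "\<phi> ` insert x P = \<phi> ` P" using True by auto
    ultimately show ?thesis using insert by simp
  qed
qed simp

text \<open>Given H of degree l, the s = m div l coefficients of G next to the leading one fix f =
  G(H) down to degree (l - 1) m. In the other decomposition f = g(k) this determines k as an
  approximate l-th root, once g is known up to its constant. The exponent is the sum of l - 1 for H,
  s for G and l - 2 for g, whose second coefficient is normalized to 0.\<close>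

lemma card_compositions_Int_le:
  assumes l: "l \<ge> 2" "\<not> CHAR('a) dvd l" and m: "m \<ge> 1"
  shows "card (compositions l m \<inter> compositions m l :: 'a::{field,finite} poly set)
         \<le> CARD('a) ^ (2 * l - 3 + m div l)"
proof -
  define s where "s = m div l"
  have s: "s < m" "m < (s + 1) * l" using l m unfolding s_def
    by (auto simp: mult.commute dividend_less_times_div)
  let ?I = "compositions l m \<inter> compositions m l :: 'a poly set"
  let ?\<Gamma> = "{g \<in> monic_original l :: 'a poly set. coeff g (l - 1) = 0}"
  have l0: "of_nat l \<noteq> (0::'a)" using l by (simp add: of_nat_eq_0_iff_char_dvd)
  define Q where "Q f G H g k \<longleftrightarrow> G \<in> monic_original m \<and> H \<in> monic_original l \<and> f = pcompose G H
      \<and> g - [:coeff g 0:] \<in> ?\<Gamma> \<and> degree k = m \<and> coeff k m = 1 \<and> f = pcompose g k" for f G H g k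
  have "\<exists>G H g k. Q f G H g k" if "f \<in> ?I" for f
  proof -
    have "f \<in> compositions m l" "f \<in> compositions l m" using that by auto
    then obtain G H g h where 1: "G \<in> monic_original m" "H \<in> monic_original l" "f = pcompose G H"
      and 2: "g \<in> monic_original l" "h \<in> monic_original m" "f = pcompose g h"
      by (elim compositionsE)
    \<comment> \<open>The shift by \<open>b\<close> removes the second coefficient of the left
      factor; l is invertible. Then \<open>f\<close> and k^l agree above degree (l - 2) m, up to a
      constant. In exchange \<open>k\<close> and the shifted left factor may have constant
      terms.\<close>
    define b where "b = coeff g (l - 1) / of_nat l"
    define k where "k = h + [:b:]"
    define \<gamma> where "\<gamma> = pcompose g [:- b, 1:]"
    have "pcompose [:- b, 1:] k = h" unfolding k_def by (simp add: pcompose_pCons)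
    hence fk: "f = pcompose \<gamma> k" unfolding \<gamma>_def 2(3) by (simp flip: pcompose_assoc)
    have k: "degree k = m" "coeff k m = 1" unfolding k_def using 2(2) m
      by (auto simp: monic_originalD degree_add_eq_left coeff_pCons split: nat.splits)
    have d\<gamma>: "degree \<gamma> = l" unfolding \<gamma>_def using 2(1) by (simp add: degree_pcompose monic_originalD)
    have c\<gamma>: "coeff \<gamma> l = 1" using lead_coeff_comp[of "[:- b, 1:]" g] 2(1) d\<gamma>
      unfolding \<gamma>_def by (simp add: monic_originalD)
    obtain r where r: "degree r \<le> (l - 2) * degree [:- b, 1:]"
      "\<gamma> = [:- b, 1:] ^ l + smult (coeff g (l - 1)) ([:- b, 1:] ^ (l - 1)) + r"
      using pcompose_top_terms[OF monic_originalD(1,2)[OF 2(1)] l(1), of "[:- b, 1:]"]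
      unfolding \<gamma>_def by metis
    have "coeff ([:- b, 1:] ^ l - [:0, 1:] ^ l) ((l - 1) * 1 + 0) = of_nat l * coeff ([:- b, 1:] - [:0, 1:]) 0"
      by (rule power_diff_top(2)) (use l in auto)
    moreover have "coeff ([:0, 1:] ^ l) (l - 1) = (0::'a)"
      using l by (simp flip: monom_altdef[of 1, simplified])
    ultimately have "coeff ([:- b, 1:] ^ l) (l - 1) = - of_nat l * b" by simp
    moreover have "coeff ([:- b, 1:] ^ (l - 1)) (l - 1) = 1"
      using coeff_power_le[of "[:- b, 1:]" 1 "l - 1"] by simp
    moreover have "coeff r (l - 1) = 0" using r(1) l by (auto intro: coeff_eq_0)
    ultimately have "coeff \<gamma> (l - 1) = 0" using l0 by (subst r(2)) (simp add: b_def)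
    hence "\<gamma> - [:coeff \<gamma> 0:] \<in> ?\<Gamma>" using d\<gamma> c\<gamma> l
      by (auto simp: monic_original_def coeff_pCons split: nat.splits)
    with 1 k fk have "Q f G H \<gamma> k" unfolding Q_def by blast
    thus ?thesis by blast
  qed
  then obtain G H g k where Q: "\<And>f. f \<in> ?I \<Longrightarrow> Q f (G f) (H f) (g f) (k f)" by metis
  note * = Q[unfolded Q_def]
  have c0: "coeff f 0 = 0" if f: "f \<in> ?I" for f
  proof -
    have "f \<in> compositions l m" using f by simp
    then obtain g h where gh: "g \<in> monic_original l" "h \<in> monic_original m" "f = pcompose g h"
      by (rule compositionsE)
    show ?thesis using monic_originalD(3)[OF pcompose_monic_original[OF gh(1,2) m]] gh(3) by simp
  qed
  let ?D = "\<lambda>f. (H f, restrict (coeff (G f)) {m - s..<m}, g f - [:coeff (g f) 0:])"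
  let ?E = "monic_original l \<times> (PiE {m - s..<m} (\<lambda>_. UNIV)) \<times> ?\<Gamma> :: ('a poly \<times> (nat \<Rightarrow> 'a) \<times> 'a poly) set"
  have "inj_on ?D ?I"
  proof (rule inj_onI)
    fix f1 f2 assume f: "f1 \<in> ?I" "f2 \<in> ?I" and D: "?D f1 = ?D f2"
    note f1 = *[OF f(1)] and f2 = *[OF f(2)]
    from D have H: "H f1 = H f2" and g: "g f1 - [:coeff (g f1) 0:] = g f2 - [:coeff (g f2) 0:]"
      and res: "restrict (coeff (G f1)) {m - s..<m} = restrict (coeff (G f2)) {m - s..<m}" by auto
    have "degree (G f1 - G f2) \<le> m - s - 1"
    proof (rule degree_le, intro allI impI)
      fix i assume i: "m - s - 1 < i"
      show "coeff (G f1 - G f2) i = 0"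
      proof (cases "i \<ge> m")
        case True
        thus ?thesis using f1 f2 by (cases "i = m") (auto simp: monic_originalD coeff_eq_0)
      next
        case False
        with i have "i \<in> {m - s..<m}" by auto
        thus ?thesis using fun_cong[OF res, of i] by simp
      qed
    qed
    hence "degree (pcompose (G f1 - G f2) (H f1)) \<le> (m - s - 1) * l"
      using f1 by (simp add: degree_pcompose monic_originalD(1)[of "H f1" l])
    moreover have "f1 - f2 = pcompose (G f1 - G f2) (H f1)"
      using f1 f2 H by (metis pcompose_diff)
    \<comment> \<open>Equivalent to m < (s + 1) l; this is why m div l coefficients suffice.\<close>
    moreover have "(m - s - 1) * l < (l - 1) * m"
    proof -
      have "m = (m - s - 1) + (s + 1)" using s by simp
      hence "(m - s - 1) * l + (s + 1) * l = m * l" by (metis add_mult_distrib)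
      moreover have "(l - 1) * m + m = m * l" using l by (cases l) auto
      ultimately show ?thesis using s(2) by linarith
    qed
    ultimately have df: "degree (f1 - f2) < (l - 1) * m" by simp
    define g0 where "g0 = g f1 - [:coeff (g f1) 0:]"
    define c1 where "c1 = coeff (g f1) 0"
    define c2 where "c2 = coeff (g f2) 0"
    have g12: "g f1 = g0 + [:c1:]" "g f2 = g0 + [:c2:]" using g unfolding g0_def c1_def c2_def 
      by (auto simp: algebra_simps)
    have g0: "g0 \<in> monic_original l" "coeff g0 (l - 1) = 0" using f1 unfolding g0_def by auto
    have ff: "f1 = pcompose g0 (k f1) + [:c1:]" "f2 = pcompose g0 (k f2) + [:c2:]"
      using f1 f2 g12 by (metis pcompose_add pcompose_const)+
    have exp: "\<exists>r. degree r \<le> (l - 2) * m \<and> pcompose g0 (k f) = k f ^ l + r" if "degree (k f) = m" for f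
      using pcompose_top_terms[OF monic_originalD(1,2)[OF g0(1)] l(1), of "k f"] g0(2) that by auto
    have k: "degree (k f1) = m" "degree (k f2) = m" using f1 f2 by blast+
    obtain r1 where r1: "degree r1 \<le> (l - 2) * m" "pcompose g0 (k f1) = k f1 ^ l + r1"
      using exp[OF k(1)] by blast
    obtain r2 where r2: "degree r2 \<le> (l - 2) * m" "pcompose g0 (k f2) = k f2 ^ l + r2"
      using exp[OF k(2)] by blast
    note r = r1 r2
    \<comment> \<open>If they differ, the difference of their l-th powers has degree at least (l -
      1) m, as l is invertible. But it equals f1 - f2 minus remainders and a constant, all of
      smaller degree.\<close>
    have "k f1 = k f2"
    proof (rule ccontr)
      assume neq: "k f1 \<noteq> k f2"
      define t where "t = degree (k f1 - k f2)"
      define n where "n = (l - 1) * m + t"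
      have "coeff (k f1 ^ l - k f2 ^ l) n = of_nat l * coeff (k f1 - k f2) t"
        unfolding n_def by (rule power_diff_top(2)) (use f1 f2 l in \<open>auto simp: t_def\<close>)
      hence nz: "coeff (k f1 ^ l - k f2 ^ l) n \<noteq> 0"
        using l0 neq unfolding t_def by (metis leading_coeff_0_iff mult_eq_0_iff right_minus_eq)
      have "(l - 2) * m < (l - 1) * m" using l m by simp
      hence n: "n > (l - 2) * m" "n > 0" "n > degree (f1 - f2)" using df unfolding n_def by linarith+
      have "k f1 ^ l - k f2 ^ l = (f1 - f2) - (r1 - r2) - [:c1 - c2:]"
        by (subst ff(1), subst ff(2)) (simp add: r algebra_simps)
      moreover have "coeff (f1 - f2) n = 0" by (rule coeff_eq_0[OF n(3)])
      moreover have "coeff r1 n = 0" "coeff r2 n = 0" "coeff [:c1 - c2:] n = 0"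
        using n r by (auto intro!: coeff_eq_0)
      ultimately show False using nz by (metis coeff_diff diff_zero)
    qed
    moreover have "coeff f1 0 = 0" "coeff f2 0 = 0" using c0 f by auto
    ultimately show "f1 = f2" using ff
      by (metis add_diff_cancel_left' add_diff_cancel_right' add_right_imp_eq coeff_add coeff_pCons_0 pCons_0_0 add_left_imp_eq)
  qed
  moreover have "?D ` ?I \<subseteq> ?E" using * by (intro image_subsetI) (simp add: restrict_PiE_iff)
  moreover have "finite ?E"
    by (intro finite_cartesian_product finite_PiE finite_monic_original finite_subset[OF _ finite_monic_original[of l]]) auto
  ultimately have "card ?I \<le> card ?E" by (rule card_inj_on_le)
  also have "\<dots> = CARD('a) ^ (l - 1) * (CARD('a) ^ s * CARD('a) ^ (l - 2))"
    using l s by (simp add: card_cartesian_product card_monic_original card_PiE card_monic_original_coeff)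
  also have "\<dots> = CARD('a) ^ ((l - 1) + (s + (l - 2)))" by (simp only: power_add)
  also have "(l - 1) + (s + (l - 2)) = 2 * l - 3 + s" using l(1) by linarith
  finally show ?thesis unfolding s_def .
qed

subsection \<open>Factors whose degree is the characteristic\<close>

lemma coeff_pcompose_top:
  fixes g h :: "'a::field poly"
  assumes "degree g \<le> n" "degree h = k" "coeff h k = 1" "k \<ge> 1"
  shows "coeff (pcompose g h) (n * k) = coeff g n"
proof (cases "degree g = n")
  case True
  thus ?thesis using lead_coeff_comp[of h g] assms by (simp add: degree_pcompose)
next
  case False
  hence "degree g < n" using assms by simp
  moreover from this have "degree (pcompose g h) < n * k" using assms by (simp add: degree_pcompose)
  ultimately show ?thesis by (simp add: coeff_eq_0)
qed

lemma of_nat_minus_one_CHAR_dvd: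
  assumes "CHAR('a) dvd n" "n \<ge> 1"
  shows "of_nat (n - 1) = (- 1 :: 'a::{field,finite})"
proof -
  have "of_nat (n - 1) + 1 = (of_nat n :: 'a)" using assms(2) by (simp add: of_nat_diff)
  also have "\<dots> = 0" using assms(1) by (simp add: of_nat_eq_0_iff_char_dvd)
  finally show ?thesis by (simp add: eq_neg_iff_add_eq_0)
qed

text \<open>Differentiation kills the top term because p divides n; the next one gets the factor n -
  1, which is -1 in the field.\<close>

lemma pderiv_monic_original_wild:
  fixes f :: "'a::{field,finite} poly"
  assumes f: "f \<in> monic_original n" and n: "CHAR('a) dvd n" "n \<ge> 2"
  shows "degree (pderiv f) \<le> n - 2" and "coeff (pderiv f) (n - 2) = - coeff f (n - 1)"
proof -
  show "degree (pderiv f) \<le> n - 2"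
  proof (rule degree_le, intro allI impI)
    fix i assume "i > n - 2"
    hence "Suc i = n \<or> Suc i > n" using n by linarith
    thus "coeff (pderiv f) i = 0"
      using f n(1) unfolding coeff_pderiv
      by (metis coeff_eq_0 monic_originalD(1) mult_zero_left mult_zero_right of_nat_eq_0_iff_char_dvd)
  qed
  have "Suc (n - 2) = n - 1" using n by simp
  thus "coeff (pderiv f) (n - 2) = - coeff f (n - 1)"
    unfolding coeff_pderiv using of_nat_minus_one_CHAR_dvd[of n, where ?'a = 'a] n by simp
qed

text \<open>This is the top term of the chain rule g'(h) h'. The degree of h' enters only through a
  bound n, so that two decompositions of the same polynomial can be compared at one index.\<close>

lemma coeff_pderiv_pcompose:
  fixes g h :: "'a::{field,finite} poly"
  assumes g: "g \<in> monic_original e" "CHAR('a) dvd e" "e \<ge> 2"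
    and h: "h \<in> monic_original k" "k \<ge> 1" and n: "degree (pderiv h) \<le> n"
  shows "degree (pderiv (pcompose g h)) \<le> (e - 2) * k + n"
    and "coeff (pderiv (pcompose g h)) ((e - 2) * k + n) = - coeff g (e - 1) * coeff (pderiv h) n"
proof -
  note pg = pderiv_monic_original_wild[OF g]
  have d: "degree (pcompose (pderiv g) h) \<le> (e - 2) * k"
    using pg(1) h by (simp add: degree_pcompose monic_originalD)
  show "degree (pderiv (pcompose g h)) \<le> (e - 2) * k + n"
    unfolding pderiv_pcompose by (rule order_trans[OF degree_mult_le add_mono[OF d n]])
  show "coeff (pderiv (pcompose g h)) ((e - 2) * k + n) = - coeff g (e - 1) * coeff (pderiv h) n"
    unfolding pderiv_pcompose coeff_mult_le[OF d n]
    using coeff_pcompose_top[OF pg(1), of h k] pg(2) h by (simp add: monic_originalD)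
qed

lemma degree_pderiv_compositions_wild:
  fixes f :: "'a::{field,finite} poly"
  assumes "f \<in> compositions CHAR('a) m" "m \<ge> 1"
  shows "degree (pderiv f) \<le> (CHAR('a) - 2) * m + (m - 1)"
proof -
  obtain g h where gh: "g \<in> monic_original CHAR('a)" "h \<in> monic_original m" "f = pcompose g h"
    using assms(1) by (rule compositionsE)
  have "degree (pderiv h) \<le> m - 1"
    using gh(2) by (intro degree_le) (simp add: coeff_pderiv coeff_eq_0 monic_originalD)
  from coeff_pderiv_pcompose(1)[OF gh(1) _ _ gh(2) assms(2) this] gh(3)
  show ?thesis using prime_ge_2_nat[OF prime_CHAR_finite[where ?'a = 'a]] by simp
qed

text \<open>A vanishing derivative leaves only exponents divisible by p, and there is none strictly
  between 0 and p.\<close>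

lemma pderiv_eq_0_iff_monom:
  fixes h :: "'a::{field,finite} poly"
  assumes "h \<in> monic_original CHAR('a)"
  shows "pderiv h = 0 \<longleftrightarrow> h = monom 1 CHAR('a)"
proof
  assume h0: "pderiv h = 0"
  show "h = monom 1 CHAR('a)"
  proof (rule poly_eqI)
    fix i
    consider "i = 0" | "i = CHAR('a)" | "i > CHAR('a)" | "0 < i" "i < CHAR('a)" by linarith
    thus "coeff h i = coeff (monom 1 CHAR('a)) i"
    proof cases
      case 4
      then obtain j where j: "i = Suc j" by (cases i) auto
      have "of_nat i * coeff h i = 0" using h0 j by (metis coeff_0 coeff_pderiv)
      moreover have "\<not> CHAR('a) dvd i" using 4 by (auto dest: dvd_imp_le)
      ultimately show ?thesis using 4 by (simp add: of_nat_eq_0_iff_char_dvd)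
    qed (use assms prime_gt_0_nat[OF prime_CHAR_finite[where ?'a = 'a]]
         in \<open>auto simp: monic_original_def coeff_eq_0\<close>)
  qed
qed (simp add: pderiv_monom)

lemma monom_in_monic_original: "n \<ge> 1 \<Longrightarrow> monom 1 n \<in> monic_original n"
  by (auto simp: monic_original_def degree_monom_eq)

text \<open>The equation would mean m = (p - 1) i. For p = 2 this contradicts i < m; otherwise p - 1
  has a prime divisor, which is smaller than p and divides m.\<close>

lemma least_prime_factor_no_solution:
  fixes p m :: nat
  assumes p: "prime p" and m: "\<And>r. prime r \<Longrightarrow> r dvd m \<Longrightarrow> p \<le> r" and i: "1 \<le> i" "i < m"
  shows "p * i \<noteq> m + i"
proof
  assume "p * i = m + i"
  moreover have p2: "p \<ge> 2" by (rule prime_ge_2_nat[OF p])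
  moreover have "p * i = (p - 1) * i + i" using p2 by (cases p) auto
  ultimately have mi: "m = (p - 1) * i" by simp
  with i have "p - 1 \<noteq> 1" by auto
  then obtain r where r: "prime r" "r dvd p - 1" using prime_factor_nat by blast
  hence "p \<le> r" using m[of r] mi by simp
  moreover have "r \<le> p - 1" using r(2) p2 by (intro dvd_imp_le) auto
  ultimately show False using p2 by linarith
qed

text \<open>On \<open>compositions p m\<close> the derivative has degree at most (p - 2) m + (m -
  1). For f = g(h) with deg g = m prime to p it has degree at least (m - 1) p, unless h' = 0. Since
  m > p, a common value forces h = x^p, which leaves at most q^(m - 1) values. The other error term
  is the loss from asking for a nonzero second coefficient on the side of left degree p.\<close>

lemma card_compositions_Un_tame_cofactor:
  fixes m :: nat
  defines "p \<equiv> CHAR('a::{field,finite})"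
  assumes m: "\<not> p dvd m" "m > p" and min: "\<And>r. prime r \<Longrightarrow> r dvd m \<Longrightarrow> p \<le> r"
  shows "2 * CARD('a) ^ (p + m - 2)
         \<le> card (compositions p m \<union> compositions m p :: 'a poly set) + 2 * CARD('a) ^ (p + m - 3)"
proof -
  let ?q = "CARD('a)"
  have p: "prime p" "p \<ge> 2" unfolding p_def using prime_CHAR_finite prime_ge_2_nat by blast+
  have q: "?q \<ge> 1" using zero_less_card_finite[where ?'a = 'a] by linarith
  have A: "(?q - 1) * ?q ^ (p + m - 3) \<le> card (compositions p m :: 'a poly set)"
  proof (rule card_compositions_wild[of _ 1 1])
    show "\<And>i. 1 \<le> i \<Longrightarrow> i < m \<Longrightarrow> CHAR('a) ^ 1 * i \<noteq> m + i"
      using least_prime_factor_no_solution[OF p(1) min] unfolding p_def by simp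
  qed (use p m in \<open>auto simp: p_def\<close>)
  have B: "card (compositions m p :: 'a poly set) = ?q ^ (p + m - 2)"
    using card_compositions_tame[of m p, where ?'a = 'a] m p by (simp add: p_def add.commute)
  let ?S1 = "(\<lambda>g. pcompose g (monom 1 p)) ` monic_original m :: 'a poly set"
  have "compositions p m \<inter> compositions m p \<subseteq> ?S1"
  proof
    fix f :: "'a poly" assume f: "f \<in> compositions p m \<inter> compositions m p"
    then obtain g h where gh: "g \<in> monic_original m" "h \<in> monic_original p" "f = pcompose g h"
      using compositionsE by blast
    have "degree (pderiv f) \<le> (p - 2) * m + (m - 1)"
      using degree_pderiv_compositions_wild[of f m] f m unfolding p_def by simp
    moreover have "(p - 2) * m + (m - 1) < (m - 1) * p"
    proof -
      have "p = (p - 2) + 2" "m = (m - 1) + 1" using p m by linarith+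
      hence "(p - 2) * m + 2 * m = p * m" "(m - 1) * p + p = p * m"
        by (metis add_mult_distrib mult.commute mult_1)+
      thus ?thesis using m by linarith
    qed
    moreover have "degree (pderiv f) \<ge> (m - 1) * p" if nz: "pderiv h \<noteq> 0"
    proof -
      have "coeff (pderiv g) (m - 1) \<noteq> 0"
        using gh(1) m by (simp add: coeff_pderiv monic_originalD of_nat_eq_0_iff_char_dvd p_def)
      hence "pderiv g \<noteq> 0" "degree (pderiv g) \<ge> m - 1" by (auto intro: le_degree)
      moreover have "pcompose (pderiv g) h \<noteq> 0"
        using calculation(1) gh(2) p by (simp add: pcompose_eq_0_iff monic_originalD)
      ultimately show ?thesis
        unfolding gh(3) pderiv_pcompose using nz gh(2)
        by (simp add: degree_mult_eq degree_pcompose monic_originalD trans_le_add1)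
    qed
    ultimately have "pderiv h = 0" by fastforce
    hence "h = monom 1 p" using pderiv_eq_0_iff_monom gh(2) unfolding p_def by blast
    thus "f \<in> ?S1" using gh by blast
  qed
  hence "card (compositions p m \<inter> compositions m p :: 'a poly set) \<le> card ?S1"
    by (intro card_mono finite_imageI finite_monic_original)
  also have "\<dots> \<le> ?q ^ (m - 1)"
    using card_image_le[OF finite_monic_original, of _ m] m by (metis card_monic_original less_imp_le_nat
       prime_gt_0_nat p(1) Suc_leI One_nat_def le_less_trans)
  also have "\<dots> \<le> ?q ^ (p + m - 3)" using q p m by (intro power_increasing) auto
  finally have C: "card (compositions p m \<inter> compositions m p :: 'a poly set) \<le> ?q ^ (p + m - 3)" .
  have "card (compositions p m :: 'a poly set) + card (compositions m p :: 'a poly set)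
      = card (compositions p m \<union> compositions m p :: 'a poly set)
      + card (compositions p m \<inter> compositions m p :: 'a poly set)"
    by (intro card_Un_Int finite_compositions)
  moreover have "?q ^ (p + m - 2) = (?q - 1) * ?q ^ (p + m - 3) + ?q ^ (p + m - 3)"
  proof -
    have "p + m - 2 = Suc (p + m - 3)" using p m by linarith
    hence "?q ^ (p + m - 2) = ?q * ?q ^ (p + m - 3)" by simp
    also have "\<dots> = ((?q - 1) + 1) * ?q ^ (p + m - 3)" using q by simp
    finally show ?thesis by (simp only: add_mult_distrib mult_1)
  qed
  ultimately show ?thesis using A B C by linarith
qed

text \<open>The relation p i = m + i has no solution as p is at most every prime divisor of m, so a
  collision has i = m / p and second coefficients a \<noteq> A. A nonzero coefficient of h at some j
  in \<open>J\<close> puts the top of h' above the place where h and H start to differ, so h' and H'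
  share their leading coefficient. Comparing the leading coefficient of f', which is that number
  times -a and also times -A, gives a = A.\<close>

lemma inj_on_pcompose_CHAR_left:
  fixes m :: nat
  defines "p \<equiv> CHAR('a::{field,finite})"
  assumes m: "p dvd m" "m \<ge> 2" and min: "\<And>r. prime r \<Longrightarrow> r dvd m \<Longrightarrow> p \<le> r"
    and J: "\<And>j. j \<in> J \<Longrightarrow> m - m div p < j \<and> \<not> p dvd j"
  shows "inj_on (\<lambda>(g, h). pcompose g h :: 'a poly)
           ({g \<in> monic_original p. coeff g (p - 1) \<noteq> 0} \<times> {h \<in> monic_original m. \<exists>j\<in>J. coeff h j \<noteq> 0})"
proof (rule inj_onI, clarify)
  fix g h G H :: "'a poly" and j j'
  assume A: "g \<in> monic_original p" "h \<in> monic_original m" "G \<in> monic_original p"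
    "H \<in> monic_original m" "pcompose g h = pcompose G H" and g0: "coeff g (p - 1) \<noteq> 0"
    and j: "j \<in> J" "coeff h j \<noteq> 0"
  have p: "prime p" "p \<ge> 2" unfolding p_def using prime_CHAR_finite prime_ge_2_nat by blast+
  have "h = H"
  proof (rule ccontr)
    assume neq: "h \<noteq> H"
    have e: "p = CHAR('a) ^ 1 * 1" "\<not> CHAR('a) dvd 1" "2 \<le> p"
      using p unfolding p_def by auto
    note c = collision[OF A(1,3,2,4,5) neq e, simplified, folded p_def]
    note s = degree_diff_monic_original[OF A(2,4) neq]
    have "p * (m - degree (h - H)) \<noteq> m + (m - degree (h - H))"
      by (rule least_prime_factor_no_solution[OF p(1) min]) (use s in auto)
    hence aA: "coeff g (p - 1) \<noteq> coeff G (p - 1)" using c(3) g0 by auto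
    hence "p * (m - degree (h - H)) = m" using c(2) by auto
    hence "m div p = m - degree (h - H)" using p by (metis nonzero_mult_div_cancel_left not_numeral_le_zero)
    hence s': "degree (h - H) = m - m div p" using s by linarith
    have same: "coeff (pderiv h) n = coeff (pderiv H) n" if "n \<ge> m - m div p" for n
    proof -
      have "coeff (h - H) (Suc n) = 0" using s' that by (intro coeff_eq_0) simp
      thus ?thesis by (simp add: coeff_pderiv)
    qed
    define n where "n = degree (pderiv h)"
    from J[OF j(1)] obtain j0 where j0: "j = Suc j0" "j0 \<ge> m - m div p" by (cases j) auto
    have "coeff (pderiv h) j0 \<noteq> 0"
      using J[OF j(1)] j(2) j0(1) by (auto simp: coeff_pderiv of_nat_eq_0_iff_char_dvd p_def simp del: of_nat_Suc)
    hence n: "n \<ge> m - m div p" "pderiv h \<noteq> 0"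
      unfolding n_def using j0 le_degree[of "pderiv h" j0] by auto
    have cn: "coeff (pderiv h) n \<noteq> 0" unfolding n_def using n(2) by simp
    have dH: "degree (pderiv H) \<le> n"
    proof (rule degree_le, intro allI impI)
      fix i assume "i > n"
      thus "coeff (pderiv H) i = 0" using same[of i] n by (simp add: n_def coeff_eq_0)
    qed
    have m1: "m \<ge> 1" using m by simp
    have "- coeff g (p - 1) * coeff (pderiv h) n = - coeff G (p - 1) * coeff (pderiv H) n"
      using coeff_pderiv_pcompose(2)[OF A(1) _ p(2) A(2) m1, of n]
        coeff_pderiv_pcompose(2)[OF A(3) _ p(2) A(4) m1 dH] A(5) unfolding n_def p_def by simp
    with same[OF n(1)] cn aA show False by simp
  qed
  with A m show "g = G \<and> h = H" using pcompose_left_cancel[of g h G] by (auto simp: monic_originalD)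
qed

text \<open>Collisions are taken as ordered pairs because \<open>card_image_plus_collisions\<close>
  counts them in this form.\<close>

definition wild_collisions :: "nat \<Rightarrow> (('a::{field,finite} poly \<times> 'a poly) \<times> ('a poly \<times> 'a poly)) set" where
  "wild_collisions e = {((g, h), (G, H)). g \<in> monic_original e \<and> G \<in> monic_original e
      \<and> h \<in> monic_original CHAR('a) \<and> H \<in> monic_original CHAR('a)
      \<and> coeff g (e - 1) \<noteq> 0 \<and> coeff G (e - 1) \<noteq> 0
      \<and> (g, h) \<noteq> (G, H) \<and> pcompose g h = pcompose G H}"

text \<open>There are two relations between the second coefficients a, A of g, G: cancellation in
  \<open>collision\<close> gives A = a + (r (u - v))^p, and the top coefficient of f' gives a u = A
  v. Eliminating A expresses a by u and v.\<close>

lemma wild_collision_coeffs: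
  fixes g h G H :: "'a::{field,finite} poly"
  assumes c: "((g, h), (G, H)) \<in> wild_collisions e" and e: "e = CHAR('a) * r" "\<not> CHAR('a) dvd r"
  defines "u \<equiv> coeff h (CHAR('a) - 1)" and "v \<equiv> coeff H (CHAR('a) - 1)"
  shows "u \<noteq> 0" "v \<noteq> 0" "u \<noteq> v" "coeff g (e - 1) = (of_nat r * (u - v)) ^ CHAR('a) * v / (u - v)"
proof -
  define p where "p = CHAR('a)"
  define a where "a = coeff g (e - 1)"
  define A where "A = coeff G (e - 1)"
  have p: "prime p" "p \<ge> 2" unfolding p_def using prime_CHAR_finite prime_ge_2_nat by blast+
  have C: "g \<in> monic_original e" "h \<in> monic_original p" "G \<in> monic_original e"
    "H \<in> monic_original p" "pcompose g h = pcompose G H" and a: "a \<noteq> 0" "A \<noteq> 0"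
    and ne: "(g, h) \<noteq> (G, H)"
    using c unfolding wild_collisions_def p_def a_def A_def by auto
  have hH: "h \<noteq> H" using ne C(5) pcompose_left_cancel[of g h G] C(2) p by (auto simp: monic_originalD)
  have e2: "e \<ge> 2" using e p unfolding p_def by (cases r) auto
  have e': "e = CHAR('a) ^ 1 * r" using e by simp
  note col = collision[OF C(1,3,2,4,5) hH e' e(2) e2, simplified, folded p_def a_def A_def]
  note s = degree_diff_monic_original[OF C(2,4) hH]
  \<comment> \<open>Otherwise p i = p + i for the gap i, so p divides i, although 1 \<le> i <
    p.\<close>
  have "a \<noteq> A"
  proof
    assume "a = A"
    hence eq: "p * (p - degree (h - H)) = p + (p - degree (h - H))"
      using col(3) a unfolding a_def A_def by simp
    hence "p dvd p - degree (h - H)" by (metis dvd_add_triv_left_iff dvd_triv_left)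
    with s show False by (auto dest: dvd_imp_le)
  qed
  hence "p * (p - degree (h - H)) = p" and eq: "(of_nat r * lead_coeff (h - H)) ^ p + (a - A) = 0"
    using col(2) unfolding a_def A_def by auto
  hence "p - degree (h - H) = 1" using p by simp
  hence "degree (h - H) = p - 1" using s by linarith
  hence lc: "lead_coeff (h - H) = u - v" unfolding u_def v_def p_def by simp
  show uv: "u \<noteq> v" using lc hH by (metis leading_coeff_0_iff right_minus_eq)
  define w where "w = (of_nat r * (u - v)) ^ p"
  have A: "A = a + w" using eq unfolding lc w_def by (simp add: algebra_simps)
  have p1: "p \<ge> 1" and pp: "CHAR('a) dvd p" and pe: "CHAR('a) dvd e" using p e unfolding p_def by auto
  note dh = pderiv_monic_original_wild[OF C(2) pp p(2)] and dH = pderiv_monic_original_wild[OF C(4) pp p(2)]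
  have "a * u = A * v"
    using coeff_pderiv_pcompose(2)[OF C(1) pe e2 C(2) p1 dh(1)]
      coeff_pderiv_pcompose(2)[OF C(3) pe e2 C(4) p1 dH(1)] C(5) dh(2) dH(2)
    unfolding a_def A_def u_def v_def p_def by simp
  with A have au: "a * u = (a + w) * v" by simp
  show "u \<noteq> 0" using \<open>a * u = A * v\<close> a uv by auto
  show "v \<noteq> 0" using \<open>a * u = A * v\<close> a uv by auto
  have "a * (u - v) = w * v" using au by (simp add: algebra_simps)
  hence "a = w * v / (u - v)" using uv by (simp add: field_simps)
  thus "coeff g (e - 1) = (of_nat r * (u - v)) ^ CHAR('a) * v / (u - v)"
    unfolding a_def w_def p_def .
qed

text \<open>A collision is determined by its first pair (g, h) and the second coefficient v of H.
  For each of the (q - 1)(q - 2) choices of distinct nonzero u, v, one coefficient of g and one of h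
  are prescribed.\<close>

lemma card_wild_collisions:
  assumes e: "e = CHAR('a) * r" "\<not> CHAR('a) dvd r"
  shows "card (wild_collisions e :: (('a::{field,finite} poly \<times> 'a poly) \<times> ('a poly \<times> 'a poly)) set)
     \<le> (CARD('a) - 1) * (CARD('a) - 2) * CARD('a) ^ (e + CHAR('a) - 4)"
proof -
  define p where "p = CHAR('a)"
  have p: "prime p" "p \<ge> 2" unfolding p_def using prime_CHAR_finite prime_ge_2_nat by blast+
  have e2: "e \<ge> 2" using e p unfolding p_def by (cases r) auto
  let ?C = "wild_collisions e :: (('a poly \<times> 'a poly) \<times> ('a poly \<times> 'a poly)) set"
  define \<alpha> where "\<alpha> u v = (of_nat r * (u - v)) ^ p * v / (u - v)" for u v :: 'a
  define UV where "UV = (SIGMA u : UNIV - {0::'a}. UNIV - {0, u})"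
  define T where "T = (\<lambda>(u, v). {v} \<times> ({g \<in> monic_original e. coeff g (e - 1) = \<alpha> u v}
        \<times> {h \<in> monic_original p. coeff h (p - 1) = u}))"
  let ?\<Psi> = "\<lambda>z. (coeff (snd (snd z)) (p - 1), fst z)"
  have cardUV: "card UV = (CARD('a) - 1) * (CARD('a) - 2)"
    unfolding UV_def by (simp add: card_Diff_subset numeral_2_eq_2)
  have finT: "finite (T uv)" for uv
    by (rule finite_subset[of _ "UNIV \<times> (monic_original e \<times> monic_original p)"])
       (auto simp: T_def finite_monic_original split: prod.splits)
  have cT: "card (T uv) = CARD('a) ^ (e + p - 4)" for uv
  proof -
    obtain u v where uv: "uv = (u, v)" by (cases uv)
    have "card (T uv) = CARD('a) ^ (e - 2) * CARD('a) ^ (p - 2)"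
      unfolding T_def uv using e2 p by (simp add: card_cartesian_product card_monic_original_coeff)
    also have "\<dots> = CARD('a) ^ ((e - 2) + (p - 2))" by (simp only: power_add)
    also have "(e - 2) + (p - 2) = e + p - 4" using e2 p by linarith
    finally show ?thesis .
  qed
  have "inj_on ?\<Psi> ?C"
  proof (rule inj_onI)
    fix z1 z2 assume z: "z1 \<in> ?C" "z2 \<in> ?C" "?\<Psi> z1 = ?\<Psi> z2"
    obtain g h G1 H1 where z1: "z1 = ((g, h), (G1, H1))" by (metis surj_pair)
    obtain G2 H2 where z2: "z2 = ((g, h), (G2, H2))" using z(3) z1 by (metis fst_conv prod.inject surj_pair)
    have C: "((g, h), G1, H1) \<in> ?C" "((g, h), G2, H2) \<in> ?C"
      and v: "coeff H1 (p - 1) = coeff H2 (p - 1)" using z unfolding z1 z2 by auto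
    \<comment> \<open>Two different partners of the same (g, h) would collide with each other, so
      their right factors would have different second coefficients.\<close>
    have "G1 = G2 \<and> H1 = H2"
    proof (rule ccontr)
      assume "\<not> (G1 = G2 \<and> H1 = H2)"
      hence "((G1, H1), (G2, H2)) \<in> ?C" using C unfolding wild_collisions_def by auto
      from wild_collision_coeffs(3)[OF this e] v show False unfolding p_def by simp
    qed
    thus "z1 = z2" unfolding z1 z2 by simp
  qed
  moreover have "?\<Psi> ` ?C \<subseteq> (\<Union>uv\<in>UV. T uv)"
  proof (rule image_subsetI)
    fix x assume x: "x \<in> ?C"
    obtain g h G H where gh: "x = ((g, h), (G, H))" by (metis surj_pair)
    note w = wild_collision_coeffs[OF x[unfolded gh] e, folded p_def]
    have "(coeff h (p - 1), coeff H (p - 1)) \<in> UV" using w unfolding UV_def by auto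
    moreover have "?\<Psi> x \<in> T (coeff h (p - 1), coeff H (p - 1))"
      using w x unfolding gh T_def \<alpha>_def wild_collisions_def p_def by simp
    ultimately show "?\<Psi> x \<in> (\<Union>uv\<in>UV. T uv)" by blast
  qed
  moreover have finUV: "finite UV" unfolding UV_def by simp
  ultimately have "card ?C \<le> card (\<Union>uv\<in>UV. T uv)" using finT by (intro card_inj_on_le) auto
  also have "\<dots> \<le> (\<Sum>uv\<in>UV. card (T uv))" by (rule card_UN_le[OF finUV])
  finally show ?thesis unfolding cT p_def by (simp add: cardUV)
qed

lemma card_image_pcompose_wild_right:
  fixes P :: "('a::{field,finite} poly \<times> 'a poly) set"
  assumes e: "e = CHAR('a) * r" "\<not> CHAR('a) dvd r"
    and P: "P \<subseteq> {g \<in> monic_original e. coeff g (e - 1) \<noteq> 0} \<times> monic_original CHAR('a)"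
  shows "2 * card P \<le> 2 * card ((\<lambda>(g, h). pcompose g h) ` P)
           + (CARD('a) - 1) * (CARD('a) - 2) * CARD('a) ^ (e + CHAR('a) - 4)"
proof -
  let ?\<phi> = "\<lambda>(g, h). pcompose g h :: 'a poly"
  have finP: "finite P"
    by (rule finite_subset[OF P]) (intro finite_cartesian_product
        finite_subset[OF _ finite_monic_original[of e]] finite_monic_original; auto)
  have "finite (P \<times> P)" using finP by simp
  have fin: "finite (wild_collisions e :: (('a poly \<times> 'a poly) \<times> _) set)"
    by (rule finite_subset[of _ "(monic_original e \<times> monic_original CHAR('a)) \<times> (monic_original e \<times> monic_original CHAR('a))"])
       (auto simp: wild_collisions_def intro: finite_monic_original)
  have "{(x, y). x \<in> P \<and> y \<in> P \<and> x \<noteq> y \<and> ?\<phi> x = ?\<phi> y} \<subseteq> wild_collisions e"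
    using P unfolding wild_collisions_def by auto
  hence "card {(x, y). x \<in> P \<and> y \<in> P \<and> x \<noteq> y \<and> ?\<phi> x = ?\<phi> y} \<le> card (wild_collisions e :: (('a poly \<times> 'a poly) \<times> _) set)"
    by (rule card_mono[OF fin])
  with card_wild_collisions[OF e] card_image_plus_collisions[OF finP, of ?\<phi>]
  show ?thesis by linarith
qed

text \<open>In units of q^(2 p - 4), twice the number of pairs minus the number of ordered
  collisions is at least 2 (q - 1) q - (q - 1)(q - 2) = q^2 + q - 2 \<ge> q^2.\<close>

lemma card_compositions_CHAR_CHAR:
  fixes p :: nat
  defines "p \<equiv> CHAR('a::{field,finite})"
  shows "CARD('a) ^ (2 * p - 2) \<le> 2 * card (compositions p p :: 'a poly set)"
proof -
  let ?q = "CARD('a)"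
  let ?P = "{g \<in> monic_original p :: 'a poly set. coeff g (p - 1) \<noteq> 0} \<times> (monic_original p :: 'a poly set)"
  have p: "prime p" "p \<ge> 2" unfolding p_def using prime_CHAR_finite prime_ge_2_nat by blast+
  have "card {0, 1::'a} \<le> ?q" by (intro card_mono) auto
  hence q: "?q \<ge> 2" by simp
  have "card ?P = (?q - 1) * ?q ^ (p - 2) * ?q ^ (p - 1)"
    using p by (simp add: card_cartesian_product card_monic_original_coeff_nonzero card_monic_original)
  also have "p - 1 = Suc (p - 2)" using p by linarith
  hence "?q ^ (p - 1) = ?q * ?q ^ (p - 2)" by simp
  finally have "card ?P = (?q - 1) * ?q * (?q ^ (p - 2) * ?q ^ (p - 2))" by (simp add: mult_ac)
  moreover have Z: "?q ^ (p - 2) * ?q ^ (p - 2) = ?q ^ (p + p - 4)"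
  proof -
    have "(p - 2) + (p - 2) = p + p - 4" using p by linarith
    thus ?thesis by (metis power_add)
  qed
  ultimately have cP: "card ?P = (?q - 1) * ?q * ?q ^ (p + p - 4)" by simp
  have "2 * card ?P \<le> 2 * card ((\<lambda>(g, h). pcompose g h) ` ?P) + (?q - 1) * (?q - 2) * ?q ^ (p + CHAR('a) - 4)"
    by (rule card_image_pcompose_wild_right[of _ 1]) (use p in \<open>auto simp: p_def\<close>)
  also have "card ((\<lambda>(g, h). pcompose g h) ` ?P) \<le> card (compositions p p :: 'a poly set)"
    by (rule card_mono[OF finite_compositions]) (auto simp: compositions_def)
  finally have *: "2 * ((?q - 1) * ?q * ?q ^ (p + p - 4))
      \<le> 2 * card (compositions p p :: 'a poly set) + (?q - 1) * (?q - 2) * ?q ^ (p + p - 4)"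
    unfolding cP by (simp add: p_def)
  obtain x where x: "?q = x + 2" using q by (metis add.commute le_Suc_ex)
  have "2 * ((?q - 1) * ?q) = (?q - 1) * (?q - 2) + (?q * ?q + ?q - 2)"
    unfolding x by (simp add: algebra_simps)
  hence "2 * ((?q - 1) * ?q * ?q ^ (p + p - 4))
      = (?q - 1) * (?q - 2) * ?q ^ (p + p - 4) + (?q * ?q + ?q - 2) * ?q ^ (p + p - 4)"
    by (metis add_mult_distrib mult.assoc)
  with * have "(?q * ?q + ?q - 2) * ?q ^ (p + p - 4) \<le> 2 * card (compositions p p :: 'a poly set)"
    by linarith
  moreover have "?q * ?q * ?q ^ (p + p - 4) \<le> (?q * ?q + ?q - 2) * ?q ^ (p + p - 4)"
    using q by (intro mult_right_mono) auto
  moreover have "?q * ?q * ?q ^ (p + p - 4) = ?q ^ (2 * p - 2)"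
  proof -
    have "2 * p - 2 = Suc (Suc (p + p - 4))" using p by linarith
    thus ?thesis by (simp add: mult.assoc)
  qed
  ultimately show ?thesis by linarith
qed

subsection \<open>Translation invariance\<close>

text \<open>Repeated division expands f in powers of \<Gamma> with constant digits; these digits are
  the coefficients of \<kappa>. The sets of translation invariant polynomials below are closed under
  such a division.\<close>

lemma polynomial_in_divisor_closed_set:
  fixes \<Gamma> :: "'a::field poly"
  assumes \<Gamma>: "degree \<Gamma> \<ge> 1"
    and S: "\<And>f. f \<in> S \<Longrightarrow> \<exists>c f'. f = \<Gamma> * f' + [:c:] \<and> f' \<in> S"
    and "f \<in> S"
  shows "\<exists>\<kappa>. f = pcompose \<kappa> \<Gamma>"
  using \<open>f \<in> S\<close>
proof (induction "degree f" arbitrary: f rule: less_induct)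
  case less
  obtain c f' where f: "f = \<Gamma> * f' + [:c:]" "f' \<in> S" using S[OF less.prems] by blast
  show ?case
  proof (cases "f' = 0")
    case True
    hence "f = pcompose [:c:] \<Gamma>" using f by simp
    thus ?thesis by blast
  next
    case False
    have "degree f = degree \<Gamma> + degree f'"
      unfolding f(1) using False \<Gamma> by (subst degree_add_const, subst degree_mult_eq) auto
    hence "degree f' < degree f" using \<Gamma> by simp
    from less.hyps[OF this f(2)] obtain \<kappa> where "f' = pcompose \<kappa> \<Gamma>" by blast
    hence "f = pcompose (pCons c \<kappa>) \<Gamma>" using f(1) by (simp add: pcompose_pCons)
    thus ?thesis by blast
  qed
qed

lemma card_divisor_closed_set_le:
  fixes \<Gamma> :: "'a::{field,finite} poly"
  assumes \<Gamma>: "\<Gamma> \<in> monic_original D" "D \<ge> 1"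
    and S: "\<And>f. f \<in> S \<Longrightarrow> \<exists>c f'. f = \<Gamma> * f' + [:c:] \<and> f' \<in> S"
    and n: "n \<ge> 1"
  shows "card (S \<inter> monic_original n) \<le> CARD('a) ^ (n div D - 1)"
\<comment> \<open>For n < D the set is empty, although the truncated exponent 0 would allow one
  element.\<close>
proof (cases "n div D = 0")
  case False
  have "S \<inter> monic_original n \<subseteq> (\<lambda>\<kappa>. pcompose \<kappa> \<Gamma>) ` monic_original (n div D)"
  proof
    fix f assume f: "f \<in> S \<inter> monic_original n"
    then obtain \<kappa> where \<kappa>: "f = pcompose \<kappa> \<Gamma>"
      using polynomial_in_divisor_closed_set[of \<Gamma> S f] S \<Gamma> by (auto simp: monic_originalD)
    have "n = degree \<kappa> * D" using f \<Gamma> unfolding \<kappa> by (simp add: monic_original_def degree_pcompose)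
    hence "n div D = degree \<kappa>" using \<Gamma>(2) by simp
    moreover have "lead_coeff \<kappa> = 1"
      using lead_coeff_comp[of \<Gamma> \<kappa>] f \<Gamma> unfolding \<kappa> by (simp add: monic_original_def)
    moreover have "coeff \<kappa> 0 = 0"
      using f \<Gamma> unfolding \<kappa> by (simp add: monic_original_def poly_0_coeff_0)
    ultimately have "\<kappa> \<in> monic_original (n div D)" by (simp add: monic_original_def)
    thus "f \<in> (\<lambda>\<kappa>. pcompose \<kappa> \<Gamma>) ` monic_original (n div D)" using \<kappa> by blast
  qed
  hence "card (S \<inter> monic_original n) \<le> card (monic_original (n div D) :: 'a poly set)"
    by (rule surj_card_le[OF finite_monic_original])
  thus ?thesis using False by (simp add: card_monic_original)
next
  case True
  have "S \<inter> monic_original n = {}"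
  proof (rule ccontr)
    assume "S \<inter> monic_original n \<noteq> {}"
    then obtain f where f: "f \<in> S \<inter> monic_original n" by blast
    then obtain \<kappa> where \<kappa>: "f = pcompose \<kappa> \<Gamma>"
      using polynomial_in_divisor_closed_set[of \<Gamma> S f] S \<Gamma> by (auto simp: monic_originalD)
    have "n = degree \<kappa> * D" using f \<Gamma> unfolding \<kappa> by (simp add: monic_original_def degree_pcompose)
    thus False using True n \<Gamma>(2) by simp
  qed
  thus ?thesis by simp
qed

lemma monic_original_2_eq:
  assumes "h \<in> monic_original 2"
  shows "h = [:0, coeff h 1, 1:]"
proof (rule poly_eqI)
  fix i :: nat
  consider "i = 0" | "i = 1" | "i = 2" | "i > 2" by linarith
  thus "coeff h i = coeff [:0, coeff h 1, 1:] i"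
    using assms by cases (auto simp: monic_original_def coeff_eq_0 numeral_2_eq_2)
qed

lemma monic_original_2I: "[:0, u, 1:] \<in> monic_original 2"
  by (auto simp: monic_original_def numeral_2_eq_2)

lemma pcompose_quadratic_translation:
  "pcompose [:0, u, 1:] [:v, 1:] = [:v * (v + u), u + (v + v), 1 :: 'a::comm_ring_1:]"
  by (simp add: pcompose_pCons algebra_simps)

text \<open>f - f(0) vanishes at 0 and, by invariance, at w, so x (x + w) divides it. In
  characteristic 2 this divisor is itself invariant, hence so is the quotient.\<close>

lemma translation_invariant_division:
  fixes f :: "'a::field poly"
  assumes "CHAR('a) = 2" and w: "w \<noteq> 0" and f: "pcompose f [:w, 1:] = f"
  shows "\<exists>c f'. f = [:0, w, 1:] * f' + [:c:] \<and> pcompose f' [:w, 1:] = f'"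
proof -
  have ww: "w + w = 0" using uminus_CHAR_2[OF assms(1), of w] by (metis add.right_inverse)
  define c where "c = poly f 0"
  have "poly f w = c" unfolding c_def using arg_cong[OF f, of "\<lambda>g. poly g 0"] by (simp add: poly_pcompose)
  have "poly (f - [:c:]) 0 = 0" unfolding c_def by simp
  hence "[:- 0, 1:] dvd f - [:c:]" by (simp only: poly_eq_0_iff_dvd)
  then obtain f1 where f1: "f - [:c:] = [:0, 1:] * f1" by (auto simp: dvd_def)
  have "poly (f - [:c:]) w = 0" using \<open>poly f w = c\<close> by simp
  hence "poly f1 w = 0" unfolding f1 using w by simp
  then obtain f2 where f2: "f1 = [:- w, 1:] * f2" by (auto simp: poly_eq_0_iff_dvd dvd_def)
  have mw: "- w = w" using ww by (simp add: eq_neg_iff_add_eq_0 minus_equation_iff)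
  have eq: "f - [:c:] = [:0, w, 1:] * f2" unfolding f1 f2 mw by (simp flip: mult.assoc)
  have \<Gamma>: "pcompose [:0, w, 1:] [:w, 1:] = [:0, w, 1:]"
    by (simp only: pcompose_quadratic_translation ww mult_zero_right add_0_right)
  have "[:0, w, 1:] * pcompose f2 [:w, 1:] = pcompose (f - [:c:]) [:w, 1:]"
    unfolding eq by (simp only: pcompose_mult \<Gamma>)
  also have "\<dots> = f - [:c:]" by (simp only: pcompose_diff f pcompose_const)
  also have "\<dots> = [:0, w, 1:] * f2" by (rule eq)
  finally have "[:0, w, 1:] * pcompose f2 [:w, 1:] = [:0, w, 1:] * f2" .
  moreover have "[:0, w, 1:] \<noteq> 0" by simp
  ultimately have "pcompose f2 [:w, 1:] = f2" using mult_cancel_left by blast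
  moreover have "f = [:0, w, 1:] * f2 + [:c:]" using eq by (metis diff_add_cancel)
  ultimately show ?thesis by blast
qed

text \<open>Suppose f = g(x^2 + u x) = G(x^2 + v x) with u, v distinct and nonzero. The second form
  shows that f is invariant under x + v, and this shift adds v (v + u) to x^2 + u x. Hence g is
  invariant under a nonzero translation w and is a polynomial in x^2 + w x. Removing these few g
  makes composition injective.\<close>

lemma card_image_pcompose_char2:
  fixes m :: nat
  assumes char: "CHAR('a::{field,finite}) = 2" and m: "m \<ge> 2"
  shows "(CARD('a) - 1) * CARD('a) ^ (m - 2) * (CARD('a) - 1)
    \<le> card ((\<lambda>(g, h). pcompose g h :: 'a poly) `
          ({g \<in> monic_original m. coeff g (m - 1) \<noteq> 0} \<times> (monic_original 2 - {monom 1 2})))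
      + (CARD('a) - 1) * (CARD('a) - 2) * CARD('a) ^ (m div 2 - 1)"
proof -
  let ?q = "CARD('a)"
  let ?\<phi> = "\<lambda>(g, h). pcompose g h :: 'a poly"
  let ?P = "{g \<in> monic_original m :: 'a poly set. coeff g (m - 1) \<noteq> 0} \<times> (monic_original 2 - {monom 1 2 :: 'a poly})"
  have double: "x + x = 0" for x :: 'a using uminus_CHAR_2[OF char, of x] by (metis add.right_inverse)
  have finP: "finite ?P"
    by (intro finite_cartesian_product finite_subset[OF _ finite_monic_original[of m]] finite_Diff
        finite_monic_original) auto
  have "monom 1 2 \<in> (monic_original 2 :: 'a poly set)" by (rule monom_in_monic_original) simp
  hence "card (monic_original 2 - {monom 1 2 :: 'a poly}) = ?q - 1"
    by (subst card_Diff_singleton) (auto simp: card_monic_original)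
  hence cP: "card ?P = (?q - 1) * ?q ^ (m - 2) * (?q - 1)"
    using m by (simp add: card_cartesian_product card_monic_original_coeff_nonzero)
  define UV where "UV = (SIGMA u : UNIV - {0::'a}. UNIV - {0, u})"
  define S where "S w = {f :: 'a poly. pcompose f [:w, 1:] = f}" for w
  define B where "B = (\<Union>(u, v)\<in>UV. (S (v * (v + u)) \<inter> monic_original m) \<times> {[:0, u, 1:]})"
  have cUV: "card UV = (?q - 1) * (?q - 2)" unfolding UV_def by (simp add: card_Diff_subset numeral_2_eq_2)
  have "card B \<le> (\<Sum>(u, v)\<in>UV. card ((S (v * (v + u)) \<inter> monic_original m) \<times> {[:0, u, 1:]}))"
    unfolding B_def by (rule order_trans[OF card_UN_le]) (auto simp: UV_def case_prod_beta)
  also have "\<dots> \<le> (\<Sum>(u, v)\<in>UV. ?q ^ (m div 2 - 1))"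
  proof (rule sum_mono, clarify)
    fix u v assume uv: "(u, v) \<in> UV"
    have "v + u \<noteq> 0" using uv double[of u] unfolding UV_def by (metis (no_types, lifting) add_right_cancel SigmaE2 DiffE insertCI)
    hence w: "v * (v + u) \<noteq> 0" using uv unfolding UV_def by auto
    have "card (S (v * (v + u)) \<inter> monic_original m) \<le> ?q ^ (m div 2 - 1)"
    proof (rule card_divisor_closed_set_le[where \<Gamma> = "[:0, v * (v + u), 1:]"])
      show "\<exists>c f'. f = [:0, v * (v + u), 1:] * f' + [:c:] \<and> f' \<in> S (v * (v + u))"
        if "f \<in> S (v * (v + u))" for f
        using translation_invariant_division[OF char w, of f] that unfolding S_def by blast
    qed (use m monic_original_2I in auto)
    thus "card ((S (v * (v + u)) \<inter> monic_original m) \<times> {[:0, u, 1:]}) \<le> ?q ^ (m div 2 - 1)"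
      by (simp add: card_cartesian_product)
  qed
  also have "\<dots> = (?q - 1) * (?q - 2) * ?q ^ (m div 2 - 1)" by (simp add: cUV case_prod_beta)
  finally have cB: "card B \<le> (?q - 1) * (?q - 2) * ?q ^ (m div 2 - 1)" .
  have finB: "finite B"
    by (rule finite_subset[of _ "monic_original m \<times> monic_original 2"])
       (auto simp: B_def finite_monic_original monic_original_2I)
  have "inj_on ?\<phi> (?P - B)"
  proof (rule inj_onI)
    fix z1 z2 assume z: "z1 \<in> ?P - B" "z2 \<in> ?P - B" "?\<phi> z1 = ?\<phi> z2"
    obtain g h where z1: "z1 = (g, h)" by (metis surj_pair)
    obtain G H where z2: "z2 = (G, H)" by (metis surj_pair)
    have A: "g \<in> monic_original m" "h \<in> monic_original 2" "h \<noteq> monom 1 2" "(g, h) \<notin> B"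
      "G \<in> monic_original m" "H \<in> monic_original 2" "H \<noteq> monom 1 2" and eq: "pcompose g h = pcompose G H"
      using z unfolding z1 z2 by simp_all
    define u where "u = coeff h 1"
    define v where "v = coeff H 1"
    have h: "h = [:0, u, 1:]" and H: "H = [:0, v, 1:]"
      using monic_original_2_eq A(2,6) unfolding u_def v_def by auto
    have X2: "monom 1 2 = [:0, 0, 1 :: 'a:]" by (simp add: monom_altdef numeral_2_eq_2)
    have "u = v"
    proof (rule ccontr)
      assume "u \<noteq> v"
      hence uv: "(u, v) \<in> UV" using A(3,7) unfolding UV_def h H X2 by auto
      have "pcompose H [:v, 1:] = H" unfolding H
        by (simp only: pcompose_quadratic_translation double mult_zero_right add_0_right)
      hence "pcompose (pcompose g h) [:v, 1:] = pcompose g h"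
        unfolding eq by (simp flip: pcompose_assoc)
      moreover have "pcompose h [:v, 1:] = pcompose [:v * (v + u), 1:] h" unfolding h
        by (simp only: pcompose_quadratic_translation double add_0_right) (simp add: pcompose_pCons)
      ultimately have "pcompose (pcompose g [:v * (v + u), 1:]) h = pcompose g h"
        by (simp flip: pcompose_assoc)
      hence "pcompose g [:v * (v + u), 1:] = g"
        by (rule pcompose_left_cancel) (simp add: h)
      hence "(g, h) \<in> B" using uv A(1) unfolding B_def S_def h by auto
      with A(4) show False by simp
    qed
    hence "h = H" using h H by metis
    moreover have "degree h > 0" using A(2) by (simp add: monic_originalD)
    ultimately show "z1 = z2" unfolding z1 z2 using eq pcompose_left_cancel[of g h G] by metis
  qed
  hence "card (?\<phi> ` (?P - B)) = card (?P - B)" by (rule card_image)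
  moreover have "card ?P - card B \<le> card (?P - B)" by (rule diff_card_le_card_Diff[OF finB])
  moreover have "card (?\<phi> ` (?P - B)) \<le> card (?\<phi> ` ?P)" using finP by (intro card_mono) auto
  ultimately show ?thesis using cP cB by linarith
qed

text \<open>Substituting $x^2$ into the divisor gives $(x (x - w) (x + w))^2$, which is invariant under
  $x \mapsto x + w$ in characteristic 3.\<close>

lemma even_translation_invariant_division:
  fixes g :: "'a::field poly"
  assumes char: "CHAR('a) = 3" and w: "w \<noteq> 0"
    and g: "pcompose (pcompose g [:0, 0, 1:]) [:w, 1:] = pcompose g [:0, 0, 1:]"
  shows "\<exists>c g'. g = ([:0, 1:] * [:- (w ^ 2), 1:] ^ 2) * g' + [:c:] \<and>
            pcompose (pcompose g' [:0, 0, 1:]) [:w, 1:] = pcompose g' [:0, 0, 1:]"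
proof -
  have three: "x + x + x = 0" for x :: 'a
  proof -
    have "of_nat 3 = (0::'a)" using char by (metis of_nat_CHAR)
    hence "(3::'a) = 0" by simp
    hence "3 * x = 0" by simp
    thus ?thesis by (simp add: algebra_simps)
  qed
  have two: "x + x = - x" for x :: 'a using three[of x] by (simp add: eq_neg_iff_add_eq_0)
  define Q where "Q = [:0, 0, 1::'a:]"
  define T where "T = [:w, 1:]"
  have pQ: "poly Q x = x ^ 2" for x by (simp add: Q_def power2_eq_square)
  have inv: "poly g ((x + w) ^ 2) = poly g (x ^ 2)" for x
    using arg_cong[OF g, of "\<lambda>f. poly f x"] by (simp add: poly_pcompose power2_eq_square add.commute)
  define c where "c = poly g 0"
  have "poly (g - [:c:]) 0 = 0" unfolding c_def by simp
  hence "[:- 0, 1:] dvd g - [:c:]" by (simp only: poly_eq_0_iff_dvd)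
  then obtain g1 where g1: "g - [:c:] = [:0, 1:] * g1" by (auto simp: dvd_def)
  have "poly (g - [:c:]) (w ^ 2) = 0" using inv[of 0] by (simp add: c_def)
  hence "poly g1 (w ^ 2) = 0" unfolding g1 using w by simp
  then obtain g2 where g2: "g1 = [:- (w ^ 2), 1:] * g2" by (auto simp: poly_eq_0_iff_dvd dvd_def)
  have eq2: "g - [:c:] = [:0, 1:] * [:- (w ^ 2), 1:] * g2" unfolding g1 g2 by (simp only: mult.assoc)
  define X where "X = [:0, 1::'a:]"
  have E1: "pcompose (g - [:c:]) Q = X ^ 2 * (X - [:w:]) * (X + [:w:]) * pcompose g2 Q"
  proof -
    have "pcompose ([:0, 1:] * [:- (w ^ 2), 1:]) Q = X ^ 2 * (X - [:w:]) * (X + [:w:])"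
      unfolding Q_def X_def by (simp add: pcompose_pCons power2_eq_square algebra_simps)
    thus ?thesis unfolding eq2 pcompose_mult by simp
  qed
  have E2: "pcompose (pcompose (g - [:c:]) Q) T = (X + [:w:]) ^ 2 * X * (X - [:w:]) * pcompose (pcompose g2 Q) T"
  proof -
    have "pcompose X T = X + [:w:]" "pcompose (X - [:w:]) T = X" "pcompose (X + [:w:]) T = X - [:w:]"
      unfolding X_def T_def using two[of w] by (simp_all add: pcompose_pCons)
    thus ?thesis unfolding E1 pcompose_mult power2_eq_square by simp
  qed
  have E3: "pcompose (pcompose (g - [:c:]) Q) T = pcompose (g - [:c:]) Q"
    using g unfolding Q_def T_def by (simp add: pcompose_diff)
  have nz: "X * (X - [:w:]) * (X + [:w:]) \<noteq> 0" unfolding X_def by simp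
  have "X * (X - [:w:]) * (X + [:w:]) * ((X + [:w:]) * pcompose (pcompose g2 Q) T)
      = X * (X - [:w:]) * (X + [:w:]) * (X * pcompose g2 Q)"
    using E1 E2 E3 by (simp add: power2_eq_square mult_ac)
  hence E4: "(X + [:w:]) * pcompose (pcompose g2 Q) T = X * pcompose g2 Q"
    using nz by (metis mult_cancel_left)
  \<comment> \<open>At x = - w the factor x + w on the left vanishes, while x on the right does not.
    So w^2 is a root a second time, which makes the divisor cubic.\<close>
  have "poly g2 (w ^ 2) = 0"
    using arg_cong[OF E4, of "\<lambda>f. poly f (- w)"] w unfolding X_def by (simp add: poly_pcompose pQ)
  then obtain g3 where g3: "g2 = [:- (w ^ 2), 1:] * g3" by (auto simp: poly_eq_0_iff_dvd dvd_def)
  have E5: "pcompose g2 Q = (X - [:w:]) * (X + [:w:]) * pcompose g3 Q"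
  proof -
    have "pcompose [:- (w ^ 2), 1:] Q = (X - [:w:]) * (X + [:w:])"
      unfolding Q_def X_def by (simp add: pcompose_pCons power2_eq_square algebra_simps)
    thus ?thesis unfolding g3 pcompose_mult by simp
  qed
  have E6: "pcompose (pcompose g2 Q) T = X * (X - [:w:]) * pcompose (pcompose g3 Q) T"
  proof -
    have "pcompose (X - [:w:]) T = X" "pcompose (X + [:w:]) T = X - [:w:]"
      unfolding X_def T_def using two[of w] by (simp_all add: pcompose_pCons)
    thus ?thesis unfolding E5 pcompose_mult by simp
  qed
  have "X * (X - [:w:]) * (X + [:w:]) * pcompose (pcompose g3 Q) T
      = X * (X - [:w:]) * (X + [:w:]) * pcompose g3 Q"
    using E4[unfolded E6, unfolded E5] by (simp only: mult_ac)
  hence "pcompose (pcompose g3 Q) T = pcompose g3 Q" using nz by (metis mult_cancel_left)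
  moreover have "g = ([:0, 1:] * [:- (w ^ 2), 1:] ^ 2) * g3 + [:c:]"
  proof -
    have "g = [:0, 1:] * [:- (w ^ 2), 1:] * g2 + [:c:]" using eq2 by (metis diff_add_cancel)
    thus ?thesis unfolding g3 by (simp only: power2_eq_square mult.assoc)
  qed
  ultimately show ?thesis unfolding Q_def T_def by blast
qed

text \<open>This is the case p = l + 1, where i = 1 solves p i = l + i and
  \<open>inj_on_pcompose_wild\<close> need not apply. In characteristic 3, substituting x + c turns
  x^2 + c x into x^2 - c^2, so f is symmetric about c. A collision gives a second centre C, and the
  two reflections compose to the translation by 2 (C - c).\<close>

lemma card_compositions_quadratic_right_char3:
  assumes char: "CHAR('a::{field,finite}) = 3" and m: "m \<ge> 3"
  shows "CARD('a) ^ m \<le> card (compositions m 2 :: 'a poly set) + CARD('a) ^ (m - 1)"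
proof -
  let ?q = "CARD('a)"
  let ?\<phi> = "\<lambda>(g, h). pcompose g h :: 'a poly"
  have q: "?q \<ge> 1" using zero_less_card_finite[where ?'a = 'a] by linarith
  have three: "x + x + x = 0" for x :: 'a
  proof -
    have "of_nat 3 = (0::'a)" using char by (metis of_nat_CHAR)
    hence "(3::'a) = 0" by simp
    hence "3 * x = 0" by simp
    thus ?thesis by (simp add: algebra_simps)
  qed
  have two: "x + x = - x" for x :: 'a using three[of x] by (simp add: eq_neg_iff_add_eq_0)
  let ?P = "monic_original m \<times> monic_original 2 :: ('a poly \<times> 'a poly) set"
  define S where "S w = {g :: 'a poly. pcompose (pcompose g [:0, 0, 1:]) [:w, 1:] = pcompose g [:0, 0, 1:]}" for w
  \<comment> \<open>\<open>\<nu> c g\<close> is g(x - c^2) freed of its constant term. Evaluated at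
    x^2 it is f(x + c) up to a constant, for f = g(x^2 + c x).\<close>
  define \<nu> where "\<nu> c g = pcompose g [:- (c ^ 2), 1:] - [:poly g (- (c ^ 2)):]" for c and g :: "'a poly"
  define BB where "BB = (\<lambda>(c, w). {g \<in> monic_original m. \<nu> c g \<in> S w})"
  define B where "B = (\<Union>cw\<in>UNIV \<times> (UNIV - {0}). BB cw \<times> {[:0, fst cw, 1:]})"
  have \<nu>_mo: "\<nu> c g \<in> monic_original m" if g: "g \<in> monic_original m" for c g
  proof -
    have d: "degree (pcompose g [:- (c ^ 2), 1:]) = m" using g by (simp add: degree_pcompose monic_originalD)
    have "lead_coeff (pcompose g [:- (c ^ 2), 1:]) = 1"
      using lead_coeff_comp[of "[:- (c ^ 2), 1:]" g] g by (simp add: monic_originalD)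
    moreover have "coeff [:poly g (- (c ^ 2)):] m = 0" using m by (intro coeff_eq_0) simp
    ultimately show ?thesis unfolding \<nu>_def monic_original_def using d by simp
  qed
  have \<nu>_inj: "inj_on (\<nu> c) (monic_original m)" for c
  proof (rule inj_onI)
    fix g g' assume g: "g \<in> monic_original m" "g' \<in> monic_original m" and eq: "\<nu> c g = \<nu> c g'"
    have "pcompose (\<nu> c x) [:c ^ 2, 1:] = x - [:poly x (- (c ^ 2)):]" for x
      unfolding \<nu>_def pcompose_diff by (simp add: pcompose_pCons flip: pcompose_assoc)
    hence eq': "g - [:poly g (- (c ^ 2)):] = g' - [:poly g' (- (c ^ 2)):]" using eq by metis
    from arg_cong[OF this, of "\<lambda>x. coeff x 0"] g
    have "poly g (- (c ^ 2)) = poly g' (- (c ^ 2))" by (simp add: monic_originalD)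
    with eq' show "g = g'" by (metis diff_add_cancel)
  qed
  have cBB: "card (BB cw) \<le> ?q ^ (m div 3 - 1)" if "cw \<in> UNIV \<times> (UNIV - {0})" for cw
  proof -
    obtain c w where cw: "cw = (c, w)" by (metis surj_pair)
    have w: "w \<noteq> 0" using that unfolding cw by simp
    have BB: "BB cw = {g \<in> monic_original m. \<nu> c g \<in> S w}" unfolding cw BB_def by simp
    hence "inj_on (\<nu> c) (BB cw)" by (intro inj_on_subset[OF \<nu>_inj]) blast
    hence "card (BB cw) = card (\<nu> c ` BB cw)" by (simp only: card_image)
    also have "\<nu> c ` BB cw \<subseteq> S w \<inter> monic_original m" using \<nu>_mo unfolding BB by blast
    hence "card (\<nu> c ` BB cw) \<le> card (S w \<inter> monic_original m)"
      by (intro card_mono finite_Int disjI2 finite_monic_original)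
    also have "\<dots> \<le> ?q ^ (m div 3 - 1)"
    proof (rule card_divisor_closed_set_le[where \<Gamma> = "[:0, 1:] * [:- (w ^ 2), 1:] ^ 2"])
      show "[:0, 1:] * [:- (w ^ 2), 1:] ^ 2 \<in> monic_original 3"
        by (auto simp: monic_original_def power2_eq_square numeral_3_eq_3)
      show "\<exists>c f'. f = [:0, 1:] * [:- (w ^ 2), 1:] ^ 2 * f' + [:c:] \<and> f' \<in> S w" if "f \<in> S w" for f
        using even_translation_invariant_division[OF char w, of f] that unfolding S_def by blast
    qed (use m in auto)
    finally show ?thesis .
  qed
  have finB: "finite B"
    by (rule finite_subset[of _ ?P]) (auto simp: B_def BB_def finite_monic_original monic_original_2I)
  have "card B \<le> (\<Sum>cw\<in>UNIV \<times> (UNIV - {0}). card (BB cw \<times> {[:0, fst cw, 1:]}))"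
    unfolding B_def by (rule card_UN_le) simp
  also have "\<dots> \<le> (\<Sum>cw\<in>(UNIV :: 'a set) \<times> (UNIV - {0 :: 'a}). ?q ^ (m div 3 - 1))"
    by (rule sum_mono) (use cBB in \<open>simp add: card_cartesian_product\<close>)
  also have "\<dots> = ?q * (?q - 1) * ?q ^ (m div 3 - 1)" by (simp add: card_cartesian_product card_Diff_subset)
  also have "\<dots> \<le> ?q * ?q * ?q ^ (m div 3 - 1)" by (intro mult_right_mono mult_left_mono) auto
  also have "\<dots> = ?q ^ Suc (Suc (m div 3 - 1))" by simp
  \<comment> \<open>The exponents satisfy m div 3 + 1 \<le> m - 1, with equality at m = 3.\<close>
  also have "\<dots> \<le> ?q ^ (m - 1)"
    by (rule power_increasing) (use m q div_mult_mod_eq[of m 3] in linarith)+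
  finally have cB: "card B \<le> ?q ^ (m - 1)" .
  have "inj_on ?\<phi> (?P - B)"
  proof (rule inj_onI)
    fix z1 z2 assume z: "z1 \<in> ?P - B" "z2 \<in> ?P - B" "?\<phi> z1 = ?\<phi> z2"
    obtain g h where z1: "z1 = (g, h)" by (metis surj_pair)
    obtain G H where z2: "z2 = (G, H)" by (metis surj_pair)
    have A: "g \<in> monic_original m" "h \<in> monic_original 2" "(g, h) \<notin> B"
      "G \<in> monic_original m" "H \<in> monic_original 2" and eq: "pcompose g h = pcompose G H"
      using z unfolding z1 z2 by simp_all
    define c where "c = coeff h 1"
    define C where "C = coeff H 1"
    have h: "h = [:0, c, 1:]" and H: "H = [:0, C, 1:]"
      using monic_original_2_eq A(2,5) unfolding c_def C_def by auto
    have center: "pcompose [:0, x, 1:] [:x, 1:] = pcompose [:- (x ^ 2), 1:] [:0, 0, 1:]" for x :: 'a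
      using three[of x] two[of "x * x"]
      by (simp add: pcompose_pCons power2_eq_square algebra_simps)
    have "c = C"
    proof (rule ccontr)
      assume ne: "c \<noteq> C"
      define \<delta> where "\<delta> = C - c"
      define w where "w = \<delta> + \<delta>"
      have w: "w \<noteq> 0" unfolding w_def two \<delta>_def using ne by simp
      define \<psi> where "\<psi> = pcompose (pcompose g h) [:c, 1:]"
      define \<psi>2 where "\<psi>2 = pcompose (pcompose G H) [:C, 1:]"
      have \<psi>: "\<psi> = pcompose (pcompose g [:- (c ^ 2), 1:]) [:0, 0, 1:]"
        unfolding \<psi>_def h by (simp only: pcompose_assoc[symmetric] center)
      have \<psi>2: "\<psi>2 = pcompose (pcompose G [:- (C ^ 2), 1:]) [:0, 0, 1:]"
        unfolding \<psi>2_def H by (simp only: pcompose_assoc[symmetric] center)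
      have sq: "pcompose [:0, 0, 1:] [:0, - 1:] = [:0, 0, 1 :: 'a:]" by (simp add: pcompose_pCons)
      have even: "pcompose \<psi> [:0, - 1:] = \<psi>" "pcompose \<psi>2 [:0, - 1:] = \<psi>2"
        unfolding \<psi> \<psi>2 by (simp_all only: pcompose_assoc[symmetric] sq)
      have shift: "pcompose \<psi> [:\<delta>, 1:] = \<psi>2"
        unfolding \<psi>_def \<psi>2_def eq \<delta>_def by (simp add: pcompose_pCons flip: pcompose_assoc)
      \<comment> \<open>The chain is \<psi>(x + 2 \<delta>) = \<psi>2(x + \<delta>) = \<psi>2(- x -
        \<delta>) = \<psi>(- x) = \<psi>(x).\<close>
      have "pcompose \<psi> [:w, 1:] = pcompose (pcompose \<psi> [:\<delta>, 1:]) [:\<delta>, 1:]"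
        unfolding w_def by (simp add: pcompose_pCons flip: pcompose_assoc)
      also have "\<dots> = pcompose (pcompose \<psi>2 [:0, - 1:]) [:\<delta>, 1:]" by (simp only: shift even)
      also have "\<dots> = pcompose (pcompose \<psi> [:\<delta>, 1:]) [:- \<delta>, - 1:]"
        unfolding shift by (simp add: pcompose_pCons flip: pcompose_assoc)
      also have "\<dots> = pcompose \<psi> [:0, - 1:]" by (simp add: pcompose_pCons flip: pcompose_assoc)
      finally have "pcompose \<psi> [:w, 1:] = \<psi>" by (simp only: even)
      hence "\<nu> c g \<in> S w" unfolding S_def \<nu>_def \<psi> by (simp add: pcompose_diff)
      hence "g \<in> BB (c, w)" using A(1) unfolding BB_def by simp
      hence "(g, h) \<in> B" unfolding B_def h using w by force
      with A(3) show False by simp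
    qed
    hence "h = H" using h H by metis
    moreover have "degree h > 0" using A(2) by (simp add: monic_originalD)
    ultimately show "z1 = z2" unfolding z1 z2 using eq pcompose_left_cancel[of g h G] by metis
  qed
  hence "card (?\<phi> ` (?P - B)) = card (?P - B)" by (rule card_image)
  moreover have "card ?P - card B \<le> card (?P - B)" by (rule diff_card_le_card_Diff[OF finB])
  moreover have "card (?\<phi> ` (?P - B)) \<le> card (compositions m 2 :: 'a poly set)"
    by (intro card_mono finite_compositions) (auto simp: compositions_def)
  moreover have "card ?P = ?q ^ m" using card_monic_original_Times[of m 2, where ?'a = 'a] m by simp
  ultimately show ?thesis using cB by linarith
qed

text \<open>The three summands count compositions that are told apart by $f'$: it vanishes in the first family
  (right factor $x^p$), has degree at least $(m - 2) p$ in the second, and is nonzero of smaller degree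
  in the third (left factor of degree $p$).\<close>

lemma card_compositions_Un_wild_cofactor:
  fixes m :: nat
  defines "p \<equiv> CHAR('a::{field,finite})"
  assumes m: "p dvd m" "m \<ge> 2 * p" and min: "\<And>r. prime r \<Longrightarrow> r dvd m \<Longrightarrow> p \<le> r"
    and J: "\<And>j. j \<in> J \<Longrightarrow> m - m div p < j \<and> j < m \<and> \<not> p dvd j"
  shows "CARD('a) ^ (m - 1)
     + card ((\<lambda>(g, h). pcompose g h :: 'a poly) `
          ({g \<in> monic_original m. coeff g (m - 1) \<noteq> 0} \<times> (monic_original p - {monom 1 p})))
     + (CARD('a) - 1) * CARD('a) ^ (p - 2) * (CARD('a) ^ (m - 1) - CARD('a) ^ (m - 1 - card J))
     \<le> card (compositions p m \<union> compositions m p :: 'a poly set)"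
proof -
  let ?q = "CARD('a)"
  let ?\<phi> = "\<lambda>(g, h). pcompose g h :: 'a poly"
  have p: "prime p" "p \<ge> 2" unfolding p_def using prime_CHAR_finite prime_ge_2_nat by blast+
  have m2: "m \<ge> 2" using m(2) p by linarith
  define S1 where "S1 = (\<lambda>g. pcompose g (monom 1 p)) ` (monic_original m :: 'a poly set)"
  define P2 where "P2 = {g \<in> monic_original m :: 'a poly set. coeff g (m - 1) \<noteq> 0} \<times> (monic_original p - {monom 1 p :: 'a poly})"
  define S2 where "S2 = ?\<phi> ` P2"
  define H3 where "H3 = {h \<in> monic_original m :: 'a poly set. \<exists>j\<in>J. coeff h j \<noteq> 0}"
  define P3 where "P3 = {g \<in> monic_original p :: 'a poly set. coeff g (p - 1) \<noteq> 0} \<times> H3"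
  define S3 where "S3 = ?\<phi> ` P3"
  let ?U = "compositions p m \<union> compositions m p :: 'a poly set"
  have monom: "monom 1 p \<in> (monic_original p :: 'a poly set)" using p by (intro monom_in_monic_original) simp
  have S1_sub: "S1 \<subseteq> compositions m p" unfolding S1_def compositions_def using monom by auto
  have S2_sub: "S2 \<subseteq> compositions m p" unfolding S2_def P2_def compositions_def by auto
  have S3_sub: "S3 \<subseteq> compositions p m" unfolding S3_def P3_def H3_def compositions_def by auto
  have d1: "pderiv f = 0" if "f \<in> S1" for f
    using that pderiv_eq_0_iff_monom[of "monom 1 p :: 'a poly"] monom
    unfolding S1_def by (auto simp: pderiv_pcompose p_def)
  \<comment> \<open>This gap separates the second family from the third. It amounts to 2 p < m + 1,
    whence the hypothesis m \<ge> 2 p.\<close>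
  have big: "(p - 2) * m + (m - 1) < (m - 2) * p"
  proof -
    have "p = (p - 2) + 2" "m = (m - 2) + 2" using p m2 by linarith+
    hence "(p - 2) * m + 2 * m = p * m" "(m - 2) * p + 2 * p = p * m"
      by (metis add_mult_distrib mult.commute)+
    thus ?thesis using m p by linarith
  qed
  have d2: "degree (pderiv f) \<ge> (m - 2) * p" if f: "f \<in> S2" for f
  proof -
    obtain x where x: "f = ?\<phi> x" "x \<in> P2" using f unfolding S2_def by blast
    obtain g h where xg: "x = (g, h)" by (metis surj_pair)
    have gh: "g \<in> monic_original m" "coeff g (m - 1) \<noteq> 0" "h \<in> monic_original p"
      "h \<noteq> monom 1 p" "f = pcompose g h"
      using x unfolding xg P2_def by simp_all
    have h': "pderiv h \<noteq> 0" using pderiv_eq_0_iff_monom gh(3,4) unfolding p_def by blast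
    have "coeff (pderiv f) ((m - 2) * p + degree (pderiv h)) \<noteq> 0"
      using coeff_pderiv_pcompose(2)[OF gh(1) _ m2 gh(3), of "degree (pderiv h)"] m(1) p gh(2) h'
      unfolding gh(5) p_def by simp
    thus ?thesis using le_degree trans_le_add1 by (metis add_leD1)
  qed
  have d3: "pderiv f \<noteq> 0 \<and> degree (pderiv f) \<le> (p - 2) * m + (m - 1)" if f: "f \<in> S3" for f
  proof
    show "degree (pderiv f) \<le> (p - 2) * m + (m - 1)"
      using degree_pderiv_compositions_wild[of f m] S3_sub f m2 unfolding p_def by auto
    obtain x where x: "f = ?\<phi> x" "x \<in> P3" using f unfolding S3_def by blast
    obtain g h where xg: "x = (g, h)" by (metis surj_pair)
    obtain j where j: "j \<in> J" "coeff h j \<noteq> 0" using x unfolding xg P3_def H3_def by auto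
    have "g \<in> monic_original p" "coeff g (p - 1) \<noteq> 0" "h \<in> monic_original m" "f = pcompose g h"
      using x unfolding xg P3_def H3_def by simp_all
    note gh = this(1-3) j this(4)
    obtain j0 where j0: "j = Suc j0" using J[OF gh(4)] by (cases j) auto
    have "coeff (pderiv h) j0 \<noteq> 0"
      using J[OF gh(4)] gh(5) by (auto simp: j0 coeff_pderiv of_nat_eq_0_iff_char_dvd p_def simp del: of_nat_Suc)
    hence h': "pderiv h \<noteq> 0" by auto
    have "coeff (pderiv f) ((p - 2) * m + degree (pderiv h)) \<noteq> 0"
      using coeff_pderiv_pcompose(2)[OF gh(1) _ p(2) gh(3), of "degree (pderiv h)"] m2 gh(2) h'
      unfolding gh(6) p_def by simp
    thus "pderiv f \<noteq> 0" by auto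
  qed
  have dis12: "S1 \<inter> S2 = {}" using d1 d2 big by fastforce
  have dis3: "(S1 \<union> S2) \<inter> S3 = {}" using d1 d2 d3 big by fastforce
  have finU: "finite ?U" by (simp add: finite_compositions)
  have "S1 \<union> S2 \<union> S3 \<subseteq> ?U" using S1_sub S2_sub S3_sub by auto
  hence le: "card (S1 \<union> S2 \<union> S3) \<le> card ?U" by (rule card_mono[OF finU])
  have fin: "finite S1" "finite S2" "finite S3"
    using S1_sub S2_sub S3_sub finite_compositions finite_subset by blast+
  have "card (S1 \<union> S2 \<union> S3) = card S1 + card S2 + card S3"
    using dis12 dis3 fin by (simp add: card_Un_disjoint)
  moreover have "card S1 = ?q ^ (m - 1)"
  proof -
    have "inj_on (\<lambda>g. pcompose g (monom 1 p)) (monic_original m :: 'a poly set)"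
      by (rule inj_onI, rule pcompose_left_cancel) (use p in \<open>auto simp: degree_monom_eq\<close>)
    thus ?thesis unfolding S1_def using m2 by (simp add: card_image card_monic_original)
  qed
  moreover have "card S3 = (?q - 1) * ?q ^ (p - 2) * (?q ^ (m - 1) - ?q ^ (m - 1 - card J))"
  proof -
    have "J \<subseteq> {1..<m}" using J by fastforce
    hence c0: "card {h \<in> monic_original m :: 'a poly set. \<forall>j\<in>J. coeff h j = 0} = ?q ^ (m - 1 - card J)"
      using card_monic_original_prescribed(1)[of m J "\<lambda>_. 0 :: 'a"] m2 by simp
    have "H3 = monic_original m - {h \<in> monic_original m. \<forall>j\<in>J. coeff h j = 0}"
      unfolding H3_def by auto
    hence "card H3 = card (monic_original m :: 'a poly set) - card {h \<in> monic_original m :: 'a poly set. \<forall>j\<in>J. coeff h j = 0}"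
      by (simp only:) (intro card_Diff_subset finite_subset[OF _ finite_monic_original[of m]]; auto)
    hence "card H3 = ?q ^ (m - 1) - ?q ^ (m - 1 - card J)"
      using c0 m2 by (simp add: card_monic_original)
    hence "card P3 = (?q - 1) * ?q ^ (p - 2) * (?q ^ (m - 1) - ?q ^ (m - 1 - card J))"
      unfolding P3_def using p by (simp add: card_cartesian_product card_monic_original_coeff_nonzero)
    moreover have "inj_on ?\<phi> P3"
      unfolding P3_def H3_def p_def
      by (rule inj_on_pcompose_CHAR_left) (use m(1) m2 min J in \<open>auto simp: p_def\<close>)
    ultimately show ?thesis unfolding S3_def by (simp add: card_image)
  qed
  ultimately show ?thesis using le unfolding S2_def P2_def by simp
qed

subsection \<open>Lower bounds for the two extreme degree pairs\<close>

lemma CARD_ge_2: "CARD('a::{field,finite}) \<ge> 2"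
proof -
  have "card {0, 1::'a} \<le> CARD('a)" by (intro card_mono) auto
  thus ?thesis by simp
qed

lemma CHAR_le_CARD: "CHAR('a::{field,finite}) \<le> CARD('a)"
proof -
  have "inj_on (of_nat :: nat \<Rightarrow> 'a) {..<CHAR('a)}"
  proof (rule linorder_inj_onI)
    fix i j :: nat assume ij: "i < j" "i \<in> {..<CHAR('a)}" "j \<in> {..<CHAR('a)}"
    hence "\<not> CHAR('a) dvd j - i" by (auto dest: dvd_imp_le)
    hence "of_nat (j - i) \<noteq> (0::'a)" by (simp add: of_nat_eq_0_iff_char_dvd)
    thus "of_nat i \<noteq> (of_nat j :: 'a)" using ij by (simp add: of_nat_diff)
  qed auto
  from card_inj_on_le[OF this, of UNIV] show ?thesis by simp
qed

lemma card_compositions_Un_coprime: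
  assumes l: "l \<ge> 2" "\<not> CHAR('a::{field,finite}) dvd l" and m: "\<not> CHAR('a) dvd m" "m \<ge> 2"
  shows "2 * CARD('a) ^ (l + m - 2)
         \<le> card (compositions l m \<union> compositions m l :: 'a poly set) + CARD('a) ^ (2 * l - 3 + m div l)"
proof -
  have "card (compositions l m :: 'a poly set) = CARD('a) ^ (l + m - 2)"
    using card_compositions_tame[of l m, where ?'a = 'a] l m by simp
  moreover have "card (compositions m l :: 'a poly set) = CARD('a) ^ (l + m - 2)"
    using card_compositions_tame[of m l, where ?'a = 'a] l m by (simp add: add.commute)
  moreover have "card (compositions l m :: 'a poly set) + card (compositions m l :: 'a poly set)
      = card (compositions l m \<union> compositions m l :: 'a poly set)
      + card (compositions l m \<inter> compositions m l :: 'a poly set)"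
    by (intro card_Un_Int finite_compositions)
  moreover have "m \<ge> 1" using m(2) by simp
  ultimately show ?thesis using card_compositions_Int_le[OF l, of m] by linarith
qed

text \<open>This brings the intersection exponent 2 l - 3 + m div l down to l + m - 3, one factor q
  below the number of pairs.\<close>

lemma add_div_le:
  fixes l m :: nat
  assumes "l \<ge> 2" "m > l"
  shows "l + m div l \<le> m"
proof -
  define k where "k = m div l"
  have lk: "l * k \<le> m" unfolding k_def by simp
  show ?thesis
  proof (cases "k \<le> 1")
    case True
    thus ?thesis using assms unfolding k_def[symmetric] by linarith
  next
    case False
    then obtain k' where k: "k = k' + 2" by (metis add.commute le_add_diff_inverse not_less_eq_eq numeral_2_eq_2 One_nat_def)
    obtain l' where l': "l = l' + 2" using assms(1) by (metis add.commute le_Suc_ex)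
    have "l + k \<le> l * k" unfolding k l' by (simp add: algebra_simps)
    thus ?thesis using lk unfolding k_def by linarith
  qed
qed

text \<open>Left degree l is tame and loses nothing. For left degree m the power P of p in m is at
  least p; if p \<ge> l + 2 then P i > l + i, and the wild criterion applies. The remaining case p =
  l + 1 forces l = 2 and p = 3. The two error terms are the loss for left degree m and the
  intersection.\<close>

lemma card_compositions_Un_wild_left:
  assumes l: "prime l" "l < CHAR('a::{field,finite})" and m: "CHAR('a) dvd m" "m > 0"
  shows "2 * CARD('a) ^ (l + m - 2)
         \<le> card (compositions l m \<union> compositions m l :: 'a poly set) + 2 * CARD('a) ^ (l + m - 3)"
proof -
  define p where "p = CHAR('a)"
  let ?q = "CARD('a)"
  have p: "prime p" "p \<ge> 2" unfolding p_def using prime_CHAR_finite prime_ge_2_nat by blast+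
  have l2: "l \<ge> 2" by (rule prime_ge_2_nat[OF l(1)])
  have nl: "\<not> CHAR('a) dvd l" using l l2 by (auto dest: dvd_imp_le)
  have pm: "p \<le> m" using m unfolding p_def by (intro dvd_imp_le) auto
  have q: "?q \<ge> 2" by (rule CARD_ge_2)
  have split: "?q ^ (l + m - 2) = (?q - 1) * ?q ^ (l + m - 3) + ?q ^ (l + m - 3)"
  proof -
    have "l + m - 2 = Suc (l + m - 3)" using l2 pm p by linarith
    hence "?q ^ (l + m - 2) = ?q * ?q ^ (l + m - 3)" by simp
    also have "\<dots> = ((?q - 1) + 1) * ?q ^ (l + m - 3)" using q by simp
    finally show ?thesis by (simp only: add_mult_distrib mult_1)
  qed
  have B: "?q ^ (l + m - 2) \<le> card (compositions m l :: 'a poly set) + ?q ^ (l + m - 3)"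
  proof (cases "p = l + 1")
    case True
    have "l = 2"
    proof (rule ccontr)
      assume "l \<noteq> 2"
      hence "odd l" using prime_odd_nat l l2 by simp
      hence "even p" using True by simp
      hence "p = 2" using p prime_odd_nat[of p] by linarith
      with True l2 show False by simp
    qed
    with True have "CHAR('a) = 3" unfolding p_def by simp
    from card_compositions_quadratic_right_char3[OF this, of m] pm True \<open>l = 2\<close>
    show ?thesis by (simp add: numeral_3_eq_3 numeral_2_eq_2)
  next
    case False
    hence pl: "p \<ge> l + 2" using l(2) unfolding p_def by linarith
    define t where "t = multiplicity p m"
    obtain r where r: "m = p ^ t * r" "\<not> p dvd r"
      unfolding t_def using multiplicity_decompose'[of m p] m(2) p by (metis not_prime_unit neq0_conv)
    have "t \<noteq> 0" using r m(1) unfolding p_def by (metis mult_1 power_0)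
    hence pt: "p ^ t \<ge> p" using p by (metis Suc_leI le_antisym linorder_not_le not_gr_zero power_increasing
          power_one_right One_nat_def one_le_numeral order_trans)
    have "(?q - 1) * ?q ^ (m + l - 3) \<le> card (compositions m l :: 'a poly set)"
    proof (rule card_compositions_wild)
      show "m = CHAR('a) ^ t * r" "\<not> CHAR('a) dvd r" using r unfolding p_def by auto
      show "2 \<le> m" "1 \<le> l" using pm p l2 by auto
      show "\<not> CHAR('a) ^ t dvd l" using pt pl l2 unfolding p_def by (auto dest: dvd_imp_le)
      fix i assume i: "1 \<le> i" "i < l"
      have "l + 2 \<le> p ^ t" using pt pl by linarith
      hence "(l + 2) * i \<le> p ^ t * i" by (rule mult_le_mono1)
      moreover have "(l + 2) * i = l * i + 2 * i" by (rule add_mult_distrib)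
      moreover have "l \<le> l * i" using i by simp
      ultimately show "CHAR('a) ^ t * i \<noteq> l + i" using i unfolding p_def by linarith
    qed
    thus ?thesis using split by (simp add: add.commute)
  qed
  have A: "card (compositions l m :: 'a poly set) = ?q ^ (l + m - 2)"
    using card_compositions_tame[of l m, where ?'a = 'a] l2 nl m by simp
  have I: "card (compositions l m \<inter> compositions m l :: 'a poly set) \<le> ?q ^ (l + m - 3)"
  proof -
    have "l + m div l \<le> m" using l pm l2 unfolding p_def by (intro add_div_le) auto
    hence "2 * l - 3 + m div l \<le> l + m - 3" using l2 by linarith
    hence "?q ^ (2 * l - 3 + m div l) \<le> ?q ^ (l + m - 3)" using q by (intro power_increasing) auto
    with card_compositions_Int_le[OF l2 nl, of m] m show ?thesis by simp
  qed
  have "card (compositions l m :: 'a poly set) + card (compositions m l :: 'a poly set)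
      = card (compositions l m \<union> compositions m l :: 'a poly set)
      + card (compositions l m \<inter> compositions m l :: 'a poly set)"
    by (intro card_Un_Int finite_compositions)
  with A B I show ?thesis by linarith
qed

lemma card_wild_right_pairs:
  assumes "m \<ge> 2"
  shows "card ({g \<in> monic_original m :: 'a::{field,finite} poly set. coeff g (m - 1) \<noteq> 0}
             \<times> (monic_original CHAR('a) - {monom 1 CHAR('a) :: 'a poly}))
       = (CARD('a) - 1) * CARD('a) ^ (m - 2) * (CARD('a) ^ (CHAR('a) - 1) - 1)"
proof -
  have "CHAR('a) \<ge> 1" using prime_gt_0_nat[OF prime_CHAR_finite[where ?'a = 'a]] by linarith
  moreover from this have "monom 1 CHAR('a) \<in> (monic_original CHAR('a) :: 'a poly set)"
    by (rule monom_in_monic_original)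
  ultimately show ?thesis using assms
    by (simp add: card_cartesian_product card_monic_original_coeff_nonzero card_monic_original
        card_Diff_singleton)
qed

text \<open>The power P of p in m is at least p^2 \<ge> 2 p here, too large to divide p or to
  satisfy P i = p + i, so no collisions occur.\<close>

lemma card_wild_right_image_square:
  fixes m :: nat
  assumes m: "CHAR('a::{field,finite}) ^ 2 dvd m" "m > 0"
  shows "card ((\<lambda>(g, h). pcompose g h :: 'a poly) `
          ({g \<in> monic_original m. coeff g (m - 1) \<noteq> 0} \<times> (monic_original CHAR('a) - {monom 1 CHAR('a)})))
     = (CARD('a) - 1) * CARD('a) ^ (m - 2) * (CARD('a) ^ (CHAR('a) - 1) - 1)"
proof -
  define p where "p = CHAR('a)"
  have p: "prime p" "p \<ge> 2" unfolding p_def using prime_CHAR_finite prime_ge_2_nat by blast+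
  define t where "t = multiplicity p m"
  obtain r where r: "m = p ^ t * r" "\<not> p dvd r"
    unfolding t_def using multiplicity_decompose'[of m p] m(2) p by (metis not_prime_unit neq0_conv)
  have t2: "t \<ge> 2" unfolding t_def using m p not_prime_unit
    by (intro multiplicity_geI) (auto simp: p_def)
  have "p ^ 2 \<le> p ^ t" using t2 p by (intro power_increasing) auto
  moreover have "2 * p \<le> p ^ 2" using p by (simp add: power2_eq_square)
  ultimately have pt: "2 * p \<le> p ^ t" by linarith
  have m2: "m \<ge> 2" using m p unfolding p_def
    by (metis dvd_imp_le le_trans power2_nat_le_imp_le self_le_power zero_less_numeral le_numeral_extra(4) one_le_numeral)
  have "inj_on (\<lambda>(g, h). pcompose g h :: 'a poly) ({g \<in> monic_original m. coeff g (m - 1) \<noteq> 0} \<times> monic_original p)"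
  proof (rule inj_on_pcompose_wild)
    show "m = CHAR('a) ^ t * r" "\<not> CHAR('a) dvd r" using r unfolding p_def by auto
    show "2 \<le> m" "1 \<le> p" using m2 p by auto
    show "\<not> CHAR('a) ^ t dvd p" using pt p unfolding p_def by (auto dest: dvd_imp_le)
    fix i assume i: "1 \<le> i" "i < p"
    have "2 * p * i \<le> p ^ t * i" using pt by simp
    moreover have "p \<le> p * i" using i by simp
    ultimately show "CHAR('a) ^ t * i \<noteq> p + i" using i unfolding p_def by linarith
  qed
  hence "inj_on (\<lambda>(g, h). pcompose g h :: 'a poly)
     ({g \<in> monic_original m. coeff g (m - 1) \<noteq> 0} \<times> (monic_original CHAR('a) - {monom 1 CHAR('a)}))"
    by (rule inj_on_subset) (auto simp: p_def)
  thus ?thesis using card_wild_right_pairs[OF m2, where ?'a = 'a] by (simp add: card_image)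
qed

text \<open>In the unit \<open>W\<close> a full family of q^(p + m - 2) pairs measures q^2. The
  three families of \<open>card_compositions_Un_wild_cofactor\<close> are added up; only the middle
  one, of size \<open>s2\<close>, can suffer collisions. It has none if p^2 divides m, and otherwise
  is cut by the collision count or, for p = 2, by translation invariance.\<close>

lemma wild_cofactor_bounds:
  fixes m :: nat
  defines "p \<equiv> CHAR('a::{field,finite})" and "q \<equiv> real CARD('a)"
  assumes m: "p dvd m" "m \<ge> 2 * p" and min: "\<And>r. prime r \<Longrightarrow> r dvd m \<Longrightarrow> p \<le> r"
  defines "K \<equiv> real (card (compositions p m \<union> compositions m p :: 'a poly set))"
    and "W \<equiv> q ^ (p + m - 4)"
  shows "q ^ 2 * W \<le> K"
    and "p ^ 2 dvd m \<Longrightarrow> 2 * (q ^ 2 - 2 * q) * W \<le> K"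
    and "\<not> p ^ 2 dvd m \<Longrightarrow> q > 5 \<Longrightarrow> (3 / 2 * q ^ 2 - q) * W \<le> K"
proof -
  have p: "prime p" "p \<ge> 2" unfolding p_def using prime_CHAR_finite prime_ge_2_nat by blast+
  have m4: "m \<ge> 4" using m p by linarith
  have q2: "q \<ge> 2" unfolding q_def using CARD_ge_2[where ?'a = 'a] by simp
  have q0: "q > 0" using q2 by simp
  have W0: "W > 0" unfolding W_def using q0 by simp
  have qn: "real (CARD('a) - 1) = q - 1" "real (CARD('a) - 2) = q - 2"
    unfolding q_def using CARD_ge_2[where ?'a = 'a] by (simp_all add: of_nat_diff)
  have cq: "real (CARD('a) ^ n) = q ^ n" for n unfolding q_def by simp
  let ?P2 = "{g \<in> monic_original m :: 'a poly set. coeff g (m - 1) \<noteq> 0} \<times> (monic_original p - {monom 1 p :: 'a poly})"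
  define s2 where "s2 = real (card ((\<lambda>(g, h). pcompose g h :: 'a poly) ` ?P2))"
  define V where "V = q ^ (m - 2)"
  have V0: "V > 0" unfolding V_def using q0 by simp
  have WV: "W = q ^ (p - 2) * V"
  proof -
    have "p + m - 4 = (p - 2) + (m - 2)" using p m4 by linarith
    thus ?thesis unfolding W_def V_def by (simp only: power_add)
  qed
  have qp: "q ^ (p - 1) = q * q ^ (p - 2)"
  proof -
    have "p - 1 = Suc (p - 2)" using p by linarith
    thus ?thesis by simp
  qed
  have cP2: "real (card ?P2) = (q - 1) * (q * W - V)"
  proof -
    have "m \<ge> 2" using m4 by simp
    have "real (card ?P2) = (q - 1) * V * (q ^ (p - 1) - 1)"
      unfolding p_def card_wild_right_pairs[OF \<open>m \<ge> 2\<close>] of_nat_mult qn V_def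
      using CARD_ge_2[where ?'a = 'a] by (simp add: of_nat_diff q_def)
    thus ?thesis unfolding qp WV by (simp add: algebra_simps)
  qed
  have main: "q ^ (m - 1) + s2 + (q - 1) * q ^ (p - 2) * (q ^ (m - 1) - q ^ (m - 1 - card J)) \<le> K"
    if J: "\<And>j. j \<in> J \<Longrightarrow> m - m div p < j \<and> j < m \<and> \<not> p dvd j" for J
  proof -
    have "CARD('a) ^ (m - 1 - card J) \<le> CARD('a) ^ (m - 1)"
      using CARD_ge_2[where ?'a = 'a] by (intro power_increasing) auto
    hence *: "real (CARD('a) ^ (m - 1) - CARD('a) ^ (m - 1 - card J)) = q ^ (m - 1) - q ^ (m - 1 - card J)"
      by (simp only: of_nat_diff cq)
    from card_compositions_Un_wild_cofactor[OF m(1)[unfolded p_def] m(2)[unfolded p_def] min[unfolded p_def] J[unfolded p_def]]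
    have "real (CARD('a) ^ (m - 1)
     + card ((\<lambda>(g, h). pcompose g h :: 'a poly) ` ?P2)
     + (CARD('a) - 1) * CARD('a) ^ (p - 2) * (CARD('a) ^ (m - 1) - CARD('a) ^ (m - 1 - card J))) \<le> K"
      unfolding K_def p_def by (intro of_nat_mono) blast
    thus ?thesis unfolding of_nat_add of_nat_mult qn * cq s2_def .
  qed
  have qm: "q ^ (m - 1) = q * V" unfolding V_def
  proof -
    have "m - 1 = Suc (m - 2)" using m4 by linarith
    thus "q ^ (m - 1) = q * q ^ (m - 2)" by simp
  qed
  have pm1: "\<not> p dvd m - 1"
  proof
    assume "p dvd m - 1"
    hence "p dvd m - (m - 1)" by (rule dvd_diff_nat[OF m(1)])
    moreover have "m - (m - 1) = 1" using m4 by linarith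
    ultimately have "p dvd 1" by metis
    thus False using p by simp
  qed
  have mp: "m div p \<ge> 2" using m p by (metis div_le_mono nonzero_mult_div_cancel_right not_numeral_le_zero)
  \<comment> \<open>The single index m - 1 already makes the third family as large as (q - 1)^2
    W.\<close>
  have main1: "q * V + s2 + (q - 1) * (q - 1) * W \<le> K"
  proof -
    have "m - 1 - card {m - 1} = m - 2" by simp
    with main[of "{m - 1}"] show ?thesis
      using mp pm1 m4 unfolding qm by (simp add: V_def[symmetric] WV algebra_simps)
  qed
  have square: "s2 = (q - 1) * (q * W - V)" if "p ^ 2 dvd m"
  proof -
    have "card ((\<lambda>(g, h). pcompose g h :: 'a poly) ` ?P2) = card ?P2"
      using card_wild_right_image_square[of m, where ?'a = 'a] card_wild_right_pairs[of m, where ?'a = 'a] that m4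
      unfolding p_def by simp
    thus ?thesis unfolding s2_def using cP2 by simp
  qed
  have V_le_W: "V \<le> W" unfolding WV using q2 V0 one_le_power[of q "p - 2"] by simp
  show B: "2 * (q ^ 2 - 2 * q) * W \<le> K" if "p ^ 2 dvd m"
  proof -
    have "(q - 1) * (q * W - W) \<le> s2"
      unfolding square[OF that] using V_le_W q2 by (intro mult_left_mono) auto
    moreover have "0 \<le> q * V" using q0 V0 by simp
    ultimately have "(q - 1) * (q * W - W) + (q - 1) * (q - 1) * W \<le> K" using main1 by linarith
    moreover have "(q - 1) * (q * W - W) + (q - 1) * (q - 1) * W = 2 * (q ^ 2 - 2 * q) * W + 2 * W"
      by (simp add: algebra_simps power2_eq_square)
    ultimately show ?thesis using W0 by linarith
  qed
  \<comment> \<open>For p = 2 the index m - 2 is even and cannot be put into \<open>J\<close>.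
    Translation invariance makes up for it by a sharper count of the middle family.\<close>
  have two: "q ^ 2 * W \<le> K \<and> (\<not> p ^ 2 dvd m \<longrightarrow> q > 5 \<longrightarrow> (3 / 2 * q ^ 2 - q) * W \<le> K)" if p2: "p = 2"
  proof -
    define Z where "Z = q ^ (m div 2 - 1)"
    have VW: "V = W" unfolding WV p2 by simp
    have "real ((CARD('a) - 1) * CARD('a) ^ (m - 2) * (CARD('a) - 1))
        \<le> real (card ((\<lambda>(g, h). pcompose g h :: 'a poly) ` ?P2)
         + (CARD('a) - 1) * (CARD('a) - 2) * CARD('a) ^ (m div 2 - 1))"
      using card_image_pcompose_char2[of m, where ?'a = 'a] p2 m4 unfolding p_def
      by (intro of_nat_mono) simp
    hence s2: "(q - 1) * W * (q - 1) \<le> s2 + (q - 1) * (q - 2) * Z"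
      unfolding of_nat_add of_nat_mult qn cq s2_def Z_def VW[symmetric] V_def .
    have K: "q * W + (q - 1) * W * (q - 1) - (q - 1) * (q - 2) * Z + (q - 1) * (q - 1) * W \<le> K"
      using main1 s2 unfolding VW by linarith
    have c0: "(q - 1) * (q - 2) \<ge> 0" using q2 by simp
    have "Z \<le> W" unfolding Z_def VW[symmetric] V_def using q2 m4 by (intro power_increasing) auto
    hence "(q - 1) * (q - 2) * Z \<le> (q - 1) * (q - 2) * W" by (intro mult_left_mono c0)
    moreover have "q * W + (q - 1) * W * (q - 1) - (q - 1) * (q - 2) * W + (q - 1) * (q - 1) * W = q ^ 2 * W"
      by (simp add: algebra_simps power2_eq_square)
    ultimately have "q ^ 2 * W \<le> K" using K by linarith
    moreover have "(3 / 2 * q ^ 2 - q) * W \<le> K" if n4: "\<not> p ^ 2 dvd m" and q5: "q > 5"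
    proof -
      \<comment> \<open>4 is divisible by p^2. From m = 6 on, the correction satisfies q^2 Z \<le>
        W, with equality at 6.\<close>
      have "m \<noteq> 4" using n4 p2 by auto
      moreover have "even m" using m(1) p2 by simp
      ultimately have m6: "m \<ge> 6" using m4 by presburger
      have "q ^ 2 * Z \<le> W"
      proof -
        have "q ^ 2 * Z = q ^ (2 + (m div 2 - 1))" unfolding Z_def by (simp only: power_add)
        also have "\<dots> \<le> q ^ (m - 2)" using q2 m6 by (intro power_increasing) auto
        finally show ?thesis unfolding VW[symmetric] V_def .
      qed
      moreover have "Z \<ge> 0" unfolding Z_def using q0 by simp
      moreover have "(q - 1) * (q - 2) \<le> q ^ 2" using q2 by (simp add: algebra_simps power2_eq_square)
      ultimately have "(q - 1) * (q - 2) * Z \<le> W" by (meson mult_right_mono order_trans)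
      hence "q * W + (q - 1) * W * (q - 1) - W + (q - 1) * (q - 1) * W \<le> K" using K by linarith
      moreover have "q * W + (q - 1) * W * (q - 1) - W + (q - 1) * (q - 1) * W
          = (3 / 2 * q ^ 2 - q) * W + (q * (q - 4) / 2 + 1) * W"
        by (simp add: algebra_simps power2_eq_square) (simp add: field_simps)
      moreover have "(q * (q - 4) / 2 + 1) * W \<ge> 0" using q5 W0 by (intro mult_nonneg_nonneg) auto
      ultimately show ?thesis by linarith
    qed
    ultimately show ?thesis by blast
  qed
  have odd: "q ^ 2 * W \<le> K \<and> (\<not> p ^ 2 dvd m \<longrightarrow> q > 5 \<longrightarrow> (3 / 2 * q ^ 2 - q) * W \<le> K)" if "p \<noteq> 2"
  proof -
    have p3: "p \<ge> 3" using that p by linarith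
    have q3: "q \<ge> 3" using CHAR_le_CARD[where ?'a = 'a] p3 unfolding q_def p_def by simp
    \<comment> \<open>This needs p \<ge> 3. As V is only bounded by W / q, the estimates below are
      multiplied by q to stay polynomial in q.\<close>
    have V: "q * V \<le> W"
    proof -
      have "q ^ 1 \<le> q ^ (p - 2)" using q2 p3 by (intro power_increasing) auto
      thus ?thesis unfolding WV using V0 by simp
    qed
    show ?thesis
    proof (cases "p ^ 2 dvd m")
      case True
      have "(q - 1) * (q * (q * W - V)) \<ge> (q - 1) * (q * (q * W) - W)"
        using V q2 by (intro mult_left_mono) (auto simp: algebra_simps)
      moreover have "q * K \<ge> q * s2 + q * ((q - 1) * (q - 1) * W)"
      proof -
        have "q * V \<ge> 0" using q0 V0 by simp
        hence "s2 + (q - 1) * (q - 1) * W \<le> K" using main1 by linarith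
        hence "q * (s2 + (q - 1) * (q - 1) * W) \<le> q * K" using q0 by (intro mult_left_mono) auto
        thus ?thesis by (simp only: distrib_left)
      qed
      ultimately have "q * K \<ge> (q - 1) * (q * (q * W) - W) + q * ((q - 1) * (q - 1) * W)"
        unfolding square[OF True] by (simp add: mult.left_commute)
      moreover have "(q - 1) * (q * (q * W) - W) + q * ((q - 1) * (q - 1) * W)
           = q * (q ^ 2 * W) + (q ^ 2 * (q - 3) + 1) * W"
        by (simp add: algebra_simps power2_eq_square)
      moreover have "(q ^ 2 * (q - 3) + 1) * W \<ge> 0" using q3 W0 by (intro mult_nonneg_nonneg) auto
      ultimately have "q * (q ^ 2 * W) \<le> q * K" by linarith
      hence "q ^ 2 * W \<le> K" using q0 by simp
      with True show ?thesis by blast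
    next
      case False
      define r where "r = m div p"
      have mr: "m = p * r" using m(1) unfolding r_def by simp
      have pr: "\<not> p dvd r" using False unfolding mr power2_eq_square by simp
      \<comment> \<open>The index m - 1 alone would not reach 3/2 q^2 - q. The second index m - 2
        exceeds m - m / p only if m / p > 2, and m / p = 2 would give m the prime divisor 2 <
        p.\<close>
      have r3: "r \<ge> 3"
      proof -
        have "r \<noteq> 2" using min[of 2] p3 unfolding mr by auto
        thus ?thesis using mp unfolding r_def by linarith
      qed
      have pm2: "\<not> p dvd m - 2"
      proof
        assume "p dvd m - 2"
        hence "p dvd m - (m - 2)" by (rule dvd_diff_nat[OF m(1)])
        hence "p dvd 2" using m4 by simp
        thus False using p3 by (auto dest: dvd_imp_le)
      qed
      define s3 where "s3 = (q - 1) * q ^ (p - 2) * (q * V - q ^ (m - 3))"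
      have c2: "card {m - 1, m - 2} = 2" using m4 by simp
      have "m - 1 - 2 = m - 3" by simp
      with main[of "{m - 1, m - 2}"] have K: "q * V + s2 + s3 \<le> K"
        using pm1 pm2 r3 m4 unfolding s3_def qm c2 r_def by fastforce
      have "q * q ^ (m - 3) = V"
      proof -
        have "m - 2 = Suc (m - 3)" using m4 by linarith
        thus ?thesis unfolding V_def by simp
      qed
      hence "q * s3 = (q - 1) * q ^ (p - 2) * (q * (q * V) - V)"
        unfolding s3_def by (metis mult.left_commute right_diff_distrib)
      hence s3: "q * s3 = (q - 1) * (q * (q * W) - W)"
        unfolding WV by (simp add: algebra_simps)
      have "2 * card ?P2 \<le> 2 * card ((\<lambda>(g, h). pcompose g h :: 'a poly) ` ?P2)
           + (CARD('a) - 1) * (CARD('a) - 2) * CARD('a) ^ (m + CHAR('a) - 4)"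
        by (rule card_image_pcompose_wild_right[of m r]) (use mr pr in \<open>auto simp: p_def\<close>)
      hence "real (2 * card ?P2) \<le> real (2 * card ((\<lambda>(g, h). pcompose g h :: 'a poly) ` ?P2)
           + (CARD('a) - 1) * (CARD('a) - 2) * CARD('a) ^ (m + p - 4))"
        unfolding p_def by (rule of_nat_mono)
      hence "2 * ((q - 1) * (q * W - V)) \<le> 2 * s2 + (q - 1) * (q - 2) * W"
        unfolding of_nat_add of_nat_mult qn cq cP2 s2_def[symmetric] W_def
        by (simp add: add.commute)
      hence "q * (2 * ((q - 1) * (q * W - V))) \<le> q * (2 * s2 + (q - 1) * (q - 2) * W)"
        using q0 by (intro mult_left_mono) auto
      moreover have "(q - 1) * (q * (q * W) - W) \<le> (q - 1) * (q * (q * W) - q * V)"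
        using V q2 by (intro mult_left_mono) auto
      ultimately have s2: "2 * ((q - 1) * (q * (q * W) - W)) \<le> 2 * (q * s2) + q * ((q - 1) * (q - 2) * W)"
        by (simp add: algebra_simps)
      have "q * (q * V + s2 + s3) \<le> q * K" using K q0 by (intro mult_left_mono) auto
      moreover have "q * (q * V) \<ge> 0" using q0 V0 by simp
      ultimately have "q * s2 + q * s3 \<le> q * K" by (simp add: algebra_simps)
      hence K2: "4 * ((q - 1) * (q * (q * W) - W)) - q * ((q - 1) * (q - 2) * W) \<le> 2 * (q * K)"
        using s2 s3 by linarith
      have "4 * ((q - 1) * (q * (q * W) - W)) - q * ((q - 1) * (q - 2) * W)
          = 2 * (q * (q ^ 2 * W)) + (q * (q * (q - 3) + 2 * (q - 3)) + 4) * W"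
        by (simp add: algebra_simps power2_eq_square)
      moreover have "(q * (q * (q - 3) + 2 * (q - 3)) + 4) * W \<ge> 0"
        using q3 W0 by (intro mult_nonneg_nonneg add_nonneg_nonneg) auto
      ultimately have "2 * (q * (q ^ 2 * W)) \<le> 2 * (q * K)" using K2 by linarith
      hence "q ^ 2 * W \<le> K" using q0 by simp
      moreover have "(3 / 2 * q ^ 2 - q) * W \<le> K" if q5: "q > 5"
      proof -
        \<comment> \<open>Multiplied by 2 q, the surplus over the claim is (q^2 - 6 q + 4) W, which
          is negative at q = 5 and nonnegative from q = 6 on.\<close>
        have q6: "q \<ge> 6" using q5 unfolding q_def by simp
        have "4 * ((q - 1) * (q * (q * W) - W)) - q * ((q - 1) * (q - 2) * W)
          = 2 * (q * ((3 / 2 * q ^ 2 - q) * W)) + (q * (q - 6) + 4) * W"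
          by (simp add: algebra_simps power2_eq_square)
        moreover have "(q * (q - 6) + 4) * W \<ge> 0"
          using q6 W0 by (intro mult_nonneg_nonneg add_nonneg_nonneg) auto
        ultimately have "2 * (q * ((3 / 2 * q ^ 2 - q) * W)) \<le> 2 * (q * K)" using K2 by linarith
        thus ?thesis using q0 by simp
      qed
      ultimately show ?thesis by blast
    qed
  qed
  show "q ^ 2 * W \<le> K" using two odd by blast
  show "(3 / 2 * q ^ 2 - q) * W \<le> K" if "\<not> p ^ 2 dvd m" "q > 5" using two odd that by blast
qed

subsection \<open>Summation over the divisors\<close>

lemma sum_power_le_next_power:
  assumes "finite A" "\<And>s. s \<in> A \<Longrightarrow> s \<le> M" "(q::real) \<ge> 2"
  shows "(\<Sum>s\<in>A. q ^ s) \<le> q ^ Suc M"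
proof -
  have "(\<Sum>s\<in>A. q ^ s) \<le> (\<Sum>s\<le>M. q ^ s)"
    using assms by (intro sum_mono2) auto
  also have "(\<Sum>s\<le>M. q ^ s) \<le> q ^ Suc M"
  proof (induction M)
    case (Suc M)
    have "(\<Sum>s\<le>Suc M. q ^ s) \<le> 2 * q ^ Suc M" using Suc by simp
    also have "\<dots> \<le> q * q ^ Suc M" using assms(3) by (intro mult_right_mono) auto
    finally show ?case by simp
  qed (use assms(3) in simp)
  finally show ?thesis .
qed

text \<open>One of $e$, $d/e$ is $l t$ with $t \ge l$; calling the other one $e'$, passing from the exponent
  $l + m$ to $e + d/e$ saves $(e' - l)(t - 1)$ against $m/(3l) = e' t/(3l)$. The three excluded degrees
  are those where the gain is less than 1; they have a single pair of middle divisors.\<close>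

lemma middle_divisor_exponent:
  fixes l m e :: nat
  assumes l: "prime l" and min: "\<And>r. prime r \<Longrightarrow> r dvd l * m \<Longrightarrow> l \<le> r"
    and e: "e dvd l * m" "l < e" "e < m" and exc: "l * m \<notin> {12, 16, 18}"
  shows "m + 3 * l * (e + l * m div e + 1) \<le> 3 * l * (l + m)"
proof -
  have l2: "l \<ge> 2" by (rule prime_ge_2_nat[OF l])
  obtain f where f: "l * m = e * f" using e(1) by auto
  have fe: "l * m div e = f" using f e(2) by simp
  have lf: "l < f"
  proof (rule ccontr)
    assume "\<not> l < f"
    hence "e * f \<le> e * l" by simp
    also have "\<dots> < m * l" using e(3) l2 by simp
    finally show False using f by (metis mult.commute nat_less_le)
  qed
  have cofactor: "l \<le> t" if t: "t dvd l * m" "t \<noteq> 1" for t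
  proof (cases "t = 0")
    case True
    thus ?thesis using t(1) e l2 by auto
  next
    case False
    obtain r where r: "prime r" "r dvd t" using prime_factor_nat[OF t(2)] by blast
    have "l \<le> r" using min[OF r(1)] r(2) t(1) by (metis dvd_trans)
    also have "r \<le> t" using r(2) False by (intro dvd_imp_le) auto
    finally show ?thesis .
  qed
  have "l dvd e \<or> l dvd f" using f l by (metis dvd_triv_left prime_dvd_mult_iff)
  hence "\<exists>e' t. m = e' * t \<and> e + f = e' + l * t \<and> l < e' \<and> l \<le> t"
  proof
    assume "l dvd e"
    then obtain t where t: "e = l * t" by auto
    have m: "m = f * t" using f l2 unfolding t by simp
    have "t \<noteq> 1" using e(2) t by auto
    moreover have "t dvd l * m" unfolding m by simp
    ultimately have "l \<le> t" using cofactor by blast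
    moreover have "e + f = f + l * t" unfolding t by simp
    ultimately show ?thesis using m lf by blast
  next
    assume "l dvd f"
    then obtain t where t: "f = l * t" by auto
    have "l * m = l * (e * t)" using f unfolding t by (simp only: mult.left_commute)
    hence m: "m = e * t" using l2 by simp
    have "t \<noteq> 1" using e(3) m by (cases "t = 1") simp_all
    moreover have "t dvd l * m" unfolding m by simp
    ultimately have "l \<le> t" using cofactor by blast
    thus ?thesis using m t e(2) by blast
  qed
  then obtain e' t where et: "m = e' * t" "e + f = e' + l * t" "l < e'" "l \<le> t" by blast
  obtain y where y: "t = l + y" using et(4) le_Suc_ex by blast
  obtain x where x: "e' = l + 1 + x" using et(3) by (metis Suc_eq_plus1 Suc_leI le_Suc_ex)
  have "e' * t + 3 * l * (e' + l * t + 1) \<le> 3 * l * (l + e' * t)"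
  proof (cases "l = 2")
    case True
    \<comment> \<open>The three pairs belong to the degrees 12, 18 and 16, in this order; they are
      exactly the failures of the next inequality.\<close>
    have ex: "(x, y) \<noteq> (0, 0)" "(x, y) \<noteq> (0, 1)" "(x, y) \<noteq> (1, 0)"
      using exc unfolding et(1) x y True by auto
    have "6 \<le> 4 * x + 3 * y + 5 * (x * y)"
    proof (cases "x = 0 \<or> y = 0")
      case False
      hence "x * y \<ge> 1" by simp
      moreover have "x \<ge> 1" "y \<ge> 1" using False by auto
      ultimately show ?thesis by linarith
    qed (use ex in auto)
    thus ?thesis unfolding x y True by (simp add: algebra_simps)
  next
    case False
    then obtain a where a: "l = a + 3" using l2 by (metis add.commute le_Suc_ex Suc_leI antisym_conv2 numeral_2_eq_2 numeral_3_eq_3)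
    \<comment> \<open>For odd l the number l + 1 is even, and 2 would be a prime divisor below
      l.\<close>
    have "x \<noteq> 0"
    proof
      assume "x = 0"
      hence "even e'" using prime_odd_nat[OF l] a x by simp
      hence "2 dvd l * m" using et(1) by simp
      thus False using min[of 2] a by simp
    qed
    then obtain b where b: "x = Suc b" by (cases x) auto
    show ?thesis unfolding x y a b by (simp add: algebra_simps)
  qed
  hence "m + 3 * l * (e + f + 1) \<le> 3 * l * (l + m)" unfolding et(1)[symmetric] et(2)[symmetric] .
  thus ?thesis by (simp only: fe)
qed

text \<open>Divisors pair up as e and d / e with the same exponent, whence the factor 2 and the
  restriction to e^2 \<le> d. There the sum of e and d / e determines e, so the exponents are
  distinct and the sum costs just one further power of q. In the three exceptional degrees at most
  one term remains, and this further power is not spent.\<close>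

lemma middle_divisor_sum:
  fixes l m :: nat and q :: real
  assumes l: "prime l" and min: "\<And>r. prime r \<Longrightarrow> r dvd l * m \<Longrightarrow> l \<le> r" and q: "q \<ge> 2"
  shows "(\<Sum>e | e dvd l * m \<and> l < e \<and> e < m. q ^ (e + l * m div e))
         \<le> 2 * q powr (real l + real m - real m / (3 * real l))"
proof -
  define d where "d = l * m"
  define s where "s e = e + d div e" for e
  define D where "D = {e. e dvd d \<and> l < e \<and> e < m}"
  define D1 where "D1 = {e \<in> D. e * e \<le> d}"
  define B where "B = q powr (real l + real m - real m / (3 * real l))"
  have l2: "l \<ge> 2" by (rule prime_ge_2_nat[OF l])
  have finD: "finite D" unfolding D_def by simp
  have finD1: "finite D1" unfolding D1_def using finD by simp
  have inv: "d div (d div e) = e" "s (d div e) = s e" if e: "e \<in> D" for e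
  proof -
    obtain f where f: "d = e * f" using e unfolding D_def by auto
    have "l \<noteq> 0" "m \<noteq> 0" using e l2 unfolding D_def by auto
    hence "d \<noteq> 0" unfolding d_def by simp
    hence "f \<noteq> 0" "e \<noteq> 0" unfolding f by simp_all
    thus "d div (d div e) = e" "s (d div e) = s e" unfolding s_def f by simp_all
  qed
  have "D \<subseteq> D1 \<union> (\<lambda>e. d div e) ` D1"
  proof
    fix e assume e: "e \<in> D"
    obtain f where f: "d = e * f" using e unfolding D_def by auto
    have de: "d div e = f" using f e unfolding D_def by auto
    show "e \<in> D1 \<union> (\<lambda>e. d div e) ` D1"
    proof (cases "e * e \<le> d")
      case False
      hence fe: "f < e" unfolding f by auto
      have "l < f"
      proof (rule ccontr)
        assume "\<not> l < f"
        hence "e * f \<le> e * l" by simp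
        also have "\<dots> < m * l" using e l2 unfolding D_def by simp
        finally show False using f unfolding d_def by (metis mult.commute nat_less_le)
      qed
      hence "f \<in> D1" using fe e f unfolding D1_def D_def by auto
      moreover have "e = d div f" using inv(1)[OF e] de by simp
      ultimately show ?thesis by blast
    qed (use e in \<open>auto simp: D1_def\<close>)
  qed
  hence "(\<Sum>e\<in>D. q ^ s e) \<le> (\<Sum>e\<in>D1 \<union> (\<lambda>e. d div e) ` D1. q ^ s e)"
    using finD1 q by (intro sum_mono2) auto
  also have "\<dots> \<le> (\<Sum>e\<in>D1. q ^ s e) + (\<Sum>e\<in>(\<lambda>e. d div e) ` D1. q ^ s e)"
    using finD1 q by (simp add: sum_Un sum_nonneg)
  also have "(\<Sum>e\<in>(\<lambda>e. d div e) ` D1. q ^ s e) = (\<Sum>e\<in>D1. q ^ s (d div e))"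
    by (rule sum.reindex_cong[where l = "\<lambda>e. d div e"])
       (auto intro!: inj_on_inverseI[where g = "\<lambda>e. d div e"] simp: inv D1_def)
  also have "\<dots> = (\<Sum>e\<in>D1. q ^ s e)" by (rule sum.cong) (auto simp: inv D1_def)
  finally have two: "(\<Sum>e\<in>D. q ^ s e) \<le> 2 * (\<Sum>e\<in>D1. q ^ s e)" by simp
  have single: "(\<Sum>e\<in>D1. q ^ s e) \<le> B"
    if "D1 \<subseteq> {e0}" and "real (s e0) \<le> real l + real m - real m / (3 * real l)" for e0
  proof -
    have "(\<Sum>e\<in>D1. q ^ s e) \<le> (\<Sum>e\<in>{e0}. q ^ s e)" using that(1) q by (intro sum_mono2) auto
    also have "\<dots> = q powr real (s e0)" using q by (simp add: powr_realpow)
    also have "\<dots> \<le> B" unfolding B_def using that(2) q by (intro powr_mono) auto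
    finally show ?thesis .
  qed
  have "(\<Sum>e\<in>D1. q ^ s e) \<le> B"
  proof (cases "d \<in> {12, 16, 18}")
    case True
    hence "l \<le> 2" using min[of 2] unfolding d_def[symmetric] by auto
    hence "l = 2" using l2 by simp
    with True consider "d = 12" "m = 6" | "d = 16" "m = 8" | "d = 18" "m = 9"
      unfolding d_def by auto
    thus ?thesis
    proof cases
      case 1
      have "D1 \<subseteq> {3}"
      proof
        fix e assume "e \<in> D1"
        hence e: "e > 2" "e * e \<le> 12" using 1 \<open>l = 2\<close> unfolding D1_def D_def by auto
        have "e < 4"
        proof (rule ccontr)
          assume "\<not> e < 4"
          hence "4 * 4 \<le> e * e" by (intro mult_mono) auto
          thus False using e by simp
        qed
        thus "e \<in> {3}" using e by simp
      qed
      thus ?thesis by (rule single) (simp add: s_def 1 \<open>l = 2\<close>)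
    next
      case 2
      have "D1 \<subseteq> {4}"
      proof
        fix e assume "e \<in> D1"
        hence e: "e > 2" "e * e \<le> 16" "e dvd 16" using 2 \<open>l = 2\<close> unfolding D1_def D_def by auto
        have "e < 5"
        proof (rule ccontr)
          assume "\<not> e < 5"
          hence "5 * 5 \<le> e * e" by (intro mult_mono) auto
          thus False using e by simp
        qed
        hence "e = 3 \<or> e = 4" using e(1) by linarith
        thus "e \<in> {4}" using e(3) by auto
      qed
      thus ?thesis by (rule single) (simp add: s_def 2 \<open>l = 2\<close>)
    next
      case 3
      have "D1 \<subseteq> {3}"
      proof
        fix e assume "e \<in> D1"
        hence e: "e > 2" "e * e \<le> 18" "e dvd 18" using 3 \<open>l = 2\<close> unfolding D1_def D_def by auto
        have "e < 5"
        proof (rule ccontr)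
          assume "\<not> e < 5"
          hence "5 * 5 \<le> e * e" by (intro mult_mono) auto
          thus False using e by simp
        qed
        hence "e = 3 \<or> e = 4" using e(1) by linarith
        thus "e \<in> {3}" using e(3) by auto
      qed
      thus ?thesis by (rule single) (simp add: s_def 3 \<open>l = 2\<close>)
    qed
  next
    case False
    show ?thesis
    proof (cases "D1 = {}")
      case True
      thus ?thesis unfolding B_def by simp
    next
      case ne: False
      have inj: "inj_on s D1"
      proof (rule inj_onI)
        fix e1 e2 assume e: "e1 \<in> D1" "e2 \<in> D1" "s e1 = s e2"
        obtain f1 where f1: "d = e1 * f1" using e unfolding D1_def D_def by auto
        obtain f2 where f2: "d = e2 * f2" using e unfolding D1_def D_def by auto
        have pos: "e1 > 0" "e2 > 0" using e l2 unfolding D1_def D_def by auto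
        have "e1 * e1 \<le> d" "e2 * e2 \<le> d" using e unfolding D1_def by blast+
        hence "e1 * e1 \<le> e1 * f1" "e2 * e2 \<le> e2 * f2" using f1 f2 by metis+
        hence le: "e1 \<le> f1" "e2 \<le> f2" using pos by simp_all
        have "d div e1 = f1" using f1 pos by simp
        moreover have "d div e2 = f2" using f2 pos by simp
        ultimately have sum: "e1 + f1 = e2 + f2" using e(3) unfolding s_def by simp
        \<comment> \<open>e1 is a root of the quadratic with roots e2 and f2, since sum and product
          agree.\<close>
        have "(int e1 - int e2) * (int e1 - int f2) = 0"
        proof -
          have "(int e1 - int e2) * (int e1 - int f2)
              = int e1 * int e1 - int e1 * (int e2 + int f2) + int e2 * int f2"
            by (simp add: algebra_simps)
          also have "int e2 + int f2 = int e1 + int f1" using sum by linarith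
          also have "int e2 * int f2 = int e1 * int f1" using f1 f2 by (metis of_nat_mult)
          finally show ?thesis by (simp add: algebra_simps)
        qed
        hence "e1 = e2 \<or> e1 = f2" by auto
        thus "e1 = e2"
        proof
          assume "e1 = f2"
          hence "f1 = e2" using sum by simp
          thus ?thesis using le \<open>e1 = f2\<close> by simp
        qed
      qed
      define M where "M = Max (s ` D1)"
      have "M \<in> s ` D1" unfolding M_def using finD1 ne by (intro Max_in) auto
      then obtain e0 where e0: "e0 \<in> D1" "M = s e0" by auto
      have "(\<Sum>e\<in>D1. q ^ s e) = (\<Sum>x\<in>s ` D1. q ^ x)" by (simp add: sum.reindex[OF inj])
      also have "\<dots> \<le> q ^ Suc M"
        using finD1 q by (intro sum_power_le_next_power) (auto simp: M_def)
      also have "\<dots> = q powr real (Suc M)" using q by (simp add: powr_realpow del: power_Suc of_nat_Suc)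
      also have "\<dots> \<le> B"
      proof -
        have "m + 3 * l * (e0 + l * m div e0 + 1) \<le> 3 * l * (l + m)"
          by (rule middle_divisor_exponent[OF l min]) (use e0(1) False in \<open>auto simp: D1_def D_def d_def\<close>)
        hence "m + 3 * l * (M + 1) \<le> 3 * l * (l + m)" unfolding e0(2) s_def d_def .
        hence "real (m + 3 * l * (M + 1)) \<le> real (3 * l * (l + m))" by (rule of_nat_mono)
        hence "real (Suc M) \<le> real l + real m - real m / (3 * real l)"
          using l2 by (simp add: field_simps)
        thus ?thesis unfolding B_def using q by (intro powr_mono) auto
      qed
      finally show ?thesis .
    qed
  qed
  with two show ?thesis unfolding D_def s_def d_def B_def by linarith
qed

section \<open>Upper and lower bounds for the number of monic decomposables\<close>

lemma card_monic_decomposables_le: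
  assumes "d \<ge> 1"
  shows "card (monic_decomposables d :: 'a::{field,finite} poly set)
     \<le> (\<Sum>e | e dvd d \<and> 1 < e \<and> e < d. CARD('a) ^ (e + d div e - 2))"
proof -
  have fin: "finite {e. e dvd d \<and> 1 < e \<and> e < d}" by simp
  have "card (monic_decomposables d :: 'a poly set)
     \<le> (\<Sum>e | e dvd d \<and> 1 < e \<and> e < d. card (compositions e (d div e) :: 'a poly set))"
    unfolding monic_decomposables_eq[OF assms] by (rule card_UN_le[OF fin])
  also have "\<dots> \<le> (\<Sum>e | e dvd d \<and> 1 < e \<and> e < d. CARD('a) ^ (e + d div e - 2))"
  proof (rule sum_mono)
    fix e assume "e \<in> {e. e dvd d \<and> 1 < e \<and> e < d}"
    hence "e \<ge> 1" "d div e \<ge> 1" by (auto simp: Suc_leI div_greater_zero_iff dvd_imp_le)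
    thus "card (compositions e (d div e) :: 'a poly set) \<le> CARD('a) ^ (e + d div e - 2)"
      by (rule card_compositions_le)
  qed
  finally show ?thesis .
qed

lemma compositions_Un_subset_monic_decomposables:
  assumes "l \<ge> 2" "m \<ge> 2"
  shows "compositions l m \<union> compositions m l \<subseteq> monic_decomposables (l * m)"
proof -
  have pos: "l * m \<ge> 1" using assms by simp
  have l: "l \<in> {e. e dvd l * m \<and> 1 < e \<and> e < l * m}" using assms by simp
  have m: "m \<in> {e. e dvd l * m \<and> 1 < e \<and> e < l * m}" using assms by simp
  have div: "l * m div l = m" "l * m div m = l" using assms by auto
  show ?thesis
    unfolding monic_decomposables_eq[OF pos]
    using UN_upper[OF l, of "\<lambda>e. compositions e (l * m div e)"]
      UN_upper[OF m, of "\<lambda>e. compositions e (l * m div e)"]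
    unfolding div by (rule Un_least)
qed

lemma card_compositions_Un_le_monic_decomposables:
  assumes "l \<ge> 2" "m \<ge> 2"
  shows "card (compositions l m \<union> compositions m l :: 'a::{field,finite} poly set)
         \<le> card (monic_decomposables (l * m) :: 'a poly set)"
proof (rule card_mono)
  show "finite (monic_decomposables (l * m) :: 'a poly set)"
    by (rule finite_subset[OF _ finite_monic_original[of "l * m"]]) (auto simp: monic_decomposables_def)
qed (rule compositions_Un_subset_monic_decomposables[OF assms])

text \<open>As l is the least prime divisor, every proper divisor lies between l and m. The two ends
  give the main term, and \<open>middle_divisor_sum\<close>, scaled by q^2, gives the error. For l =
  m the ends coincide and nothing lies between them.\<close>

lemma card_monic_decomposables_upper:
  fixes l m :: nat
  defines "q \<equiv> real CARD('a::{field,finite})"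
  defines "K \<equiv> real (card (monic_decomposables (l * m) :: 'a poly set))"
  assumes l: "prime l" and least: "\<forall>r. prime r \<longrightarrow> r dvd l * m \<longrightarrow> l \<le> r" and lm: "l \<le> m"
  shows "l = m \<Longrightarrow> K \<le> q ^ (l + m - 2)"
    and "l < m \<Longrightarrow> K \<le> 2 * q ^ (l + m - 2) * (1 + q powr (- real m / (3 * real l)))"
proof -
  note min = least[rule_format]
  have l2: "l \<ge> 2" by (rule prime_ge_2_nat[OF l])
  have q2: "q \<ge> 2" unfolding q_def using CARD_ge_2[where ?'a = 'a] by simp
  define E where "E = {e. e dvd l * m \<and> 1 < e \<and> e < l * m}"
  define D where "D = {e. e dvd l * m \<and> l < e \<and> e < m}"
  have "E \<subseteq> {l, m} \<union> D"
  proof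
    fix e assume e: "e \<in> E"
    obtain f where f: "l * m = e * f" using e unfolding E_def by auto
    have big: "l \<le> t" if t: "t dvd l * m" "t > 1" for t
    proof -
      obtain r where r: "prime r" "r dvd t" using prime_factor_nat[of t] t(2) by auto
      have "l \<le> r" using min[OF r(1)] r(2) t(1) by (metis dvd_trans)
      also have "r \<le> t" using r(2) t(2) by (intro dvd_imp_le) auto
      finally show ?thesis .
    qed
    have "f > 1" using e f unfolding E_def by (cases "f = 0 \<or> f = 1") auto
    hence "l \<le> e" "l \<le> f" using big e f unfolding E_def by auto
    moreover have "e \<le> m"
    proof (rule ccontr)
      assume "\<not> e \<le> m"
      hence "m * l < e * l" using l2 by simp
      also have "\<dots> \<le> e * f" using \<open>l \<le> f\<close> by simp
      finally show False using f by (metis mult.commute nat_less_le)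
    qed
    ultimately show "e \<in> {l, m} \<union> D" using e unfolding E_def D_def by auto
  qed
  moreover have finD: "finite D" unfolding D_def by simp
  ultimately have "(\<Sum>e\<in>E. q ^ (e + l * m div e - 2)) \<le> (\<Sum>e\<in>{l, m} \<union> D. q ^ (e + l * m div e - 2))"
    using q2 by (intro sum_mono2) auto
  also have "\<dots> = (\<Sum>e\<in>{l, m}. q ^ (e + l * m div e - 2)) + (\<Sum>e\<in>D. q ^ (e + l * m div e - 2))"
    by (intro sum.union_disjoint finD) (auto simp: D_def)
  finally have up: "(\<Sum>e\<in>E. q ^ (e + l * m div e - 2))
      \<le> (\<Sum>e\<in>{l, m}. q ^ (e + l * m div e - 2)) + (\<Sum>e\<in>D. q ^ (e + l * m div e - 2))" .
  have "l * m \<ge> 1" using l2 lm by (metis One_nat_def Suc_leI le_trans mult_pos_pos not_less numeral_2_eq_2 zero_less_Suc le_zero_eq neq0_conv)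
  from card_monic_decomposables_le[OF this, where ?'a = 'a]
  have "K \<le> real (\<Sum>e\<in>E. CARD('a) ^ (e + l * m div e - 2))"
    unfolding K_def E_def by (rule of_nat_mono)
  hence K: "K \<le> (\<Sum>e\<in>E. q ^ (e + l * m div e - 2))" unfolding q_def by simp
  have dm: "l * m div l = m" "l * m div m = l" using l2 lm by auto
  show "K \<le> q ^ (l + m - 2)" if "l = m"
  proof -
    have "D = {}" unfolding D_def that by auto
    thus ?thesis using K up dm that by simp
  qed
  show "K \<le> 2 * q ^ (l + m - 2) * (1 + q powr (- real m / (3 * real l)))" if "l < m"
  proof -
    have "q ^ 2 * (\<Sum>e\<in>D. q ^ (e + l * m div e - 2)) = (\<Sum>e\<in>D. q ^ (e + l * m div e))"
      unfolding sum_distrib_left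
    proof (rule sum.cong[OF refl])
      fix e assume "e \<in> D"
      hence "e \<ge> 2" using l2 unfolding D_def by simp
      hence "2 + (e + l * m div e - 2) = e + l * m div e" by simp
      thus "q ^ 2 * q ^ (e + l * m div e - 2) = q ^ (e + l * m div e)" by (metis power_add)
    qed
    also have "\<dots> \<le> 2 * q powr (real l + real m - real m / (3 * real l))"
      unfolding D_def by (rule middle_divisor_sum[OF l min q2])
    also have "\<dots> = 2 * (q powr real (l + m) * q powr (- real m / (3 * real l)))"
      by (simp add: powr_add[symmetric])
    also have "q powr real (l + m) = q ^ (l + m)" using q2 by (simp add: powr_realpow del: of_nat_add)
    also have "q ^ (l + m) = q ^ 2 * q ^ (l + m - 2)"
    proof -
      have "l + m = 2 + (l + m - 2)" using l2 by simp
      thus ?thesis by (metis power_add)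
    qed
    finally have "q ^ 2 * (\<Sum>e\<in>D. q ^ (e + l * m div e - 2))
       \<le> q ^ 2 * (2 * q ^ (l + m - 2) * q powr (- real m / (3 * real l)))" by (simp add: mult_ac)
    hence "(\<Sum>e\<in>D. q ^ (e + l * m div e - 2)) \<le> 2 * q ^ (l + m - 2) * q powr (- real m / (3 * real l))"
      using q2 by (subst (asm) mult_le_cancel_left_pos) auto
    moreover have "(\<Sum>e\<in>{l, m}. q ^ (e + l * m div e - 2)) = 2 * q ^ (l + m - 2)"
      using that by (simp add: dm add.commute)
    ultimately show ?thesis using K up by (simp add: algebra_simps)
  qed
qed

text \<open>If p \<noteq> l, the tame family of left degree l alone has Y elements. If p = l < m,
  the cofactor m is either prime to p or at least 2 p, and both cases are settled above. Only p = l
  = m falls below Y, to Y / 2.\<close>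

lemma card_monic_decomposables_lower:
  fixes l m :: nat
  defines "q \<equiv> real CARD('a::{field,finite})" and "p \<equiv> CHAR('a)"
  defines "K \<equiv> real (card (monic_decomposables (l * m) :: 'a poly set))" and "Y \<equiv> q ^ (l + m - 2)"
  assumes l: "prime l" and least: "\<forall>r. prime r \<longrightarrow> r dvd l * m \<longrightarrow> l \<le> r" and lm: "l \<le> m"
  shows "p \<noteq> l \<Longrightarrow> Y \<le> K"
    and "Y \<le> 2 * K"
    and "l < m \<Longrightarrow> Y \<le> K"
    and "l < m \<Longrightarrow> \<not> (p = l \<and> p ^ 2 dvd l * m \<and> \<not> p ^ 3 dvd l * m) \<Longrightarrow> 2 * Y * (1 - 2 / q) \<le> K"
    and "l < m \<Longrightarrow> q > 5 \<Longrightarrow> (3 / 2 - 1 / q) * Y \<le> K"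
    and "l < m \<Longrightarrow> \<not> p dvd l * m \<Longrightarrow> 2 * Y * (1 - q powr (- real m / (3 * real l))) \<le> K"
proof -
  note min = least[rule_format]
  have l2: "l \<ge> 2" by (rule prime_ge_2_nat[OF l])
  have p: "prime p" "p \<ge> 2" unfolding p_def using prime_CHAR_finite prime_ge_2_nat by blast+
  have m2: "m \<ge> 2" using l2 lm by simp
  have q2: "q \<ge> 2" unfolding q_def using CARD_ge_2[where ?'a = 'a] by simp
  have Y0: "Y > 0" unfolding Y_def using q2 by simp
  have cq: "real (CARD('a) ^ n) = q ^ n" for n unfolding q_def by simp
  define U where "U = real (card (compositions l m \<union> compositions m l :: 'a poly set))"
  have UK: "U \<le> K" unfolding U_def K_def
    using card_compositions_Un_le_monic_decomposables[OF l2 m2, where ?'a = 'a] by (rule of_nat_mono)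
  have qY: "Y / q = q ^ (l + m - 3)"
  proof -
    have "l + m - 2 = Suc (l + m - 3)" using l2 m2 by linarith
    thus ?thesis unfolding Y_def using q2 by simp
  qed
  have two: "2 * Y * (1 - 1 / q) \<le> K" if "2 * CARD('a) ^ (l + m - 2)
         \<le> card (compositions l m \<union> compositions m l :: 'a poly set) + 2 * CARD('a) ^ (l + m - 3)"
  proof -
    have "real (2 * CARD('a) ^ (l + m - 2))
         \<le> real (card (compositions l m \<union> compositions m l :: 'a poly set) + 2 * CARD('a) ^ (l + m - 3))"
      using that by (rule of_nat_mono)
    hence "2 * q ^ (l + m - 2) \<le> U + 2 * q ^ (l + m - 3)"
      unfolding of_nat_add of_nat_mult cq U_def by simp
    hence "2 * Y \<le> U + 2 * (Y / q)" unfolding qY[symmetric] Y_def[symmetric] .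
    moreover have "2 * Y * (1 - 1 / q) = 2 * Y - 2 * (Y / q)" by (simp add: right_diff_distrib)
    ultimately show ?thesis using UK by linarith
  qed
  have nd: "\<not> p dvd l" if "p \<noteq> l" using that p(1) l primes_dvd_imp_eq by blast
  show notl: "Y \<le> K" if "p \<noteq> l"
  proof -
    have "card (compositions l m :: 'a poly set) = CARD('a) ^ (l + m - 2)"
      using card_compositions_tame[of l m, where ?'a = 'a] nd[OF that] l2 m2 unfolding p_def by simp
    moreover have "card (compositions l m :: 'a poly set)
       \<le> card (compositions l m \<union> compositions m l :: 'a poly set)"
      by (intro card_mono) (auto simp: finite_compositions)
    ultimately have "Y \<le> U" unfolding U_def Y_def cq[symmetric] by simp
    thus ?thesis using UK by simp
  qed
  have mmin: "p \<le> r" if "p = l" "prime r" "r dvd m" for r using min[of r] that by simp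
  have pm_big: "m \<ge> 2 * p" if "p = l" "p dvd m" "l < m"
  proof -
    have "m = p * (m div p)" using that(2) by simp
    then obtain k where k: "m = p * k" by blast
    have "k \<noteq> 0" "k \<noteq> 1" using that k m2 by auto
    hence "k \<ge> 2" by linarith
    thus ?thesis unfolding k by simp
  qed
  have YW: "Y = q ^ 2 * q ^ (p + m - 4)" if "p = l" "l < m"
  proof -
    have "p + m - 2 = 2 + (p + m - 4)" using that p by linarith
    thus ?thesis unfolding Y_def that(1)[symmetric] by (metis power_add)
  qed
  note wild = wild_cofactor_bounds[where ?'a = 'a and m = m, folded p_def q_def]
  have tame_cof: "2 * Y * (1 - 1 / q) \<le> K" if "p = l" "\<not> p dvd m"
  proof (rule two)
    have "m > p" using that lm by (metis dvd_refl le_neq_implies_less)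
    thus "2 * CARD('a) ^ (l + m - 2)
         \<le> card (compositions l m \<union> compositions m l :: 'a poly set) + 2 * CARD('a) ^ (l + m - 3)"
      using card_compositions_Un_tame_cofactor[where ?'a = 'a and m = m] that mmin
      unfolding p_def by blast
  qed
  have half: "1 / q \<le> 1 / 2" using q2 by (simp add: field_simps)
  have halfY: "Y \<le> 2 * Y * (1 - 1 / q)" using mult_left_mono[OF half, of "2 * Y"] Y0 by (simp add: algebra_simps)
  show ge_Y: "Y \<le> K" if lm': "l < m"
  proof (cases "p = l")
    case True
    show ?thesis
    proof (cases "p dvd m")
      case pm: True
      have "q ^ 2 * q ^ (p + m - 4) \<le> U"
        using wild(1)[OF pm pm_big[OF True pm lm'] mmin[OF True]] True unfolding U_def by simp
      thus ?thesis using YW[OF True lm'] UK by linarith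
    qed (use tame_cof[OF True] halfY in linarith)
  qed (rule notl)
  show "Y \<le> 2 * K"
  proof (cases "p = l \<and> l = m")
    case True
    have "CARD('a) ^ (2 * p - 2) \<le> 2 * card (compositions p p :: 'a poly set)"
      using card_compositions_CHAR_CHAR[where ?'a = 'a] unfolding p_def .
    hence "real (CARD('a) ^ (2 * p - 2)) \<le> real (2 * card (compositions p p :: 'a poly set))"
      by (rule of_nat_mono)
    moreover have "2 * p - 2 = l + m - 2" using True by simp
    moreover have "compositions l m \<union> compositions m l = (compositions p p :: 'a poly set)"
      using True by simp
    ultimately have "Y \<le> 2 * U" unfolding U_def cq Y_def by simp
    thus ?thesis using UK by linarith
  next
    case False
    hence "Y \<le> K" using notl ge_Y lm by (cases "l = m") auto
    thus ?thesis using Y0 by linarith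
  qed
  show C: "2 * Y * (1 - 2 / q) \<le> K"
    if lm': "l < m" and nex: "\<not> (p = l \<and> p ^ 2 dvd l * m \<and> \<not> p ^ 3 dvd l * m)"
  proof -
    have weaker: "2 * Y * (1 - 2 / q) \<le> 2 * Y * (1 - 1 / q)"
      using Y0 q2 by (intro mult_left_mono) (auto simp: field_simps)
    show ?thesis
    proof (cases "p = l")
      case True
      show ?thesis
      proof (cases "p dvd m")
        case pm: True
        have "p ^ 2 dvd p * m" unfolding power2_eq_square by (rule mult_dvd_mono[OF dvd_refl pm])
        hence "p ^ 3 dvd p * m" using nex True by metis
        moreover have "p * p ^ 2 = p ^ 3" by (simp add: power3_eq_cube power2_eq_square)
        ultimately have "p * p ^ 2 dvd p * m" by metis
        hence sq: "p ^ 2 dvd m" using p by simp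
        have "2 * (q ^ 2 - 2 * q) * q ^ (p + m - 4) \<le> U"
          using wild(2)[OF pm pm_big[OF True pm lm'] mmin[OF True] sq] True unfolding U_def by simp
        moreover have "2 * (q ^ 2 - 2 * q) * q ^ (p + m - 4) = 2 * Y * (1 - 2 / q)"
          unfolding YW[OF True lm'] using q2 by (simp add: field_simps power2_eq_square)
        ultimately show ?thesis using UK by linarith
      qed (use tame_cof[OF True] weaker in linarith)
    next
      case False
      show ?thesis
      proof (cases "p dvd m")
        case True
        have "l \<le> p" using min[of p] p True by simp
        hence "l < p" using False by simp
        have "2 * CARD('a) ^ (l + m - 2)
         \<le> card (compositions l m \<union> compositions m l :: 'a poly set) + 2 * CARD('a) ^ (l + m - 3)"
          using card_compositions_Un_wild_left[OF l, where ?'a = 'a and m = m] \<open>l < p\<close> True m2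
          unfolding p_def by simp
        from two[OF this] weaker show ?thesis by linarith
      next
        case pm: False
        have "CARD('a) ^ (2 * l - 3 + m div l) \<le> CARD('a) ^ (l + m - 3)"
          using add_div_le[OF l2 lm'] l2 CARD_ge_2[where ?'a = 'a] by (intro power_increasing) auto
        hence "2 * CARD('a) ^ (l + m - 2)
         \<le> card (compositions l m \<union> compositions m l :: 'a poly set) + 2 * CARD('a) ^ (l + m - 3)"
          using card_compositions_Un_coprime[OF l2 _ _ m2, where ?'a = 'a] nd[OF False] pm
          unfolding p_def by fastforce
        from two[OF this] weaker show ?thesis by linarith
      qed
    qed
  qed
  show "(3 / 2 - 1 / q) * Y \<le> K" if lm': "l < m" and q5: "q > 5"
  proof (cases "p = l \<and> p ^ 2 dvd l * m \<and> \<not> p ^ 3 dvd l * m")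
    case True
    hence pl: "p = l" by simp
    have "p ^ 2 dvd p * m" using True by metis
    hence "p * p dvd p * m" by (simp only: power2_eq_square)
    hence pm: "p dvd m" using p by simp
    have sq: "\<not> p ^ 2 dvd m"
    proof
      assume "p ^ 2 dvd m"
      hence "p * p ^ 2 dvd p * m" by (rule mult_dvd_mono[OF dvd_refl])
      moreover have "p * p ^ 2 = p ^ 3" by (simp add: power3_eq_cube power2_eq_square)
      ultimately show False using True by metis
    qed
    have "(3 / 2 * q ^ 2 - q) * q ^ (p + m - 4) \<le> U"
      using wild(3)[OF pm pm_big[OF pl pm lm'] mmin[OF pl] sq q5] pl unfolding U_def by simp
    moreover have "(3 / 2 * q ^ 2 - q) * q ^ (p + m - 4) = (3 / 2 - 1 / q) * Y"
      unfolding YW[OF pl lm'] using q2 by (simp add: field_simps power2_eq_square)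
    ultimately show ?thesis using UK by linarith
  next
    case False
    have q6: "q \<ge> 6" using q5 unfolding q_def by simp
    \<comment> \<open>Equivalent to 3 / q \<le> 1 / 2, that is, to q \<ge> 6.\<close>
    have "3 / 2 - 1 / q \<le> 2 * (1 - 2 / q)" using q6 by (simp add: field_simps)
    hence "(3 / 2 - 1 / q) * Y \<le> 2 * (1 - 2 / q) * Y" using Y0 by (intro mult_right_mono) auto
    also have "\<dots> = 2 * Y * (1 - 2 / q)" by simp
    finally show ?thesis using C[OF lm' False] by linarith
  qed
  show "2 * Y * (1 - q powr (- real m / (3 * real l))) \<le> K" if lm': "l < m" and pd: "\<not> p dvd l * m"
  proof -
    have pl: "\<not> p dvd l" and pm: "\<not> p dvd m" using pd by auto
    have "2 * CARD('a) ^ (l + m - 2)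
         \<le> card (compositions l m \<union> compositions m l :: 'a poly set) + CARD('a) ^ (2 * l - 3 + m div l)"
      using card_compositions_Un_coprime[OF l2 _ _ m2, where ?'a = 'a] pl pm unfolding p_def by simp
    hence "real (2 * CARD('a) ^ (l + m - 2))
         \<le> real (card (compositions l m \<union> compositions m l :: 'a poly set) + CARD('a) ^ (2 * l - 3 + m div l))"
      by (rule of_nat_mono)
    hence A: "2 * Y \<le> U + q ^ (2 * l - 3 + m div l)"
      unfolding of_nat_add of_nat_mult cq Y_def U_def by simp
    have "q ^ (2 * l - 3 + m div l) = q powr real (2 * l - 3 + m div l)"
      using q2 by (simp only: powr_realpow)
    also have "\<dots> \<le> q powr (real (l + m - 2) + (- real m / (3 * real l)))"
    proof (rule powr_mono)
      obtain a where a: "l = a + 2" using l2 by (metis add.commute le_Suc_ex)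
      obtain b where b: "m = a + 3 + b" using lm' unfolding a by (metis Suc_leI add_Suc_right le_Suc_ex numeral_3_eq_3 numeral_2_eq_2)
      \<comment> \<open>Equality holds at l = 2, m = 3. Of the 4 m, one m comes from the error
        exponent and 3 m bounds 3 l (m div l).\<close>
      have "3 * l * (2 * l) + 4 * m \<le> 3 * l * (l + m + 1)"
        unfolding a b by (simp add: algebra_simps)
      moreover have "3 * (l * (m div l)) \<le> 3 * m" by simp
      ultimately have "3 * l * (2 * l) + m + 3 * l * (m div l) \<le> 3 * l * (l + m + 1)" by linarith
      hence "real (3 * l * (2 * l) + m + 3 * l * (m div l)) \<le> real (3 * l * (l + m + 1))"
        by (rule of_nat_mono)
      moreover have "real (2 * l - 3 + m div l) = 2 * real l - 3 + real (m div l)"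
        using l2 by (simp add: of_nat_diff)
      moreover have "real (l + m - 2) = real l + real m - 2" using l2 by (simp add: of_nat_diff)
      ultimately show "real (2 * l - 3 + m div l) \<le> real (l + m - 2) + (- real m / (3 * real l))"
        using l2 by (simp add: field_simps)
    qed (use q2 in auto)
    also have "\<dots> = Y * q powr (- real m / (3 * real l))"
      unfolding powr_add Y_def using q2 by (simp only: powr_realpow)
    also have "\<dots> \<le> 2 * (Y * q powr (- real m / (3 * real l)))" using Y0 by simp
    finally show ?thesis using A UK by (simp add: algebra_simps)
  qed
qed

theorem mainTheorem1:
  fixes d l :: nat
  assumes d_ge: "d \<ge> 2" and d_comp: "\<not> prime d"
    and l_prime: "prime l" and l_dvd: "l dvd d"
    and l_min: "\<And>r. prime r \<Longrightarrow> r dvd d \<Longrightarrow> l \<le> r"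
  defines "q \<equiv> card (UNIV :: 'a::{field,finite} set)"
    and "p \<equiv> CHAR('a)"
    and "N \<equiv> real (card (decomp_set d :: 'a poly set))"
    and "\<alpha> \<equiv> alpha_d (card (UNIV :: 'a set)) d l"
  shows
    "(real q powr (2 * sqrt (real d)) / 2 \<le> \<alpha> \<and> \<alpha> < 2 * real q powr (real d / 2 + 2))
     \<and> (\<alpha> / 2 \<le> N \<and> N \<le> \<alpha> * (1 + real q powr (- real d / (3 * real l ^ 2)))
        \<and> \<alpha> * (1 + real q powr (- real d / (3 * real l ^ 2))) < 2 * \<alpha>
        \<and> 2 * \<alpha> < 4 * real q powr (real d / 2 + 2))
     \<and> (d \<noteq> p^2 \<and> q > 5 \<longrightarrow>
          N \<ge> (3 - 2 / real q) * \<alpha> / 4 \<and> (3 - 2 / real q) * \<alpha> / 4 \<ge> real q powr (2 * sqrt (real d)) / 2)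
     \<and> (\<not> (p = l \<and> p^2 dvd d \<and> \<not> p^3 dvd d) \<longrightarrow> N \<ge> \<alpha> * (1 - 2 / real q))
     \<and> (\<not> p dvd d \<longrightarrow> \<bar>N - \<alpha>\<bar> \<le> \<alpha> * real q powr (- real d / (3 * real l ^ 2)))"
proof -
  have l2: "l \<ge> 2" by (rule prime_ge_2_nat[OF l_prime])
  have d_eq: "d = l * (d div l)" using l_dvd by simp
  obtain m where d: "d = l * m" using d_eq by blast
  have m1: "m \<noteq> 1" using d d_comp l_prime by auto
  have m0: "m \<noteq> 0" using d d_ge by (metis mult_0_right not_numeral_le_zero)
  have lm: "l \<le> m"
  proof -
    obtain r where r: "prime r" "r dvd m" using prime_factor_nat[OF m1] by blast
    have "l \<le> r" by (rule l_min[OF r(1)]) (use r(2) in \<open>simp add: d\<close>)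
    also have "r \<le> m" using r(2) m0 by (intro dvd_imp_le) auto
    finally show ?thesis .
  qed
  have m2: "m \<ge> 2" using lm l2 by simp
  define Q where "Q = real q"
  define Y where "Y = Q ^ (l + m - 2)"
  \<comment> \<open>\<open>c\<close> is the number of affine maps, so N = c K, while \<alpha> is c Y
    for l = m and 2 c Y for l < m. Everything is thereby reduced to comparing K with Y.\<close>
  define c where "c = Q * (Q - 1)"
  define K where "K = real (card (monic_decomposables (l * m) :: 'a poly set))"
  define \<rho> where "\<rho> = Q powr (- real m / (3 * real l))"
  have qn2: "q \<ge> 2" unfolding q_def by (rule CARD_ge_2)
  have Q2: "Q \<ge> 2" unfolding Q_def using qn2 by simp
  have Y0: "Y > 0" unfolding Y_def using Q2 by simp
  have c0: "c > 0" unfolding c_def using Q2 by simp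
  have QY: "Q ^ (l + m) = Q ^ 2 * Y"
  proof -
    have "l + m = 2 + (l + m - 2)" using l2 by simp
    thus ?thesis unfolding Y_def by (metis power_add)
  qed
  have cY: "c * Y = Q ^ (l + m) * (1 - 1 / Q)"
    unfolding QY c_def using Q2 by (simp add: field_simps power2_eq_square)
  have N: "N = c * K"
  proof -
    have "card (decomp_set d :: 'a poly set) = (q - 1) * q * card (monic_decomposables (l * m) :: 'a poly set)"
      unfolding q_def d[symmetric] by (rule card_decomp_set) (use d_ge in simp)
    thus ?thesis unfolding N_def c_def K_def Q_def using qn2 by (simp add: of_nat_diff)
  qed
  have \<alpha>_lt: "\<alpha> = 2 * (c * Y)" if "l < m"
  proof -
    have "d \<noteq> l ^ 2" using that l2 unfolding d power2_eq_square by simp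
    moreover have "real l + real d / real l = real (l + m)" using l2 by (simp add: d)
    ultimately have "\<alpha> = 2 * Q powr real (l + m) * (1 - 1 / Q)"
      unfolding \<alpha>_def alpha_d_def Q_def q_def by simp
    also have "Q powr real (l + m) = Q ^ (l + m)" using Q2 by (intro powr_realpow) simp
    finally show ?thesis unfolding cY by simp
  qed
  have \<alpha>_eq: "\<alpha> = c * Y" if "l = m"
  proof -
    have "d = l ^ 2" unfolding d power2_eq_square that ..
    moreover have "2 * real l = real (l + m)" using that by simp
    ultimately have "\<alpha> = Q powr real (l + m) * (1 - 1 / Q)"
      unfolding \<alpha>_def alpha_d_def Q_def q_def by simp
    also have "Q powr real (l + m) = Q ^ (l + m)" using Q2 by (intro powr_realpow) simp
    finally show ?thesis unfolding cY by simp
  qed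
  have cY0: "c * Y > 0" using c0 Y0 by simp
  have "\<alpha> = c * Y \<or> \<alpha> = 2 * (c * Y)" using \<alpha>_lt \<alpha>_eq lm by (cases "l = m") auto
  hence \<alpha>_ge: "c * Y \<le> \<alpha>" and \<alpha>_le: "\<alpha> \<le> 2 * (c * Y)" and \<alpha>0: "\<alpha> > 0"
    using cY0 by linarith+
  have exponent: "- real d / (3 * real l ^ 2) = - real m / (3 * real l)"
    using l2 by (simp add: d power2_eq_square)
  have \<rho>: "0 < \<rho>" "\<rho> < 1"
  proof -
    show "0 < \<rho>" unfolding \<rho>_def using Q2 by simp
    have "- real m / (3 * real l) < 0" using l2 m2 by simp
    hence "Q powr (- real m / (3 * real l)) < Q powr 0" using Q2 by (intro powr_less_mono) auto
    thus "\<rho> < 1" unfolding \<rho>_def using Q2 by simp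
  qed
  have min: "\<forall>r. prime r \<longrightarrow> r dvd l * m \<longrightarrow> l \<le> r" using l_min unfolding d by blast
  note upper = card_monic_decomposables_upper[OF l_prime min lm, where ?'a = 'a,
      folded q_def, folded Q_def, folded Y_def K_def \<rho>_def]
  note lower = card_monic_decomposables_lower[OF l_prime min lm, where ?'a = 'a,
      folded q_def p_def, folded Q_def, folded Y_def K_def \<rho>_def]
  have lbN: "c * x \<le> N" if "x \<le> K" for x unfolding N using that c0 by simp
  have sqrt_le: "Q powr (2 * sqrt (real d)) \<le> Q ^ (l + m)"
  proof -
    have "sqrt (real l * real m) \<le> (real l + real m) / 2" by (rule arith_geo_mean_sqrt) auto
    hence "2 * sqrt (real d) \<le> real (l + m)" unfolding d by simp
    hence "Q powr (2 * sqrt (real d)) \<le> Q powr real (l + m)" using Q2 by (intro powr_mono) auto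
    also have "\<dots> = Q ^ (l + m)" using Q2 by (intro powr_realpow) simp
    finally show ?thesis .
  qed
  have P1: "Q powr (2 * sqrt (real d)) / 2 \<le> \<alpha>"
  proof -
    have "1 / 2 \<le> 1 - 1 / Q" using Q2 by (simp add: field_simps)
    hence "Q ^ (l + m) * (1 / 2) \<le> c * Y" unfolding cY using Q2 by (intro mult_left_mono) auto
    with sqrt_le \<alpha>_ge show ?thesis by linarith
  qed
  have P2: "\<alpha> < 2 * Q powr (real d / 2 + 2)"
  proof -
    have "1 - 1 / Q < 1" using Q2 by simp
    hence "c * Y < Q ^ (l + m) * 1" unfolding cY using Q2 by (intro mult_strict_left_mono) auto
    hence "c * Y < Q powr real (l + m)" using Q2 by (simp add: powr_realpow del: of_nat_add)
    also have "\<dots> \<le> Q powr (real d / 2 + 2)"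
    proof (rule powr_mono)
      obtain a where a: "l = a + 2" using l2 by (metis add.commute le_Suc_ex)
      obtain b where b: "m = b + 2" using m2 by (metis add.commute le_Suc_ex)
      \<comment> \<open>Equivalent to (l - 2)(m - 2) \<ge> 0.\<close>
      have "2 * (l + m) \<le> l * m + 4" unfolding a b by (simp add: algebra_simps)
      hence "real (2 * (l + m)) \<le> real (l * m + 4)" by (rule of_nat_mono)
      thus "real (l + m) \<le> real d / 2 + 2" unfolding d by simp
    qed (use Q2 in simp)
    finally show ?thesis using \<alpha>_le by linarith
  qed
  have P3: "\<alpha> / 2 \<le> N"
  proof (cases "l = m")
    case True
    have "Y / 2 \<le> K" using lower(2) by simp
    from lbN[OF this] show ?thesis unfolding \<alpha>_eq[OF True] by simp
  next
    case False
    hence "l < m" using lm by simp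
    from lbN[OF lower(3)[OF this]] show ?thesis unfolding \<alpha>_lt[OF \<open>l < m\<close>] by simp
  qed
  have P4: "N \<le> \<alpha> * (1 + \<rho>)"
  proof (cases "l = m")
    case True
    have "N \<le> c * Y" unfolding N using upper(1)[OF True] c0 by simp
    also have "c * Y * 1 \<le> c * Y * (1 + \<rho>)" using cY0 \<rho> by (intro mult_left_mono) auto
    hence "c * Y \<le> c * Y * (1 + \<rho>)" by simp
    finally show ?thesis unfolding \<alpha>_eq[OF True] .
  next
    case False
    hence lt: "l < m" using lm by simp
    have "N \<le> c * (2 * Y * (1 + \<rho>))" unfolding N using upper(2)[OF lt] c0 by simp
    thus ?thesis unfolding \<alpha>_lt[OF lt] by (simp only: mult_ac)
  qed
  have P5: "\<alpha> * (1 + \<rho>) < 2 * \<alpha>" using \<alpha>0 \<rho> by simp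
  have P6: "N \<ge> \<alpha> * (1 - 2 / Q)" if nex: "\<not> (p = l \<and> p ^ 2 dvd d \<and> \<not> p ^ 3 dvd d)"
  proof (cases "l = m")
    case True
    \<comment> \<open>d = l^2 is divisible by l^2 but not by l^3, so p = l would be the excluded
      case.\<close>
    have "p \<noteq> l"
    proof
      assume pl: "p = l"
      have "\<not> l * l * l dvd l * l" using l2 by (auto dest!: dvd_imp_le)
      with nex True pl show False unfolding d by (simp add: power2_eq_square power3_eq_cube)
    qed
    from lbN[OF lower(1)[OF this]] have "\<alpha> \<le> N" unfolding \<alpha>_eq[OF True] .
    moreover have "\<alpha> * (1 - 2 / Q) \<le> \<alpha> * 1" using \<alpha>0 Q2 by (intro mult_left_mono) auto
    ultimately show ?thesis by simp
  next
    case False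
    hence lt: "l < m" using lm by simp
    from lbN[OF lower(4)[OF lt nex[unfolded d]]]
    show ?thesis unfolding \<alpha>_lt[OF lt] by (simp only: mult_ac)
  qed
  define X where "X = (3 - 2 / Q) * \<alpha>"
  have P7: "N \<ge> (3 - 2 / Q) * \<alpha> / 4" if dp: "d \<noteq> p ^ 2" and q5: "q > 5"
  proof (cases "l = m")
    case True
    have "p \<noteq> l" using dp True unfolding d by (auto simp: power2_eq_square)
    from lbN[OF lower(1)[OF this]] have "\<alpha> \<le> N" unfolding \<alpha>_eq[OF True] .
    moreover have "2 / Q \<ge> 0" using Q2 by simp
    hence "X \<le> 4 * \<alpha>" unfolding X_def using \<alpha>0 by (intro mult_right_mono) linarith+
    ultimately show ?thesis unfolding X_def[symmetric] by linarith
  next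
    case False
    hence lt: "l < m" using lm by simp
    have "Q > 5" using q5 unfolding Q_def by simp
    from lbN[OF lower(5)[OF lt this]] have "c * ((3 / 2 - 1 / Q) * Y) \<le> N" .
    also have "c * ((3 / 2 - 1 / Q) * Y) = (3 - 2 / Q) * \<alpha> / 4"
      unfolding \<alpha>_lt[OF lt] using Q2 by (simp add: field_simps)
    finally show ?thesis .
  qed
  have P8: "(3 - 2 / Q) * \<alpha> / 4 \<ge> Q powr (2 * sqrt (real d)) / 2" if q5: "q > 5"
  proof -
    have Q6: "Q \<ge> 6" using q5 unfolding Q_def by simp
    \<comment> \<open>Together with \<alpha> \<ge> 5/6 Q^(l + m) this yields the factor 8/3 times
      5/6 divided by 4, which is 5/9 > 1/2.\<close>
    have "8 / 3 \<le> 3 - 2 / Q" using Q6 by (simp add: field_simps)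
    hence "8 / 3 * \<alpha> \<le> X" unfolding X_def using \<alpha>0 by (intro mult_right_mono) auto
    moreover have "5 / 6 \<le> 1 - 1 / Q" using Q6 by (simp add: field_simps)
    hence "Q ^ (l + m) * (5 / 6) \<le> c * Y" unfolding cY using Q2 by (intro mult_left_mono) auto
    moreover have "Q ^ (l + m) \<ge> 0" using Q2 by simp
    ultimately show ?thesis unfolding X_def[symmetric] using sqrt_le \<alpha>_ge by linarith
  qed
  have P9: "\<bar>N - \<alpha>\<bar> \<le> \<alpha> * \<rho>" if pd: "\<not> p dvd d"
  proof -
    have "\<alpha> * (1 - \<rho>) \<le> N"
    proof (cases "l = m")
      case True
      have "p \<noteq> l" using pd unfolding d by auto
      from lbN[OF lower(1)[OF this]] have "\<alpha> \<le> N" unfolding \<alpha>_eq[OF True] .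
      moreover have "\<alpha> * (1 - \<rho>) \<le> \<alpha> * 1" using \<alpha>0 \<rho> by (intro mult_left_mono) auto
      ultimately show ?thesis by simp
    next
      case False
      hence lt: "l < m" using lm by simp
      from lbN[OF lower(6)[OF lt pd[unfolded d]]]
      show ?thesis unfolding \<alpha>_lt[OF lt] by (simp only: mult_ac)
    qed
    hence "\<alpha> - \<alpha> * \<rho> \<le> N" by (simp only: right_diff_distrib mult_1_right)
    moreover have "N \<le> \<alpha> + \<alpha> * \<rho>" using P4 by (simp only: distrib_left mult_1_right)
    ultimately show ?thesis by linarith
  qed
  show ?thesis
    unfolding exponent Q_def[symmetric] \<rho>_def[symmetric]
    using P1 P2 P3 P4 P5 P6 P7 P8 P9 by auto
qed

end
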